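(* Let $\mathfrak{g}$ be a six-dimensional strongly unimodular almost nilpotent real Lie algebra whose nilradical $\mathfrak{n}$ satisfies $\dim\mathfrak{n}^1=1$, where $\mathfrak{n}^1=[\mathfrak{n},\mathfrak{n}]$. Then every complex structure $J$ on $\mathfrak{g}$ satisfying $J\mathfrak{n}^1\not\subset\mathfrak{n}$ admits a basis of $(1,0)$-forms $\{\alpha^1,\alpha^2,\alpha^3\}$ whose structure equations appear in the following list, according to the isomorphism class of $\mathfrak{g}$ (which is necessarily one of those listed). Write $\sigma=\alpha^1-\alpha^{\bar1}$. \begin{itemize} \item $\mathfrak{h}_3\oplus\mathfrak{s}_{3.3}^0$: $d\alpha^1=i\varepsilon\alpha^{3\bar3}$, $d\alpha^2=-\alpha^2\wedge\sigma$, $d\alpha^3=0$, with $\varepsilon\in\{-1,1\}$. \item $\mathfrak{s}_{4.7}\oplus\mathbb{R}^2$: $d\alpha^1=i\varepsilon\alpha^{2\bar2}$, $d\alpha^2=-\alpha^2\wedge\sigma$, $d\alpha^3=0$, with $\varepsilon\in\{-1,1\}$. \item $\mathfrak{s}_{6.44}$: $d\alpha^1=i\varepsilon\alpha^{3\bar3}$, $d\alpha^2=-(\alpha^2+i\alpha^3)\wedge\sigma$, $d\alpha^3=-\alpha^3\wedge\sigma$, with $\varepsilon\in\{-1,1\}$. \item $\mathfrak{s}_{6.52}^{0,q}$, $q>0$: $d\alpha^1=i\delta\alpha^{2\bar2}$, $d\alpha^2=-\alpha^2\wedge\sigma$, $d\alpha^3=-\varepsilon q\,\alpha^3\wedge\sigma$,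 with $\delta,\varepsilon\in\{-1,1\}$. \item $\mathfrak{s}_{6.159}$: $d\alpha^1=i\delta\alpha^{2\bar2}+i\varepsilon\alpha^{3\bar3}$, $d\alpha^2=-\alpha^2\wedge\sigma$, $d\alpha^3=0$, with $\delta,\varepsilon\in\{-1,1\}$. \item $\mathfrak{s}_{6.162}^1$: $d\alpha^1=\alpha^{2\bar3}-\alpha^{3\bar2}$, $d\alpha^2=-i\alpha^2\wedge\sigma$, $d\alpha^3=i\alpha^3\wedge\sigma$. \item $\mathfrak{s}_{6.165}^p$, $p>0$: $d\alpha^1=\alpha^{2\bar3}-\alpha^{3\bar2}$, $d\alpha^2=-(1+ip)\alpha^2\wedge\sigma$, $d\alpha^3=-(1-ip)\alpha^3\wedge\sigma$. \item $\mathfrak{s}_{6.166}^p$, $0<|p|\le1$: $d\alpha^1=i\delta\alpha^{2\bar2}+i\varepsilon\delta\alpha^{3\bar3}$, $d\alpha^2=-\alpha^2\wedge\sigma$, $d\alpha^3=-\varepsilon p\,\alpha^3\wedge\sigma$, with $\delta,\varepsilon\in\{-1,1\}$. \item $\mathfrak{s}_{6.167}$: $d\alpha^1=\varepsilon\alpha^{2\bar3}-\varepsilon\alpha^{3\bar2}+ix\alpha^{3\bar3}$, $d\alpha^2=-(\alpha^2+i\alpha^3)\wedge\sigma$, $d\alpha^3=-\alpha^3\wedge\sigma$, with $\varepsilon\in\{-1,1\}$, $x\in\mathbb{R}$. \end{itemize}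
   Context: A (real, finite-dimensional) solvable Lie algebra $\mathfrak{g}$ is almost nilpotent if its nilradical $\mathfrak{n}$ has codimension one. It is strongly unimodular if for every $X\in\mathfrak{g}$ and every $k\ge0$ one has $\operatorname{tr}\,\mathrm{ad}_X|_{\mathfrak{n}^k/\mathfrak{n}^{k+1}}=0$, where $\mathfrak{n}^0=\mathfrak{n}$, $\mathfrak{n}^{k+1}=[\mathfrak{n},\mathfrak{n}^k]$. A complex structure on $\mathfrak{g}$ is $J\in\mathrm{End}(\mathfrak{g})$ with $J^2=-\mathrm{Id}$ and $[X,Y]-J[JX,Y]-J[X,JY]-[JX,JY]=0$ for all $X,Y$. A $(1,0)$-form is a complex-valued linear form $\alpha\in\mathfrak{g}^*\otimes\mathbb{C}$ with $\alpha(JX)=i\,\alpha(X)$ for $X \in \mathfrak{g}$; a basis of $(1,0)$-forms is a $\mathbb{C}$-basis of the space of such forms. $\alpha^{\bar k}$ is the complex conjugate of $\alpha^k$, $\alpha^{j\bar k}=\alpha^j\wedge\alpha^{\bar k}$. A six-tuple $(\eta_1,\dots,\eta_6)$ of 2-forms denotes the real Lie algebra with a basis $f_1,\dots,f_6$ whose dual basis satisfies $df^i=\eta_i$ for the Chevalley–Eilenberg differential $df(X,Y)=-f([X,Y])$ (extended complex-linearly to complex forms); $f^{ij}=f^i\wedge f^j$. The Lie algebras in question are: $\mathfrak{h}_3\oplus\mathfrak{s}_{3.3}^0=(f^{23},0,0,f^{56},-f^{46},0)$; $\mathfrak{s}_{4.7}\oplus\mathbb{R}^2=(f^{23},f^{36},-f^{26},0,0,0)$;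 $\mathfrak{s}_{6.44}=(f^{23},f^{36},-f^{26},f^{26}+f^{56},f^{36}-f^{46},0)$; $\mathfrak{s}_{6.52}^{0,q}=(f^{23},f^{36},-f^{26},qf^{56},-qf^{46},0)$; $\mathfrak{s}_{6.159}=(f^{24}+f^{35},0,-f^{56},0,f^{36},0)$; $\mathfrak{s}_{6.162}^1=(f^{24}+f^{35},f^{26},f^{36},-f^{46},-f^{56},0)$; $\mathfrak{s}_{6.165}^p=(f^{24}+f^{35},pf^{26}+f^{36},-f^{26}+pf^{36},-pf^{46}+f^{56},-f^{46}-pf^{56},0)$; $\mathfrak{s}_{6.166}^p=(f^{24}+f^{35},-f^{46},-pf^{56},f^{26},pf^{36},0)$; $\mathfrak{s}_{6.167}=(f^{24}+f^{35},f^{36},-f^{26},f^{26}+f^{56},f^{36}-f^{46},0)$.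
   Formalization: The integrability condition for J is taken with the standard Nijenhuis signs, [X,Y]+J[JX,Y]+J[X,JY]-[JX,JY]=0, instead of the printed [X,Y]-J[JX,Y]-J[X,JY]-[JX,JY]=0, under which the claim is false. *)

theory Defs
  imports Complex_Main "HOL-Library.Function_Algebras"
begin

subsection \<open>Real Lie algebras\<close>

text \<open>A real Lie algebra is a type of class \<open>real_vector\<close> with a bracket \<open>br\<close>. Since the library's
  \<open>dim\<close> is 0 for infinite-dimensional spaces, \<open>dim UNIV = 6\<close> includes finite-dimensionality.\<close>

definition lie_algebra :: "('a::real_vector \<Rightarrow> 'a \<Rightarrow> 'a) \<Rightarrow> bool" where
  "lie_algebra br \<longleftrightarrow>
     (\<forall>X. linear (br X)) \<and> (\<forall>Y. linear (\<lambda>X. br X Y)) \<and>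
     (\<forall>X. br X X = 0) \<and>
     (\<forall>X Y Z. br X (br Y Z) + br Y (br Z X) + br Z (br X Y) = 0)"

definition bracket_span :: "('a::real_vector \<Rightarrow> 'a \<Rightarrow> 'a) \<Rightarrow> 'a set \<Rightarrow> 'a set \<Rightarrow> 'a set" where
  "bracket_span br A B = span {br X Y |X Y. X \<in> A \<and> Y \<in> B}"

primrec lower_central :: "('a::real_vector \<Rightarrow> 'a \<Rightarrow> 'a) \<Rightarrow> 'a set \<Rightarrow> nat \<Rightarrow> 'a set" where
  "lower_central br A 0 = A"
| "lower_central br A (Suc k) = bracket_span br A (lower_central br A k)"

primrec derived_series :: "('a::real_vector \<Rightarrow> 'a \<Rightarrow> 'a) \<Rightarrow> nat \<Rightarrow> 'a set" where
  "derived_series br 0 = UNIV"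
| "derived_series br (Suc k) = bracket_span br (derived_series br k) (derived_series br k)"

definition solvable :: "('a::real_vector \<Rightarrow> 'a \<Rightarrow> 'a) \<Rightarrow> bool" where
  "solvable br \<longleftrightarrow> (\<exists>k. derived_series br k = {0})"

definition nilpotent_ideal :: "('a::real_vector \<Rightarrow> 'a \<Rightarrow> 'a) \<Rightarrow> 'a set \<Rightarrow> bool" where
  "nilpotent_ideal br I \<longleftrightarrow>
     subspace I \<and> (\<forall>X. \<forall>Y\<in>I. br X Y \<in> I) \<and> (\<exists>k. lower_central br I k = {0})"

definition is_nilradical :: "('a::real_vector \<Rightarrow> 'a \<Rightarrow> 'a) \<Rightarrow> 'a set \<Rightarrow> bool" where
  "is_nilradical br N \<longleftrightarrow> nilpotent_ideal br N \<and> (\<forall>I. nilpotent_ideal br I \<longrightarrow> I \<subseteq> N)"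

definition almost_nilpotent :: "('a::real_vector \<Rightarrow> 'a \<Rightarrow> 'a) \<Rightarrow> bool" where
  "almost_nilpotent br \<longleftrightarrow>
     solvable br \<and> (\<exists>N. is_nilradical br N \<and> dim N + 1 = dim (UNIV :: 'a set))"

text \<open>\<open>C\<close> is a basis of \<open>W\<close> and the classes of the elements of \<open>B\<close> form a basis of \<open>V/W\<close>.\<close>

definition quot_basis :: "'a::real_vector set \<Rightarrow> 'a set \<Rightarrow> 'a set \<Rightarrow> 'a set \<Rightarrow> bool" where
  "quot_basis V W B C \<longleftrightarrow>
     B \<inter> C = {} \<and> independent (B \<union> C) \<and> span C = W \<and> span (B \<union> C) = V"

text \<open>Trace of the endomorphism of \<open>V/W\<close> induced by \<open>T\<close>, for \<open>T\<close> preserving the subspaces \<open>W \<subseteq> V\<close>: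
  the sum of the diagonal entries of its matrix in the basis of \<open>V/W\<close> given by \<open>B\<close>
  (as usual, the value does not depend on the basis).\<close>

definition quot_trace :: "('a::real_vector \<Rightarrow> 'a) \<Rightarrow> 'a set \<Rightarrow> 'a set \<Rightarrow> real" where
  "quot_trace T V W =
     (case (SOME (B, C). quot_basis V W B C) of
        (B, C) \<Rightarrow> (\<Sum>b\<in>B. representation (B \<union> C) (T b) b))"

definition strongly_unimodular :: "('a::real_vector \<Rightarrow> 'a \<Rightarrow> 'a) \<Rightarrow> bool" where
  "strongly_unimodular br \<longleftrightarrow>
     (\<exists>N. is_nilradical br N \<and>
        (\<forall>X k. quot_trace (br X) (lower_central br N k) (lower_central br N (Suc k)) = 0))"

subsection \<open>Forms\<close>

text \<open>The operations below serve for both real-valued and complex-valued forms. Sums, differences and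
  the zero form are the pointwise ones.\<close>

definition wedge :: "('a \<Rightarrow> 'b::ring) \<Rightarrow> ('a \<Rightarrow> 'b) \<Rightarrow> 'a \<Rightarrow> 'a \<Rightarrow> 'b" (infixl \<open>\<^bold>\<and>\<close> 75) where
  "\<alpha> \<^bold>\<and> \<beta> = (\<lambda>X Y. \<alpha> X * \<beta> Y - \<alpha> Y * \<beta> X)"

definition scale_form :: "'b::ring \<Rightarrow> ('a \<Rightarrow> 'a \<Rightarrow> 'b) \<Rightarrow> 'a \<Rightarrow> 'a \<Rightarrow> 'b" (infixr \<open>\<odot>\<close> 72) where
  "c \<odot> \<omega> = (\<lambda>X Y. c * \<omega> X Y)"

definition ce_d :: "('a \<Rightarrow> 'a \<Rightarrow> 'a) \<Rightarrow> ('a \<Rightarrow> 'b::ring) \<Rightarrow> 'a \<Rightarrow> 'a \<Rightarrow> 'b" where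
  "ce_d br \<alpha> = (\<lambda>X Y. - \<alpha> (br X Y))"

definition conj_form :: "('a \<Rightarrow> complex) \<Rightarrow> 'a \<Rightarrow> complex" where
  "conj_form \<alpha> = (\<lambda>X. cnj (\<alpha> X))"

subsection \<open>Complex structures\<close>

text \<open>The last condition is the vanishing of the Nijenhuis tensor
  \<open>[JX,JY] - J[JX,Y] - J[X,JY] - [X,Y]\<close>. Mind the signs: with both middle terms negated it would say
  that brackets of \<open>(1,0)\<close>-vectors are of type \<open>(0,1)\<close>.\<close>

definition complex_structure ::
  "('a::real_vector \<Rightarrow> 'a \<Rightarrow> 'a) \<Rightarrow> ('a \<Rightarrow> 'a) \<Rightarrow> bool" where
  "complex_structure br J \<longleftrightarrow>
     linear J \<and> (\<forall>X. J (J X) = - X) \<and>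
     (\<forall>X Y. br X Y + J (br (J X) Y) + J (br X (J Y)) - br (J X) (J Y) = 0)"

definition form10 :: "('a::real_vector \<Rightarrow> 'a) \<Rightarrow> ('a \<Rightarrow> complex) \<Rightarrow> bool" where
  "form10 J \<alpha> \<longleftrightarrow> linear \<alpha> \<and> (\<forall>X. \<alpha> (J X) = \<i> * \<alpha> X)"

definition basis10 ::
  "('a::real_vector \<Rightarrow> 'a) \<Rightarrow> ('a \<Rightarrow> complex) \<Rightarrow> ('a \<Rightarrow> complex) \<Rightarrow> ('a \<Rightarrow> complex) \<Rightarrow> bool" where
  "basis10 J \<alpha>1 \<alpha>2 \<alpha>3 \<longleftrightarrow>
     form10 J \<alpha>1 \<and> form10 J \<alpha>2 \<and> form10 J \<alpha>3 \<and>
     (\<forall>a b c. (\<forall>X. a * \<alpha>1 X + b * \<alpha>2 X + c * \<alpha>3 X = 0) \<longrightarrow> a = 0 \<and> b = 0 \<and> c = 0) \<and>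
     (\<forall>\<beta>. form10 J \<beta> \<longrightarrow> (\<exists>a b c. \<forall>X. \<beta> X = a * \<alpha>1 X + b * \<alpha>2 X + c * \<alpha>3 X))"

subsection \<open>Six-dimensional Lie algebras given by structure equations\<close>

definition dual_bases :: "(nat \<Rightarrow> 'a::real_vector) \<Rightarrow> (nat \<Rightarrow> 'a \<Rightarrow> real) \<Rightarrow> bool" where
  "dual_bases e f \<longleftrightarrow>
     inj_on e {1..6} \<and> independent (e ` {1..6}) \<and> span (e ` {1..6}) = UNIV \<and>
     (\<forall>i\<in>{1..6}. linear (f i) \<and> (\<forall>j\<in>{1..6}. f i (e j) = (if i = j then 1 else 0)))"

text \<open>A six-tuple of 2-forms is encoded as the map sending a coframe \<open>f\<close> to the list of the six 2-forms.
  A Lie algebra is isomorphic to the one denoted by the six-tuple iff it has a basis whose dual basis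
  satisfies the corresponding equations.\<close>

type_synonym 'a structure_eqs = "(nat \<Rightarrow> 'a \<Rightarrow> real) \<Rightarrow> ('a \<Rightarrow> 'a \<Rightarrow> real) list"

definition isomorphic_to ::
  "('a::real_vector \<Rightarrow> 'a \<Rightarrow> 'a) \<Rightarrow> 'a structure_eqs \<Rightarrow> bool" where
  "isomorphic_to br \<eta> \<longleftrightarrow>
     (\<exists>e f. dual_bases e f \<and>
        [ce_d br (f 1), ce_d br (f 2), ce_d br (f 3), ce_d br (f 4), ce_d br (f 5), ce_d br (f 6)] = \<eta> f)"

definition h3_s33 :: "'a structure_eqs" where
  "h3_s33 f = [f 2 \<^bold>\<and> f 3, 0, 0, f 5 \<^bold>\<and> f 6, - (f 4 \<^bold>\<and> f 6), 0]"

definition s47_R2 :: "'a structure_eqs" where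
  "s47_R2 f = [f 2 \<^bold>\<and> f 3, f 3 \<^bold>\<and> f 6, - (f 2 \<^bold>\<and> f 6), 0, 0, 0]"

definition s6_44 :: "'a structure_eqs" where
  "s6_44 f = [f 2 \<^bold>\<and> f 3, f 3 \<^bold>\<and> f 6, - (f 2 \<^bold>\<and> f 6),
     f 2 \<^bold>\<and> f 6 + f 5 \<^bold>\<and> f 6, f 3 \<^bold>\<and> f 6 - f 4 \<^bold>\<and> f 6, 0]"

definition s6_52 :: "real \<Rightarrow> 'a structure_eqs" where
  "s6_52 q f = [f 2 \<^bold>\<and> f 3, f 3 \<^bold>\<and> f 6, - (f 2 \<^bold>\<and> f 6), q \<odot> f 5 \<^bold>\<and> f 6, - (q \<odot> f 4 \<^bold>\<and> f 6), 0]"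

definition s6_159 :: "'a structure_eqs" where
  "s6_159 f = [f 2 \<^bold>\<and> f 4 + f 3 \<^bold>\<and> f 5, 0, - (f 5 \<^bold>\<and> f 6), 0, f 3 \<^bold>\<and> f 6, 0]"

definition s6_162_1 :: "'a structure_eqs" where
  "s6_162_1 f = [f 2 \<^bold>\<and> f 4 + f 3 \<^bold>\<and> f 5, f 2 \<^bold>\<and> f 6, f 3 \<^bold>\<and> f 6, - (f 4 \<^bold>\<and> f 6), - (f 5 \<^bold>\<and> f 6), 0]"

definition s6_165 :: "real \<Rightarrow> 'a structure_eqs" where
  "s6_165 p f = [f 2 \<^bold>\<and> f 4 + f 3 \<^bold>\<and> f 5,
     p \<odot> f 2 \<^bold>\<and> f 6 + f 3 \<^bold>\<and> f 6, - (f 2 \<^bold>\<and> f 6) + p \<odot> f 3 \<^bold>\<and> f 6,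
     - (p \<odot> f 4 \<^bold>\<and> f 6) + f 5 \<^bold>\<and> f 6, - (f 4 \<^bold>\<and> f 6) - p \<odot> f 5 \<^bold>\<and> f 6, 0]"

definition s6_166 :: "real \<Rightarrow> 'a structure_eqs" where
  "s6_166 p f = [f 2 \<^bold>\<and> f 4 + f 3 \<^bold>\<and> f 5,
     - (f 4 \<^bold>\<and> f 6), - (p \<odot> f 5 \<^bold>\<and> f 6), f 2 \<^bold>\<and> f 6, p \<odot> f 3 \<^bold>\<and> f 6, 0]"

definition s6_167 :: "'a structure_eqs" where
  "s6_167 f = [f 2 \<^bold>\<and> f 4 + f 3 \<^bold>\<and> f 5, f 3 \<^bold>\<and> f 6, - (f 2 \<^bold>\<and> f 6),
     f 2 \<^bold>\<and> f 6 + f 5 \<^bold>\<and> f 6, f 3 \<^bold>\<and> f 6 - f 4 \<^bold>\<and> f 6, 0]"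

text \<open>\<open>J\<close> admits a basis of \<open>(1,0)\<close>-forms whose differentials are the three 2-forms that \<open>\<theta>\<close> assigns to
  this basis and to \<open>\<sigma> = \<alpha>1 - conj_form \<alpha>1\<close>.\<close>

definition admits_basis ::
  "('a::real_vector \<Rightarrow> 'a \<Rightarrow> 'a) \<Rightarrow> ('a \<Rightarrow> 'a) \<Rightarrow>
   (('a \<Rightarrow> complex) \<Rightarrow> ('a \<Rightarrow> complex) \<Rightarrow> ('a \<Rightarrow> complex) \<Rightarrow> ('a \<Rightarrow> complex) \<Rightarrow>
     ('a \<Rightarrow> 'a \<Rightarrow> complex) list) \<Rightarrow> bool" where
  "admits_basis br J \<theta> \<longleftrightarrow>
     (\<exists>\<alpha>1 \<alpha>2 \<alpha>3. basis10 J \<alpha>1 \<alpha>2 \<alpha>3 \<and>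
        [ce_d br \<alpha>1, ce_d br \<alpha>2, ce_d br \<alpha>3] = \<theta> \<alpha>1 \<alpha>2 \<alpha>3 (\<alpha>1 - conj_form \<alpha>1))"

end

theory Submission
  imports Defs
begin

text \<open>
  Let \<open>Z\<close> span \<open>[N,N]\<close>. Strong unimodularity makes \<open>Z\<close> central, \<open>W = J Z\<close> is transversal to \<open>N\<close>, and
  integrability forces \<open>ad W\<close> to act complex linearly on \<open>N \<inter> J N\<close>, which is a complex plane. The
  bracket of \<open>N\<close> is a \<open>(1,1)\<close>-form on this plane, i.e. a Hermitian form, and the Jacobi identity says
  that \<open>ad W\<close> is skew for it. Hence everything reduces to a nonzero Hermitian form on a complex plane
  together with a non-nilpotent skew endomorphism whose trace is imaginary. Up to changes of basis
  there are three families: diagonalisable with imaginary eigenvalues, diagonalisable with a pair of eigenvalues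
  \<open>\<lambda>\<close>, \<open>-cnj \<lambda>\<close> off the imaginary axis, and a single Jordan block.

  Since \<open>N\<close> is intrinsic, an isomorphism with one of the listed algebras determines the real operator
  \<open>ad W\<close> on \<open>N/[N,N]\<close> up to scale, and the bracket form on it. Eigenvalues, semisimplicity and
  rank of the form (for \<open>s6_166\<close> also the signature of the form \<open>X \<mapsto> [X, [W, X]]\<close>) then single out
  the parameters of the family.
\<close>

text \<open>Strong unimodularity enters twice. On \<open>[N,N]\<close>, which nilpotency makes
  central in \<open>N\<close>, the trace of \<open>ad X\<close> is the scalar by which
  \<open>X\<close> acts on \<open>Z\<close>, so this scalar is 0. On \<open>N/[N,N]\<close> it gives
  the trace condition on \<open>ad W\<close>. Centrality of \<open>Z\<close> is what makes
  integrability linear: with \<open>Z\<close> as one argument the Nijenhuis condition collapses to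
  \<open>[W, J X] = J [W, X]\<close>. The constants are written for \<sigma> and not for
  \<open>ad W\<close>: in the coordinates \<alpha>2, \<alpha>3 the operator \<open>ad W\<close> is
  \<open>- 2 * \<i>\<close> times the matrix with rows \<open>a b\<close> and \<open>c d\<close>.
  Real entries thus mean imaginary eigenvalues of \<open>ad W\<close>, and the pair \<lambda>,
  \<open>- cnj \<lambda>\<close> becomes a pair of conjugate entries. The obstacle is that an
  isomorphism with a listed algebra ignores \<open>J\<close>, and that the same algebra might a
  priori match several entries. Each entry is therefore tested against all three families of
  coframes: it yields equations between real structure constants and the complex ones, which refute
  the wrong families and fix the parameters of the right one.\<close>

section \<open>Adapted coframes\<close>

text \<open>The value of the real 2-form
  \<open>\<i> (h \<alpha>2 \<and> cnj \<alpha>2 + k \<alpha>3 \<and> cnj \<alpha>3 + g \<alpha>2 \<and> cnj \<alpha>3 + cnj g \<alpha>3 \<and> cnj \<alpha>2)\<close> on two vectors with coordinates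
  \<open>(\<alpha>2, \<alpha>3) = (u, v)\<close> and \<open>(u', v')\<close>.\<close>

definition hform ::
  "real \<Rightarrow> real \<Rightarrow> complex \<Rightarrow> complex \<Rightarrow> complex \<Rightarrow> complex \<Rightarrow> complex \<Rightarrow> complex" where
  "hform h k g u v u' v' =
     \<i> * (h * (u * cnj u' - u' * cnj u) + k * (v * cnj v' - v' * cnj v)
       + g * (u * cnj v' - u' * cnj v) + cnj g * (v * cnj u' - v' * cnj u))"

text \<open>With \<open>\<sigma> = \<alpha>1 - cnj \<alpha>1 = 2 \<i> Im \<alpha>1\<close> the last three conditions read \<open>d\<alpha>1 = hform h k g\<close>,
  \<open>d\<alpha>2 = - (a \<alpha>2 + b \<alpha>3) \<and> \<sigma>\<close> and \<open>d\<alpha>3 = - (c \<alpha>2 + d \<alpha>3) \<and> \<sigma>\<close>.\<close>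

definition adapted ::
  "('a::real_vector \<Rightarrow> 'a \<Rightarrow> 'a) \<Rightarrow> ('a \<Rightarrow> 'a) \<Rightarrow> 'a set \<Rightarrow> ('a \<Rightarrow> complex) \<Rightarrow> ('a \<Rightarrow> complex) \<Rightarrow> ('a \<Rightarrow> complex)
    \<Rightarrow> complex \<Rightarrow> complex \<Rightarrow> complex \<Rightarrow> complex \<Rightarrow> real \<Rightarrow> real \<Rightarrow> complex \<Rightarrow> bool" where
  "adapted br J N \<alpha>1 \<alpha>2 \<alpha>3 a b c d h k g \<longleftrightarrow>
     form10 J \<alpha>1 \<and> form10 J \<alpha>2 \<and> form10 J \<alpha>3 \<and>
     (\<forall>X. \<alpha>1 X = 0 \<and> \<alpha>2 X = 0 \<and> \<alpha>3 X = 0 \<longrightarrow> X = 0) \<and>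
     (\<forall>x y z. \<exists>X. \<alpha>1 X = x \<and> \<alpha>2 X = y \<and> \<alpha>3 X = z) \<and>
     (\<forall>X. X \<in> N \<longleftrightarrow> Im (\<alpha>1 X) = 0) \<and>
     (\<forall>X Y. \<alpha>1 (br X Y) = - hform h k g (\<alpha>2 X) (\<alpha>3 X) (\<alpha>2 Y) (\<alpha>3 Y)) \<and>
     (\<forall>X Y. \<alpha>2 (br X Y) = 2 * \<i> * ((a * \<alpha>2 X + b * \<alpha>3 X) * Im (\<alpha>1 Y) - (a * \<alpha>2 Y + b * \<alpha>3 Y) * Im (\<alpha>1 X))) \<and>
     (\<forall>X Y. \<alpha>3 (br X Y) = 2 * \<i> * ((c * \<alpha>2 X + d * \<alpha>3 X) * Im (\<alpha>1 Y) - (c * \<alpha>2 Y + d * \<alpha>3 Y) * Im (\<alpha>1 X)))"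

text \<open>Hiding the coframe lets a change of coframe act as a rewriting of the seven
  constants.\<close>

definition frame ::
  "('a::real_vector \<Rightarrow> 'a \<Rightarrow> 'a) \<Rightarrow> ('a \<Rightarrow> 'a) \<Rightarrow> 'a set
    \<Rightarrow> complex \<Rightarrow> complex \<Rightarrow> complex \<Rightarrow> complex \<Rightarrow> real \<Rightarrow> real \<Rightarrow> complex \<Rightarrow> bool" where
  "frame br J N a b c d h k g \<longleftrightarrow> (\<exists>\<alpha>1 \<alpha>2 \<alpha>3. adapted br J N \<alpha>1 \<alpha>2 \<alpha>3 a b c d h k g)"

lemma adaptedD:
  assumes "adapted br J N \<alpha>1 \<alpha>2 \<alpha>3 a b c d h k g"
  shows adapted_form10: "form10 J \<alpha>1" "form10 J \<alpha>2" "form10 J \<alpha>3"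
    and adapted_inj: "\<And>X. \<alpha>1 X = 0 \<Longrightarrow> \<alpha>2 X = 0 \<Longrightarrow> \<alpha>3 X = 0 \<Longrightarrow> X = 0"
    and adapted_surj: "\<And>x y z. \<exists>X. \<alpha>1 X = x \<and> \<alpha>2 X = y \<and> \<alpha>3 X = z"
    and adapted_N: "\<And>X. X \<in> N \<longleftrightarrow> Im (\<alpha>1 X) = 0"
    and adapted_br: "\<And>X Y. \<alpha>1 (br X Y) = - hform h k g (\<alpha>2 X) (\<alpha>3 X) (\<alpha>2 Y) (\<alpha>3 Y)"
     "\<And>X Y. \<alpha>2 (br X Y) = 2 * \<i> * ((a * \<alpha>2 X + b * \<alpha>3 X) * Im (\<alpha>1 Y) - (a * \<alpha>2 Y + b * \<alpha>3 Y) * Im (\<alpha>1 X))"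
     "\<And>X Y. \<alpha>3 (br X Y) = 2 * \<i> * ((c * \<alpha>2 X + d * \<alpha>3 X) * Im (\<alpha>1 Y) - (c * \<alpha>2 Y + d * \<alpha>3 Y) * Im (\<alpha>1 X))"
  using assms unfolding adapted_def by blast+

section \<open>Complex linearity of (1,0)-forms and changes of adapted coframe\<close>

lemma form10_scaleR: "form10 J \<alpha> \<Longrightarrow> \<alpha> (r *\<^sub>R X) = of_real r * \<alpha> X"
  by (simp add: form10_def linear_scale scaleR_conv_of_real)

lemma form10_add: "form10 J \<alpha> \<Longrightarrow> \<alpha> (X + Y) = \<alpha> X + \<alpha> Y"
  by (simp add: form10_def linear_add)

lemma form10_J: "form10 J \<alpha> \<Longrightarrow> \<alpha> (J X) = \<i> * \<alpha> X"
  by (simp add: form10_def)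

lemma form10_comb:
  assumes "form10 J \<alpha>" "form10 J \<beta>"
  shows "form10 J (\<lambda>X. p * \<alpha> X + q * \<beta> X)"
  using assms unfolding form10_def
  by (auto intro!: linearI simp: linear_add linear_scale algebra_simps)

lemma form10_cmult:
  assumes "form10 J \<alpha>" shows "form10 J (\<lambda>X. p * \<alpha> X)"
  using form10_comb[OF assms assms, of p 0] by simp

text \<open>The hypotheses make the three forms a bijection onto complex triples. They are complex
  linear for \<open>J\<close>, so the preimages of the unit triples form a complex basis.\<close>

lemma basis10_if_coordinates:
  assumes f: "form10 J \<alpha>1" "form10 J \<alpha>2" "form10 J \<alpha>3"
    and inj: "\<And>X. \<alpha>1 X = 0 \<Longrightarrow> \<alpha>2 X = 0 \<Longrightarrow> \<alpha>3 X = 0 \<Longrightarrow> X = 0"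
    and surj: "\<And>x y z. \<exists>X. \<alpha>1 X = x \<and> \<alpha>2 X = y \<and> \<alpha>3 X = z"
  shows "basis10 J \<alpha>1 \<alpha>2 \<alpha>3"
proof -
  obtain X1 where X1: "\<alpha>1 X1 = 1" "\<alpha>2 X1 = 0" "\<alpha>3 X1 = 0" using surj by metis
  obtain X2 where X2: "\<alpha>1 X2 = 0" "\<alpha>2 X2 = 1" "\<alpha>3 X2 = 0" using surj by metis
  obtain X3 where X3: "\<alpha>1 X3 = 0" "\<alpha>2 X3 = 0" "\<alpha>3 X3 = 1" using surj by metis
  \<comment> \<open>Multiplication of \<open>X\<close> by the complex number \<open>z\<close>, with
    \<open>J\<close> as imaginary unit.\<close>
  define C where "C z X = Re z *\<^sub>R X + Im z *\<^sub>R J X" for z X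
  have C: "\<alpha> (C z X) = z * \<alpha> X" if "form10 J \<alpha>" for \<alpha> z X
    unfolding C_def using that
    by (simp add: form10_add form10_scaleR form10_J complex_eq_iff algebra_simps)
  have dec: "X = C (\<alpha>1 X) X1 + (C (\<alpha>2 X) X2 + C (\<alpha>3 X) X3)" for X
  proof -
    let ?Y = "C (\<alpha>1 X) X1 + (C (\<alpha>2 X) X2 + C (\<alpha>3 X) X3)"
    have "\<alpha> (X - ?Y) = \<alpha> X - \<alpha> ?Y" if "form10 J \<alpha>" for \<alpha>
      using that by (simp add: form10_def linear_diff)
    from this[OF f(1)] this[OF f(2)] this[OF f(3)] have "X - ?Y = 0"
      using f by (intro inj) (simp_all add: form10_add C X1 X2 X3)
    then show ?thesis by simp
  qed
  have "\<exists>a b c. \<forall>X. \<beta> X = a * \<alpha>1 X + b * \<alpha>2 X + c * \<alpha>3 X" if b: "form10 J \<beta>" for \<beta>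
  proof (intro exI allI)
    fix X
    have "\<beta> X = \<beta> (C (\<alpha>1 X) X1 + (C (\<alpha>2 X) X2 + C (\<alpha>3 X) X3))" using dec[of X] by simp
    then show "\<beta> X = \<beta> X1 * \<alpha>1 X + \<beta> X2 * \<alpha>2 X + \<beta> X3 * \<alpha>3 X"
      by (simp add: form10_add[OF b] C[OF b] algebra_simps)
  qed
  moreover have "a = 0 \<and> b = 0 \<and> c = 0" if "\<forall>X. a * \<alpha>1 X + b * \<alpha>2 X + c * \<alpha>3 X = 0" for a b c
    using that[rule_format, of X1] that[rule_format, of X2] that[rule_format, of X3]
    by (simp add: X1 X2 X3)
  ultimately show ?thesis unfolding basis10_def using f by blast
qed

text \<open>Arguments that treat one of the two indices are carried over to the other one from here.
  The off-diagonal Hermitian entry is conjugated by the exchange.\<close>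

lemma frame_swap:
  assumes "frame br J N a b c d h k g"
  shows "frame br J N d c b a k h (cnj g)"
proof -
  from assms obtain \<alpha>1 \<alpha>2 \<alpha>3 where "adapted br J N \<alpha>1 \<alpha>2 \<alpha>3 a b c d h k g"
    unfolding frame_def by blast
  then have "adapted br J N \<alpha>1 \<alpha>3 \<alpha>2 d c b a k h (cnj g)"
    unfolding adapted_def hform_def by (simp add: algebra_simps) blast
  then show ?thesis unfolding frame_def by blast
qed

lemma hform_scale:
  assumes "s \<noteq> 0" and "w \<noteq> 0"
  shows "hform (r * h / (cmod s)\<^sup>2) (r * k / (cmod w)\<^sup>2) (of_real r * g / (s * cnj w))
      (s * u) (w * v) (s * u') (w * v') = of_real r * hform h k g u v u' v'"
proof -
  have hs: "complex_of_real (r * h / (cmod s)\<^sup>2) * (s * u * cnj (s * u') - s * u' * cnj (s * u))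
      = r * h * (u * cnj u' - u' * cnj u)"
    using assms(1) complex_norm_square[of s] by (simp add: field_simps)
  have ks: "complex_of_real (r * k / (cmod w)\<^sup>2) * (w * v * cnj (w * v') - w * v' * cnj (w * v))
      = r * k * (v * cnj v' - v' * cnj v)"
    using assms(2) complex_norm_square[of w] by (simp add: field_simps)
  have gs: "of_real r * g / (s * cnj w) * (s * u * cnj (w * v') - s * u' * cnj (w * v))
      = r * g * (u * cnj v' - u' * cnj v)"
    "cnj (of_real r * g / (s * cnj w)) * (w * v * cnj (s * u') - w * v' * cnj (s * u))
      = r * cnj g * (v * cnj u' - v' * cnj u)"
    using assms by (simp_all add: field_simps)
  show ?thesis unfolding hform_def hs ks gs by (simp add: algebra_simps)
qed

text \<open>\<alpha>1 may only be multiplied by a real number: \<open>N\<close> has to stay the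
  kernel of \<open>Im \<alpha>1\<close> and \<open>d\<alpha>1\<close> has to stay real. The factor
  \<open>r\<close> gained by \<sigma> is what divides the coefficients of \<open>d\<alpha>2\<close>
  and \<open>d\<alpha>3\<close>.\<close>

lemma frame_scale:
  assumes "frame br J N a b c d h k g" and r: "r \<noteq> 0" and s: "s \<noteq> 0" and w: "w \<noteq> 0"
  shows "frame br J N (a / of_real r) (b * s / (w * of_real r)) (c * w / (s * of_real r)) (d / of_real r)
     (r * h / (cmod s)\<^sup>2) (r * k / (cmod w)\<^sup>2) (of_real r * g / (s * cnj w))"
proof -
  from assms obtain \<alpha>1 \<alpha>2 \<alpha>3 where A: "adapted br J N \<alpha>1 \<alpha>2 \<alpha>3 a b c d h k g"
    unfolding frame_def by blast
  have "adapted br J N (\<lambda>X. of_real r * \<alpha>1 X) (\<lambda>X. s * \<alpha>2 X) (\<lambda>X. w * \<alpha>3 X)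
     (a / of_real r) (b * s / (w * of_real r)) (c * w / (s * of_real r)) (d / of_real r)
     (r * h / (cmod s)\<^sup>2) (r * k / (cmod w)\<^sup>2) (of_real r * g / (s * cnj w))"
    unfolding adapted_def
  proof (intro conjI allI impI)
    fix x y z :: complex
    obtain X where "\<alpha>1 X = x / r" "\<alpha>2 X = y / s" "\<alpha>3 X = z / w"
      using A unfolding adapted_def by metis
    then show "\<exists>X. of_real r * \<alpha>1 X = x \<and> s * \<alpha>2 X = y \<and> w * \<alpha>3 X = z"
      using r s w by (intro exI[of _ X]) simp
  next
    fix X Y
    show "(\<lambda>X. complex_of_real r * \<alpha>1 X) (br X Y) =
       - hform (r * h / (cmod s)\<^sup>2) (r * k / (cmod w)\<^sup>2) (complex_of_real r * g / (s * cnj w))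
           (s * \<alpha>2 X) (w * \<alpha>3 X) (s * \<alpha>2 Y) (w * \<alpha>3 Y)"
      unfolding adapted_br[OF A] by (simp add: hform_scale r s w)
  qed (use r s w in \<open>auto simp: adaptedD[OF A] form10_cmult field_simps intro: adapted_inj[OF A]\<close>)
  then show ?thesis unfolding frame_def by blast
qed

text \<open>Replacing \<alpha>2 by \<open>\<alpha>2 + t * \<alpha>3\<close> conjugates the
  coefficient matrix by a unipotent matrix. For \<open>c = 0\<close> the diagonal is kept and
  \<open>b\<close> changes by \<open>t * (d - a)\<close>. A suitable \<open>t\<close> clears
  \<open>b\<close> (if \<open>a\<close> and \<open>d\<close> differ), or \<open>g\<close> (if
  \<open>h\<close> is nonzero), or \<open>k\<close> (if \<open>h = 0\<close> and \<open>g\<close> is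
  nonzero).\<close>

lemma frame_shear:
  assumes "frame br J N a b c d h k g"
  shows "frame br J N (a + t * c) (b + t * d - t * (a + t * c)) c (d - t * c)
     h (k - 2 * Re (g * t) + h * (cmod t)\<^sup>2) (g - h * cnj t)"
proof -
  from assms obtain \<alpha>1 \<alpha>2 \<alpha>3 where A: "adapted br J N \<alpha>1 \<alpha>2 \<alpha>3 a b c d h k g"
    unfolding frame_def by blast
  have ks: "complex_of_real (k - 2 * Re (g * t) + h * (cmod t)\<^sup>2) = k - (g * t + cnj g * cnj t) + h * (t * cnj t)"
    unfolding of_real_add of_real_diff of_real_mult complex_norm_square[of t, symmetric]
    by (simp add: complex_eq_iff)
  have "adapted br J N \<alpha>1 (\<lambda>X. \<alpha>2 X + t * \<alpha>3 X) \<alpha>3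
     (a + t * c) (b + t * d - t * (a + t * c)) c (d - t * c)
     h (k - 2 * Re (g * t) + h * (cmod t)\<^sup>2) (g - h * cnj t)"
    unfolding adapted_def
  proof (intro conjI allI impI)
    fix x y z :: complex
    obtain X where "\<alpha>1 X = x" "\<alpha>2 X = y - t * z" "\<alpha>3 X = z"
      using A unfolding adapted_def by metis
    then show "\<exists>X. \<alpha>1 X = x \<and> \<alpha>2 X + t * \<alpha>3 X = y \<and> \<alpha>3 X = z"
      by (intro exI[of _ X]) simp
  next
    show "form10 J (\<lambda>X. \<alpha>2 X + t * \<alpha>3 X)"
      using A form10_comb[of J \<alpha>2 \<alpha>3 1 t] by (simp add: adapted_def)
  next
    fix X Y
    show "\<alpha>1 (br X Y) =
       - hform h (k - 2 * Re (g * t) + h * (cmod t)\<^sup>2) (g - h * cnj t)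
           (\<alpha>2 X + t * \<alpha>3 X) (\<alpha>3 X) (\<alpha>2 Y + t * \<alpha>3 Y) (\<alpha>3 Y)"
      using A unfolding adapted_def hform_def ks
      by (simp add: algebra_simps)
  qed (auto simp: adaptedD[OF A] algebra_simps intro: adapted_inj[OF A])
  then show ?thesis unfolding frame_def by blast
qed

section \<open>Normal forms and the associated Lie algebras\<close>

lemma adapted_linear:
  assumes "adapted br J N \<alpha>1 \<alpha>2 \<alpha>3 a b c d h k g"
  shows "\<alpha>1 (X + Y) = \<alpha>1 X + \<alpha>1 Y" "\<alpha>2 (X + Y) = \<alpha>2 X + \<alpha>2 Y" "\<alpha>3 (X + Y) = \<alpha>3 X + \<alpha>3 Y"
    "\<alpha>1 (r *\<^sub>R X) = of_real r * \<alpha>1 X" "\<alpha>2 (r *\<^sub>R X) = of_real r * \<alpha>2 X" "\<alpha>3 (r *\<^sub>R X) = of_real r * \<alpha>3 X"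
  using adapted_form10[OF assms] by (auto simp only: form10_add form10_scaleR)

lemma dual_basesI:
  assumes lin: "\<And>i. i \<in> {1..6} \<Longrightarrow> linear (f i)"
    and inj: "\<And>X. (\<And>i. i \<in> {1..6} \<Longrightarrow> f i X = 0) \<Longrightarrow> X = 0"
    and e: "\<And>i j. i \<in> {1..6} \<Longrightarrow> j \<in> {1..6} \<Longrightarrow> f i (e j) = (if i = j then 1 else 0)"
  shows "dual_bases e f"
proof -
  have inj_e: "inj_on e {1..6}"
  proof (rule inj_onI)
    fix i j :: nat assume i: "i \<in> {1..6}" and j: "j \<in> {1..6}" and "e i = e j"
    then show "i = j" using e[OF i i] e[OF i j] by (auto split: if_splits)
  qed
  have coord: "f i (\<Sum>j\<in>{1..6}. c j *\<^sub>R e j) = c i" if i: "i \<in> {1..6}" for i c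
  proof -
    have "f i (\<Sum>j\<in>{1..6}. c j *\<^sub>R e j) = (\<Sum>j\<in>{1..6}. c j * f i (e j))"
      using lin[OF i] by (simp add: linear_sum linear_scale)
    also have "\<dots> = (\<Sum>j\<in>{1..6}. if i = j then c j else 0)"
      using e[OF i] by (intro sum.cong) auto
    finally show ?thesis using i by simp
  qed
  have "independent (e ` {1..6})"
  proof (rule independent_if_scalars_zero)
    fix u x assume 0: "(\<Sum>x\<in>e ` {1..6}. u x *\<^sub>R x) = 0" and x: "x \<in> e ` {1..6}"
    then obtain i where i: "i \<in> {1..6}" "x = e i" by blast
    have "(\<Sum>j\<in>{1..6}. u (e j) *\<^sub>R e j) = 0" using 0 inj_e by (simp add: sum.reindex)
    then show "u x = 0" using coord[OF i(1), of "\<lambda>j. u (e j)"] lin[OF i(1)] i(2) by (simp add: linear_0)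
  qed simp
  moreover have "X \<in> span (e ` {1..6})" for X
  proof -
    let ?Y = "\<Sum>j\<in>{1..6}. f j X *\<^sub>R e j"
    have "X - ?Y = 0"
      by (rule inj) (use lin coord in \<open>simp add: linear_diff\<close>)
    moreover have "?Y \<in> span (e ` {1..6})"
      by (intro span_sum span_scale span_base) auto
    ultimately show ?thesis by simp
  qed
  ultimately show ?thesis unfolding dual_bases_def using inj_e lin e by blast
qed

lemma atLeastAtMost_1_6: "{1..6::nat} = {1, 2, 3, 4, 5, 6}"
  by auto

definition tuple6 :: "'b \<Rightarrow> 'b \<Rightarrow> 'b \<Rightarrow> 'b \<Rightarrow> 'b \<Rightarrow> 'b \<Rightarrow> nat \<Rightarrow> 'b" where
  "tuple6 x1 x2 x3 x4 x5 x6 i =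
     (if i = 1 then x1 else if i = 2 then x2 else if i = 3 then x3 else if i = 4 then x4 else if i = 5 then x5 else x6)"

lemma tuple6_simps [simp]:
  "tuple6 x1 x2 x3 x4 x5 x6 1 = x1" "tuple6 x1 x2 x3 x4 x5 x6 (Suc 0) = x1"
  "tuple6 x1 x2 x3 x4 x5 x6 2 = x2" "tuple6 x1 x2 x3 x4 x5 x6 3 = x3"
  "tuple6 x1 x2 x3 x4 x5 x6 4 = x4" "tuple6 x1 x2 x3 x4 x5 x6 5 = x5" "tuple6 x1 x2 x3 x4 x5 x6 6 = x6"
  by (simp_all add: tuple6_def)

text \<open>\<open>hform\<close> is real valued, so \<open>Im \<alpha>1\<close> is closed and
  \<open>Re \<alpha>1\<close> carries the whole form; they supply the last and the first covector.
  The factor 2 matches \<open>\<sigma> = 2 * \<i> * Im \<alpha>1\<close>, \<open>s\<close>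
  normalises the form, and \<open>Y\<close>, \<open>Z\<close> invert the real coordinates
  \<open>P2\<close> to \<open>P5\<close>.\<close>

lemma isomorphic_to_if_adapted:
  fixes P2 P3 P4 P5 :: "complex \<Rightarrow> complex \<Rightarrow> real" and s :: real
  assumes A: "adapted br J N \<alpha>1 \<alpha>2 \<alpha>3 a b c d h k g" and s: "s \<noteq> 0"
    and lin: "linear (\<lambda>X. P2 (\<alpha>2 X) (\<alpha>3 X))" "linear (\<lambda>X. P3 (\<alpha>2 X) (\<alpha>3 X))"
      "linear (\<lambda>X. P4 (\<alpha>2 X) (\<alpha>3 X))" "linear (\<lambda>X. P5 (\<alpha>2 X) (\<alpha>3 X))"
    and inj: "\<And>y z. P2 y z = 0 \<Longrightarrow> P3 y z = 0 \<Longrightarrow> P4 y z = 0 \<Longrightarrow> P5 y z = 0 \<Longrightarrow> y = 0 \<and> z = 0"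
    and surj: "\<And>x2 x3 x4 x5. P2 (Y x2 x3 x4 x5) (Z x2 x3 x4 x5) = x2 \<and> P3 (Y x2 x3 x4 x5) (Z x2 x3 x4 x5) = x3 \<and>
      P4 (Y x2 x3 x4 x5) (Z x2 x3 x4 x5) = x4 \<and> P5 (Y x2 x3 x4 x5) (Z x2 x3 x4 x5) = x5"
    and eq: "[ce_d br (\<lambda>X. s * Re (\<alpha>1 X)), ce_d br (\<lambda>X. P2 (\<alpha>2 X) (\<alpha>3 X)), ce_d br (\<lambda>X. P3 (\<alpha>2 X) (\<alpha>3 X)),
         ce_d br (\<lambda>X. P4 (\<alpha>2 X) (\<alpha>3 X)), ce_d br (\<lambda>X. P5 (\<alpha>2 X) (\<alpha>3 X)), ce_d br (\<lambda>X. 2 * Im (\<alpha>1 X))] =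
       \<eta> (tuple6 (\<lambda>X. s * Re (\<alpha>1 X)) (\<lambda>X. P2 (\<alpha>2 X) (\<alpha>3 X)) (\<lambda>X. P3 (\<alpha>2 X) (\<alpha>3 X))
          (\<lambda>X. P4 (\<alpha>2 X) (\<alpha>3 X)) (\<lambda>X. P5 (\<alpha>2 X) (\<alpha>3 X)) (\<lambda>X. 2 * Im (\<alpha>1 X)))"
  shows "isomorphic_to br \<eta>"
proof -
  define f where "f = tuple6 (\<lambda>X. s * Re (\<alpha>1 X)) (\<lambda>X. P2 (\<alpha>2 X) (\<alpha>3 X)) (\<lambda>X. P3 (\<alpha>2 X) (\<alpha>3 X))
          (\<lambda>X. P4 (\<alpha>2 X) (\<alpha>3 X)) (\<lambda>X. P5 (\<alpha>2 X) (\<alpha>3 X)) (\<lambda>X. 2 * Im (\<alpha>1 X))"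
  have "\<exists>X. f 1 X = x1 \<and> f 2 X = x2 \<and> f 3 X = x3 \<and> f 4 X = x4 \<and> f 5 X = x5 \<and> f 6 X = x6"
    for x1 x2 x3 x4 x5 x6
  proof -
    obtain y z where yz: "P2 y z = x2" "P3 y z = x3" "P4 y z = x4" "P5 y z = x5" using surj by meson
    obtain X where X: "\<alpha>1 X = Complex (x1 / s) (x6 / 2)" "\<alpha>2 X = y" "\<alpha>3 X = z"
      using adapted_surj[OF A] by metis
    then show ?thesis using yz s by (intro exI[of _ X]) (simp add: f_def)
  qed
  then have "\<exists>X. \<forall>i\<in>{1..6}. f i X = (if i = j then 1 else 0)" for j
    unfolding atLeastAtMost_1_6 by simp
  then obtain e where e: "\<And>j i. i \<in> {1..6} \<Longrightarrow> f i (e j) = (if i = j then 1 else 0)" by metis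
  have lin1: "linear (\<lambda>X. s * Re (\<alpha>1 X))" "linear (\<lambda>X. 2 * Im (\<alpha>1 X))"
    by (auto intro!: linearI simp: adapted_linear[OF A] algebra_simps)
  have "dual_bases e f"
  proof (rule dual_basesI)
    fix i :: nat assume "i \<in> {1..6}"
    then show "linear (f i)" using lin lin1 unfolding atLeastAtMost_1_6 f_def by auto
  next
    fix X assume 0: "\<And>i. i \<in> {1..6} \<Longrightarrow> f i X = 0"
    have "f 1 X = 0" "f 2 X = 0" "f 3 X = 0" "f 4 X = 0" "f 5 X = 0" "f 6 X = 0"
      using 0 unfolding atLeastAtMost_1_6 by auto
    then show "X = 0"
      using s inj[of "\<alpha>2 X" "\<alpha>3 X"]
      by (intro adapted_inj[OF A]) (auto simp: f_def complex_eq_iff)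
  qed (use e in auto)
  moreover have "[ce_d br (f 1), ce_d br (f 2), ce_d br (f 3), ce_d br (f 4), ce_d br (f 5), ce_d br (f 6)] = \<eta> f"
    using eq by (simp add: f_def)
  ultimately show ?thesis unfolding isomorphic_to_def by blast
qed

lemma admits_basis_if_adapted:
  assumes A: "adapted br J N \<alpha>1 \<alpha>2 \<alpha>3 a b c d h k g"
    and eq: "\<theta> \<alpha>1 \<alpha>2 \<alpha>3 (\<alpha>1 - conj_form \<alpha>1) =
      [\<lambda>X Y. hform h k g (\<alpha>2 X) (\<alpha>3 X) (\<alpha>2 Y) (\<alpha>3 Y),
       - ((\<lambda>X. a * \<alpha>2 X + b * \<alpha>3 X) \<^bold>\<and> (\<alpha>1 - conj_form \<alpha>1)),
       - ((\<lambda>X. c * \<alpha>2 X + d * \<alpha>3 X) \<^bold>\<and> (\<alpha>1 - conj_form \<alpha>1))]"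
  shows "admits_basis br J \<theta>"
proof -
  have sigma: "(\<alpha>1 - conj_form \<alpha>1) X = 2 * \<i> * Im (\<alpha>1 X)" for X
    by (simp add: conj_form_def complex_eq_iff)
  have "[ce_d br \<alpha>1, ce_d br \<alpha>2, ce_d br \<alpha>3] = \<theta> \<alpha>1 \<alpha>2 \<alpha>3 (\<alpha>1 - conj_form \<alpha>1)"
    unfolding eq by (simp add: ce_d_def wedge_def sigma adapted_br[OF A] fun_eq_iff algebra_simps del: minus_apply)
  moreover have "basis10 J \<alpha>1 \<alpha>2 \<alpha>3"
    using adapted_form10[OF A] adapted_inj[OF A] adapted_surj[OF A] by (rule basis10_if_coordinates)
  ultimately show ?thesis unfolding admits_basis_def by blast
qed

lemmas form_simps = wedge_def scale_form_def conj_form_def hform_def fun_eq_iff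

lemma normal_h3_s33:
  assumes F: "frame br J N 1 0 0 0 0 \<epsilon> 0" and "\<epsilon> = -1 \<or> \<epsilon> = 1"
  shows "isomorphic_to br h3_s33"
    and "\<exists>\<epsilon>\<in>{-1, 1}. admits_basis br J (\<lambda>\<alpha>1 \<alpha>2 \<alpha>3 \<sigma>.
        [(\<i> * \<epsilon>) \<odot> \<alpha>3 \<^bold>\<and> conj_form \<alpha>3, - (\<alpha>2 \<^bold>\<and> \<sigma>), 0])"
proof -
  from F obtain \<alpha>1 \<alpha>2 \<alpha>3 where A: "adapted br J N \<alpha>1 \<alpha>2 \<alpha>3 1 0 0 0 0 \<epsilon> 0"
    unfolding frame_def by blast
  show "isomorphic_to br h3_s33"
    \<comment> \<open>The half compensates \<open>\<i> * (v * cnj v' - v' * cnj v) = 2 * (Re v * Im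
      v' - Im v * Re v')\<close>, and \<epsilon> is its own inverse.\<close>
    by (rule isomorphic_to_if_adapted[OF A, of "\<epsilon> / 2" "\<lambda>y z. Re z" "\<lambda>y z. Im z" "\<lambda>y z. Re y" "\<lambda>y z. Im y"
        "\<lambda>x2 x3 x4 x5. Complex x4 x5" "\<lambda>x2 x3 x4 x5. Complex x2 x3"])
      (use assms(2-) in \<open>auto intro!: linearI
        simp: adapted_linear[OF A] complex_eq_iff h3_s33_def ce_d_def form_simps adapted_br[OF A] algebra_simps add_divide_distrib diff_divide_distrib\<close>)
  show "\<exists>\<epsilon>\<in>{-1, 1}. admits_basis br J (\<lambda>\<alpha>1 \<alpha>2 \<alpha>3 \<sigma>.
        [(\<i> * \<epsilon>) \<odot> \<alpha>3 \<^bold>\<and> conj_form \<alpha>3, - (\<alpha>2 \<^bold>\<and> \<sigma>), 0])"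
    by (rule bexI[of _ "complex_of_real \<epsilon>"], rule admits_basis_if_adapted[OF A])
      (use assms(2-) in \<open>auto simp: form_simps algebra_simps\<close>)
qed

lemma normal_s47_R2:
  assumes F: "frame br J N 1 0 0 0 \<epsilon> 0 0" and "\<epsilon> = -1 \<or> \<epsilon> = 1"
  shows "isomorphic_to br s47_R2"
    and "\<exists>\<epsilon>\<in>{-1, 1}. admits_basis br J (\<lambda>\<alpha>1 \<alpha>2 \<alpha>3 \<sigma>.
        [(\<i> * \<epsilon>) \<odot> \<alpha>2 \<^bold>\<and> conj_form \<alpha>2, - (\<alpha>2 \<^bold>\<and> \<sigma>), 0])"
proof -
  from F obtain \<alpha>1 \<alpha>2 \<alpha>3 where A: "adapted br J N \<alpha>1 \<alpha>2 \<alpha>3 1 0 0 0 \<epsilon> 0 0"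
    unfolding frame_def by blast
  show "isomorphic_to br s47_R2"
    by (rule isomorphic_to_if_adapted[OF A, of "\<epsilon> / 2" "\<lambda>y z. Re y" "\<lambda>y z. Im y" "\<lambda>y z. Re z" "\<lambda>y z. Im z"
        "\<lambda>x2 x3 x4 x5. Complex x2 x3" "\<lambda>x2 x3 x4 x5. Complex x4 x5"])
      (use assms(2-) in \<open>auto intro!: linearI
        simp: adapted_linear[OF A] complex_eq_iff s47_R2_def ce_d_def form_simps adapted_br[OF A] algebra_simps add_divide_distrib diff_divide_distrib\<close>)
  show "\<exists>\<epsilon>\<in>{-1, 1}. admits_basis br J (\<lambda>\<alpha>1 \<alpha>2 \<alpha>3 \<sigma>.
        [(\<i> * \<epsilon>) \<odot> \<alpha>2 \<^bold>\<and> conj_form \<alpha>2, - (\<alpha>2 \<^bold>\<and> \<sigma>), 0])"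
    by (rule bexI[of _ "complex_of_real \<epsilon>"], rule admits_basis_if_adapted[OF A])
      (use assms(2-) in \<open>auto simp: form_simps algebra_simps\<close>)
qed

lemma normal_s6_44:
  assumes F: "frame br J N 1 \<i> 0 1 0 \<epsilon> 0" and "\<epsilon> = -1 \<or> \<epsilon> = 1"
  shows "isomorphic_to br s6_44"
    and "\<exists>\<epsilon>\<in>{-1, 1}. admits_basis br J (\<lambda>\<alpha>1 \<alpha>2 \<alpha>3 \<sigma>.
        [(\<i> * \<epsilon>) \<odot> \<alpha>3 \<^bold>\<and> conj_form \<alpha>3, - ((\<lambda>X. \<alpha>2 X + \<i> * \<alpha>3 X) \<^bold>\<and> \<sigma>), - (\<alpha>3 \<^bold>\<and> \<sigma>)])"
proof -
  from F obtain \<alpha>1 \<alpha>2 \<alpha>3 where A: "adapted br J N \<alpha>1 \<alpha>2 \<alpha>3 1 \<i> 0 1 0 \<epsilon> 0"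
    unfolding frame_def by blast
  show "isomorphic_to br s6_44"
    by (rule isomorphic_to_if_adapted[OF A, of "\<epsilon> / 2" "\<lambda>y z. Re z" "\<lambda>y z. Im z" "\<lambda>y z. Re y" "\<lambda>y z. Im y"
        "\<lambda>x2 x3 x4 x5. Complex x4 x5" "\<lambda>x2 x3 x4 x5. Complex x2 x3"])
      (use assms(2-) in \<open>auto intro!: linearI
        simp: adapted_linear[OF A] complex_eq_iff s6_44_def ce_d_def form_simps adapted_br[OF A] algebra_simps add_divide_distrib diff_divide_distrib\<close>)
  show "\<exists>\<epsilon>\<in>{-1, 1}. admits_basis br J (\<lambda>\<alpha>1 \<alpha>2 \<alpha>3 \<sigma>.
        [(\<i> * \<epsilon>) \<odot> \<alpha>3 \<^bold>\<and> conj_form \<alpha>3, - ((\<lambda>X. \<alpha>2 X + \<i> * \<alpha>3 X) \<^bold>\<and> \<sigma>), - (\<alpha>3 \<^bold>\<and> \<sigma>)])"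
    by (rule bexI[of _ "complex_of_real \<epsilon>"], rule admits_basis_if_adapted[OF A])
      (use assms(2-) in \<open>auto simp: form_simps algebra_simps\<close>)
qed

text \<open>The form does not involve \<alpha>3, so reversing the orientation of that plane by
  \<open>\<epsilon> * Im z\<close> hides the sign of its rotation from the real algebra. The complex
  structure still sees this sign.\<close>

lemma normal_s6_52:
  assumes F: "frame br J N 1 0 0 (complex_of_real (\<epsilon> * q)) \<delta> 0 0" and "\<epsilon> = -1 \<or> \<epsilon> = 1" and "\<delta> = -1 \<or> \<delta> = 1"
  shows "isomorphic_to br (s6_52 q)"
    and "\<exists>\<delta>\<in>{-1, 1}. \<exists>\<epsilon>\<in>{-1, 1}. admits_basis br J (\<lambda>\<alpha>1 \<alpha>2 \<alpha>3 \<sigma>.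
        [(\<i> * \<delta>) \<odot> \<alpha>2 \<^bold>\<and> conj_form \<alpha>2, - (\<alpha>2 \<^bold>\<and> \<sigma>), - ((\<epsilon> * complex_of_real q) \<odot> \<alpha>3 \<^bold>\<and> \<sigma>)])"
proof -
  from F obtain \<alpha>1 \<alpha>2 \<alpha>3 where A: "adapted br J N \<alpha>1 \<alpha>2 \<alpha>3 1 0 0 (complex_of_real (\<epsilon> * q)) \<delta> 0 0"
    unfolding frame_def by blast
  show "isomorphic_to br (s6_52 q)"
    by (rule isomorphic_to_if_adapted[OF A, of "\<delta> / 2" "\<lambda>y z. Re y" "\<lambda>y z. Im y" "\<lambda>y z. Re z" "\<lambda>y z. \<epsilon> * Im z"
        "\<lambda>x2 x3 x4 x5. Complex x2 x3" "\<lambda>x2 x3 x4 x5. Complex x4 (\<epsilon> * x5)"])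
      (use assms(2-) in \<open>auto intro!: linearI
        simp: adapted_linear[OF A] complex_eq_iff s6_52_def ce_d_def form_simps adapted_br[OF A] algebra_simps add_divide_distrib diff_divide_distrib\<close>)
  show "\<exists>\<delta>\<in>{-1, 1}. \<exists>\<epsilon>\<in>{-1, 1}. admits_basis br J (\<lambda>\<alpha>1 \<alpha>2 \<alpha>3 \<sigma>.
        [(\<i> * \<delta>) \<odot> \<alpha>2 \<^bold>\<and> conj_form \<alpha>2, - (\<alpha>2 \<^bold>\<and> \<sigma>), - ((\<epsilon> * complex_of_real q) \<odot> \<alpha>3 \<^bold>\<and> \<sigma>)])"
    by (rule bexI[of _ "complex_of_real \<delta>"], rule bexI[of _ "complex_of_real \<epsilon>"], rule admits_basis_if_adapted[OF A])
      (use assms(2-) in \<open>auto simp: form_simps algebra_simps\<close>)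
qed

lemma normal_s6_159:
  assumes F: "frame br J N 1 0 0 0 \<delta> \<epsilon> 0" and "\<epsilon> = -1 \<or> \<epsilon> = 1" and "\<delta> = -1 \<or> \<delta> = 1"
  shows "isomorphic_to br s6_159"
    and "\<exists>\<delta>\<in>{-1, 1}. \<exists>\<epsilon>\<in>{-1, 1}. admits_basis br J (\<lambda>\<alpha>1 \<alpha>2 \<alpha>3 \<sigma>.
        [(\<i> * \<delta>) \<odot> \<alpha>2 \<^bold>\<and> conj_form \<alpha>2 + (\<i> * \<epsilon>) \<odot> \<alpha>3 \<^bold>\<and> conj_form \<alpha>3, - (\<alpha>2 \<^bold>\<and> \<sigma>), 0])"
proof -
  from F obtain \<alpha>1 \<alpha>2 \<alpha>3 where A: "adapted br J N \<alpha>1 \<alpha>2 \<alpha>3 1 0 0 0 \<delta> \<epsilon> 0"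
    unfolding frame_def by blast
  show "isomorphic_to br s6_159"
    \<comment> \<open>\<alpha>3 is closed, so the relative sign of the two summands of the form can
      be absorbed into the single covector made from \<open>Re \<alpha>3\<close>.\<close>
    by (rule isomorphic_to_if_adapted[OF A, of "- \<delta> / 2" "\<lambda>y z. - \<epsilon> * \<delta> * Re z" "\<lambda>y z. Im y" "\<lambda>y z. Im z" "\<lambda>y z. Re y"
        "\<lambda>x2 x3 x4 x5. Complex x5 x3" "\<lambda>x2 x3 x4 x5. Complex (- \<epsilon> * \<delta> * x2) x4"])
      (use assms(2-) in \<open>auto intro!: linearI
        simp: adapted_linear[OF A] complex_eq_iff s6_159_def ce_d_def form_simps adapted_br[OF A] algebra_simps add_divide_distrib diff_divide_distrib\<close>)
  show "\<exists>\<delta>\<in>{-1, 1}. \<exists>\<epsilon>\<in>{-1, 1}. admits_basis br J (\<lambda>\<alpha>1 \<alpha>2 \<alpha>3 \<sigma>.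
        [(\<i> * \<delta>) \<odot> \<alpha>2 \<^bold>\<and> conj_form \<alpha>2 + (\<i> * \<epsilon>) \<odot> \<alpha>3 \<^bold>\<and> conj_form \<alpha>3, - (\<alpha>2 \<^bold>\<and> \<sigma>), 0])"
    by (rule bexI[of _ "complex_of_real \<delta>"], rule bexI[of _ "complex_of_real \<epsilon>"], rule admits_basis_if_adapted[OF A])
      (use assms(2-) in \<open>auto simp: form_simps algebra_simps\<close>)
qed

text \<open>The value \<open>g = - \<i>\<close> turns \<open>hform\<close> into \<alpha>2 \<and> cnj
  \<alpha>3 - \<alpha>3 \<and> cnj \<alpha>2, which is twice Re \<alpha>2 \<and> Re \<alpha>3 + Im
  \<alpha>2 \<and> Im \<alpha>3.\<close>

lemma normal_s6_162_1:
  assumes F: "frame br J N \<i> 0 0 (- \<i>) 0 0 (- \<i>)"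
  shows "isomorphic_to br s6_162_1"
    and "admits_basis br J (\<lambda>\<alpha>1 \<alpha>2 \<alpha>3 \<sigma>.
        [\<alpha>2 \<^bold>\<and> conj_form \<alpha>3 - \<alpha>3 \<^bold>\<and> conj_form \<alpha>2, - (\<i> \<odot> \<alpha>2 \<^bold>\<and> \<sigma>), \<i> \<odot> \<alpha>3 \<^bold>\<and> \<sigma>])"
proof -
  from F obtain \<alpha>1 \<alpha>2 \<alpha>3 where A: "adapted br J N \<alpha>1 \<alpha>2 \<alpha>3 \<i> 0 0 (- \<i>) 0 0 (- \<i>)"
    unfolding frame_def by blast
  show "isomorphic_to br s6_162_1"
    by (rule isomorphic_to_if_adapted[OF A, of "1 / 2" "\<lambda>y z. Re y" "\<lambda>y z. Im y" "\<lambda>y z. Re z" "\<lambda>y z. Im z"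
        "\<lambda>x2 x3 x4 x5. Complex x2 x3" "\<lambda>x2 x3 x4 x5. Complex x4 x5"])
      (auto intro!: linearI
        simp: adapted_linear[OF A] complex_eq_iff s6_162_1_def ce_d_def form_simps adapted_br[OF A] algebra_simps add_divide_distrib diff_divide_distrib)
  show "admits_basis br J (\<lambda>\<alpha>1 \<alpha>2 \<alpha>3 \<sigma>.
        [\<alpha>2 \<^bold>\<and> conj_form \<alpha>3 - \<alpha>3 \<^bold>\<and> conj_form \<alpha>2, - (\<i> \<odot> \<alpha>2 \<^bold>\<and> \<sigma>), \<i> \<odot> \<alpha>3 \<^bold>\<and> \<sigma>])"
    by (rule admits_basis_if_adapted[OF A])
      (auto simp: form_simps algebra_simps)
qed

lemma normal_s6_165:
  assumes F: "frame br J N (1 + \<i> * complex_of_real p) 0 0 (1 - \<i> * complex_of_real p) 0 0 (- \<i>)"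
  shows "isomorphic_to br (s6_165 p)"
    and "admits_basis br J (\<lambda>\<alpha>1 \<alpha>2 \<alpha>3 \<sigma>.
        [\<alpha>2 \<^bold>\<and> conj_form \<alpha>3 - \<alpha>3 \<^bold>\<and> conj_form \<alpha>2, - ((1 + \<i> * complex_of_real p) \<odot> \<alpha>2 \<^bold>\<and> \<sigma>), - ((1 - \<i> * complex_of_real p) \<odot> \<alpha>3 \<^bold>\<and> \<sigma>)])"
proof -
  from F obtain \<alpha>1 \<alpha>2 \<alpha>3 where A: "adapted br J N \<alpha>1 \<alpha>2 \<alpha>3 (1 + \<i> * complex_of_real p) 0 0 (1 - \<i> * complex_of_real p) 0 0 (- \<i>)"
    unfolding frame_def by blast
  show "isomorphic_to br (s6_165 p)"
    by (rule isomorphic_to_if_adapted[OF A, of "1 / 2" "\<lambda>y z. Re y" "\<lambda>y z. Im y" "\<lambda>y z. Re z" "\<lambda>y z. Im z"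
        "\<lambda>x2 x3 x4 x5. Complex x2 x3" "\<lambda>x2 x3 x4 x5. Complex x4 x5"])
      (auto intro!: linearI
        simp: adapted_linear[OF A] complex_eq_iff s6_165_def ce_d_def form_simps adapted_br[OF A] algebra_simps add_divide_distrib diff_divide_distrib)
  show "admits_basis br J (\<lambda>\<alpha>1 \<alpha>2 \<alpha>3 \<sigma>.
        [\<alpha>2 \<^bold>\<and> conj_form \<alpha>3 - \<alpha>3 \<^bold>\<and> conj_form \<alpha>2, - ((1 + \<i> * complex_of_real p) \<odot> \<alpha>2 \<^bold>\<and> \<sigma>), - ((1 - \<i> * complex_of_real p) \<odot> \<alpha>3 \<^bold>\<and> \<sigma>)])"
    by (rule admits_basis_if_adapted[OF A])
      (simp add: form_simps algebra_simps)
qed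

text \<open>For \<open>\<epsilon> = - 1\<close> a conjugation of \<alpha>3 reverses both its
  rotation and its summand of the form. The two occurrences of \<epsilon> cancel, and the real
  algebra depends on \<open>p\<close> alone.\<close>

lemma normal_s6_166:
  assumes F: "frame br J N 1 0 0 (complex_of_real (\<epsilon> * p)) \<delta> (\<epsilon> * \<delta>) 0" and "\<epsilon> = -1 \<or> \<epsilon> = 1" and "\<delta> = -1 \<or> \<delta> = 1"
  shows "isomorphic_to br (s6_166 p)"
    and "\<exists>\<delta>\<in>{-1, 1}. \<exists>\<epsilon>\<in>{-1, 1}. admits_basis br J (\<lambda>\<alpha>1 \<alpha>2 \<alpha>3 \<sigma>.
        [(\<i> * \<delta>) \<odot> \<alpha>2 \<^bold>\<and> conj_form \<alpha>2 + (\<i> * \<epsilon> * \<delta>) \<odot> \<alpha>3 \<^bold>\<and> conj_form \<alpha>3, - (\<alpha>2 \<^bold>\<and> \<sigma>), - ((\<epsilon> * complex_of_real p) \<odot> \<alpha>3 \<^bold>\<and> \<sigma>)])"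
proof -
  from F obtain \<alpha>1 \<alpha>2 \<alpha>3 where A: "adapted br J N \<alpha>1 \<alpha>2 \<alpha>3 1 0 0 (complex_of_real (\<epsilon> * p)) \<delta> (\<epsilon> * \<delta>) 0"
    unfolding frame_def by blast
  show "isomorphic_to br (s6_166 p)"
    by (rule isomorphic_to_if_adapted[OF A, of "- \<delta> / 2" "\<lambda>y z. Im y" "\<lambda>y z. \<epsilon> * Im z" "\<lambda>y z. Re y" "\<lambda>y z. Re z"
        "\<lambda>x2 x3 x4 x5. Complex x4 x2" "\<lambda>x2 x3 x4 x5. Complex x5 (\<epsilon> * x3)"])
      (use assms(2-) in \<open>auto intro!: linearI
        simp: adapted_linear[OF A] complex_eq_iff s6_166_def ce_d_def form_simps adapted_br[OF A] algebra_simps add_divide_distrib diff_divide_distrib\<close>)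
  show "\<exists>\<delta>\<in>{-1, 1}. \<exists>\<epsilon>\<in>{-1, 1}. admits_basis br J (\<lambda>\<alpha>1 \<alpha>2 \<alpha>3 \<sigma>.
        [(\<i> * \<delta>) \<odot> \<alpha>2 \<^bold>\<and> conj_form \<alpha>2 + (\<i> * \<epsilon> * \<delta>) \<odot> \<alpha>3 \<^bold>\<and> conj_form \<alpha>3, - (\<alpha>2 \<^bold>\<and> \<sigma>), - ((\<epsilon> * complex_of_real p) \<odot> \<alpha>3 \<^bold>\<and> \<sigma>)])"
    by (rule bexI[of _ "complex_of_real \<delta>"], rule bexI[of _ "complex_of_real \<epsilon>"], rule admits_basis_if_adapted[OF A])
      (use assms(2-) in \<open>auto simp: form_simps algebra_simps\<close>)
qed

lemma normal_s6_167:
  assumes F: "frame br J N 1 \<i> 0 1 0 0 (- \<i> * complex_of_real \<epsilon>)" and "\<epsilon> = -1 \<or> \<epsilon> = 1"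
  shows "isomorphic_to br s6_167"
    and "\<exists>\<epsilon>\<in>{-1, 1}. \<exists>x::real. admits_basis br J (\<lambda>\<alpha>1 \<alpha>2 \<alpha>3 \<sigma>.
        [\<epsilon> \<odot> \<alpha>2 \<^bold>\<and> conj_form \<alpha>3 - \<epsilon> \<odot> \<alpha>3 \<^bold>\<and> conj_form \<alpha>2 + (\<i> * complex_of_real x) \<odot> \<alpha>3 \<^bold>\<and> conj_form \<alpha>3, - ((\<lambda>X. \<alpha>2 X + \<i> * \<alpha>3 X) \<^bold>\<and> \<sigma>), - (\<alpha>3 \<^bold>\<and> \<sigma>)])"
proof -
  from F obtain \<alpha>1 \<alpha>2 \<alpha>3 where A: "adapted br J N \<alpha>1 \<alpha>2 \<alpha>3 1 \<i> 0 1 0 0 (- \<i> * complex_of_real \<epsilon>)"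
    unfolding frame_def by blast
  show "isomorphic_to br s6_167"
    by (rule isomorphic_to_if_adapted[OF A, of "- \<epsilon> / 2" "\<lambda>y z. Re z" "\<lambda>y z. Im z" "\<lambda>y z. Re y" "\<lambda>y z. Im y"
        "\<lambda>x2 x3 x4 x5. Complex x4 x5" "\<lambda>x2 x3 x4 x5. Complex x2 x3"])
      (use assms(2-) in \<open>auto intro!: linearI
        simp: adapted_linear[OF A] complex_eq_iff s6_167_def ce_d_def form_simps adapted_br[OF A] algebra_simps add_divide_distrib diff_divide_distrib\<close>)
  show "\<exists>\<epsilon>\<in>{-1, 1}. \<exists>x::real. admits_basis br J (\<lambda>\<alpha>1 \<alpha>2 \<alpha>3 \<sigma>.
        [\<epsilon> \<odot> \<alpha>2 \<^bold>\<and> conj_form \<alpha>3 - \<epsilon> \<odot> \<alpha>3 \<^bold>\<and> conj_form \<alpha>2 + (\<i> * complex_of_real x) \<odot> \<alpha>3 \<^bold>\<and> conj_form \<alpha>3, - ((\<lambda>X. \<alpha>2 X + \<i> * \<alpha>3 X) \<^bold>\<and> \<sigma>), - (\<alpha>3 \<^bold>\<and> \<sigma>)])"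
    \<comment> \<open>The parameter \<open>x\<close> can be taken to be 0:
      \<open>frame_jordan_normalise\<close> removes the corresponding term by a shear.\<close>
    by (rule bexI[of _ "complex_of_real \<epsilon>"], rule exI[of _ 0], rule admits_basis_if_adapted[OF A])
      (use assms(2-) in \<open>auto simp: form_simps algebra_simps\<close>)
qed

section \<open>Scaling coframes to normalised constants\<close>

text \<open>The value 1 at 0 keeps the scale factor invertible, so that a vanishing Hermitian entry
  needs no separate case.\<close>

definition root_abs :: "real \<Rightarrow> real" where
  "root_abs x = (if x = 0 then 1 else sqrt \<bar>x\<bar>)"

lemma root_abs: "root_abs x \<noteq> 0" "x / (root_abs x)\<^sup>2 = sgn x"
  by (auto simp: root_abs_def sgn_if)

lemma frame_diagonal_normalise:
  assumes F: "frame br J N (of_real a) 0 0 (of_real d) h k 0" and a: "a \<noteq> 0"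
  shows "frame br J N 1 0 0 (of_real (d / a)) (sgn (a * h)) (sgn (a * k)) 0"
  using frame_scale[OF F a, of "of_real (root_abs (a * h))" "of_real (root_abs (a * k))"] a
  by (simp add: root_abs)

lemma frame_eq:
  assumes "frame br J N a b c d h k g" "a = a'" "b = b'" "c = c'" "d = d'" "h = h'" "k = k'" "g = g'"
  shows "frame br J N a' b' c' d' h' k' g'"
  using assms by simp

lemma frame_conjugate_normalise:
  assumes F: "frame br J N a 0 0 (cnj a) 0 0 g" and a: "Re a \<noteq> 0" "Im a / Re a = p" and g: "g \<noteq> 0"
  shows "frame br J N (1 + \<i> * of_real p) 0 0 (1 - \<i> * of_real p) 0 0 (- \<i>)"
  \<comment> \<open>The last factor \<open>w\<close> is chosen so that
    \<open>Re a * g / cnj w\<close> equals \<open>- \<i>\<close>.\<close>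
  by (rule frame_eq[OF frame_scale[OF F a(1) one_neq_zero, of "cnj (\<i> * of_real (Re a) * g)"]])
    (use a g in \<open>auto simp: complex_eq_iff\<close>)

lemma frame_imaginary_normalise:
  assumes F: "frame br J N a 0 0 (cnj a) 0 0 g" and a: "Re a = 0" "Im a \<noteq> 0" and g: "g \<noteq> 0"
  shows "frame br J N \<i> 0 0 (- \<i>) 0 0 (- \<i>)"
  by (rule frame_eq[OF frame_scale[OF F a(2) one_neq_zero, of "cnj (\<i> * of_real (Im a) * g)"]])
    (use a g in \<open>auto simp: complex_eq_iff\<close>)

lemma frame_jordan_degenerate_normalise:
  assumes F: "frame br J N (of_real a) b 0 (of_real a) 0 k 0" and a: "a \<noteq> 0" and b: "b \<noteq> 0"
  shows "frame br J N 1 \<i> 0 1 0 (sgn (a * k)) 0"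
  \<comment> \<open>The first factor \<open>s\<close> is fixed by requiring the off-diagonal entry
    \<open>b * s / (w * a)\<close> to be \<open>\<i>\<close>.\<close>
  using frame_scale[OF F a, of "\<i> * of_real (root_abs (a * k)) * of_real a / b" "of_real (root_abs (a * k))"] a b
  by (simp add: root_abs)

text \<open>With \<open>h = c = 0\<close> and equal diagonal entries a shear changes only
  \<open>k\<close>, so \<open>k\<close> can be cleared. Scaling then makes the off-diagonal entry
  \<open>\<i>\<close>, and only the sign of the real number \<open>b * g\<close> survives.\<close>

lemma frame_jordan_normalise:
  assumes F: "frame br J N (of_real a) b 0 (of_real a) 0 k g" and a: "a \<noteq> 0" and b: "b \<noteq> 0"
    and g: "g \<noteq> 0" and bg: "Im (b * g) = 0"
  shows "frame br J N 1 \<i> 0 1 0 0 (- \<i> * of_real (sgn (Re (b * g))))"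
proof -
  have F': "frame br J N (of_real a) b 0 (of_real a) 0 0 g"
    using frame_shear[OF F, of "of_real (k / 2) / g"] g by simp
  define x where "x = Re (b * g)"
  have x: "b * g = of_real x" using bg by (simp add: x_def complex_eq_iff)
  define s where "s = \<i> * of_real (root_abs x) * of_real a / b"
  have s: "s \<noteq> 0" using a b root_abs(1) by (simp add: s_def)
  have "of_real a * g / (s * cnj (of_real (root_abs x))) = - \<i> * (of_real x / (of_real (root_abs x))\<^sup>2)"
    using a b root_abs(1)[of x] by (simp add: s_def x[symmetric] field_simps power2_eq_square)
  also have "of_real x / (of_real (root_abs x))\<^sup>2 = complex_of_real (sgn x)"
    unfolding root_abs(2)[symmetric] by simp
  finally have eq: "of_real a * g / (s * cnj (of_real (root_abs x))) = - \<i> * of_real (sgn x)" .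
  show ?thesis
    by (rule frame_eq[OF frame_scale[OF F', of a s "of_real (root_abs x)"]])
      (use eq a b s root_abs(1)[of x] in \<open>auto simp: x_def s_def\<close>)
qed

section \<open>Classification of adapted coframes\<close>

text \<open>The \<open>\<alpha>1\<close>-component of the Jacobi identity for \<open>W\<close> and two vectors of \<open>N \<inter> J N\<close>.\<close>

lemma frame_skew:
  assumes lie: "lie_algebra br" and F: "frame br J N a b 0 d h k g"
  shows "h * Im a = 0" "(a - cnj d) * g = h * cnj b" "Im (b * g) + k * Im d = 0"
proof -
  from F obtain \<alpha>1 \<alpha>2 \<alpha>3 where A: "adapted br J N \<alpha>1 \<alpha>2 \<alpha>3 a b 0 d h k g"
    unfolding frame_def by blast
  obtain W where W: "\<alpha>1 W = \<i>" "\<alpha>2 W = 0" "\<alpha>3 W = 0" using adapted_surj[OF A] by metis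
  have main: "hform h k g p q (2 * \<i> * (a * p' + b * q')) (2 * \<i> * (d * q'))
     + hform h k g p' q' (- 2 * \<i> * (a * p + b * q)) (- 2 * \<i> * (d * q)) = 0" for p q p' q'
  proof -
    obtain X where X: "\<alpha>1 X = 0" "\<alpha>2 X = p" "\<alpha>3 X = q" using adapted_surj[OF A] by metis
    obtain Y where Y: "\<alpha>1 Y = 0" "\<alpha>2 Y = p'" "\<alpha>3 Y = q'" using adapted_surj[OF A] by metis
    have "br W (br X Y) + br X (br Y W) + br Y (br W X) = 0"
      using lie unfolding lie_algebra_def by blast
    moreover have "\<alpha>1 0 = 0" using adapted_linear(4)[OF A, of 0 0] by simp
    ultimately have "\<alpha>1 (br W (br X Y) + br X (br Y W) + br Y (br W X)) = 0" by simp
    then have "\<alpha>1 (br W (br X Y)) + \<alpha>1 (br X (br Y W)) + \<alpha>1 (br Y (br W X)) = 0"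
      by (simp only: adapted_linear[OF A])
    moreover have "\<alpha>1 (br W (br X Y)) = 0" by (simp add: adapted_br[OF A] W hform_def)
    moreover have "\<alpha>1 (br X (br Y W)) = - hform h k g p q (2 * \<i> * (a * p' + b * q')) (2 * \<i> * (d * q'))"
      by (simp add: adapted_br[OF A] X Y W)
    moreover have "\<alpha>1 (br Y (br W X)) = - hform h k g p' q' (- 2 * \<i> * (a * p + b * q)) (- 2 * \<i> * (d * q))"
      by (simp add: adapted_br[OF A] X Y W) (simp add: algebra_simps)
    ultimately have "- (hform h k g p q (2 * \<i> * (a * p' + b * q')) (2 * \<i> * (d * q'))
     + hform h k g p' q' (- 2 * \<i> * (a * p + b * q)) (- 2 * \<i> * (d * q))) = 0" by simp
    then show ?thesis by (simp only: neg_equal_0_iff_equal)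
  qed
  \<comment> \<open>The unit vectors and their multiples by \<open>\<i>\<close> isolate the entries
    of the skewness equation.\<close>
  show "h * Im a = 0"
    using main[of 1 0 \<i> 0] by (simp add: hform_def complex_eq_iff algebra_simps)
  show "(a - cnj d) * g = h * cnj b"
    using main[of 1 0 0 1] main[of 1 0 0 \<i>] by (simp add: hform_def complex_eq_iff algebra_simps)
  show "Im (b * g) + k * Im d = 0"
    using main[of 0 1 0 \<i>] by (simp add: hform_def complex_eq_iff algebra_simps)
qed

lemma bracket_span_subset:
  assumes "subspace S" and "\<And>X Y. X \<in> A \<Longrightarrow> Y \<in> B \<Longrightarrow> br X Y \<in> S"
  shows "bracket_span br A B \<subseteq> S"
  unfolding bracket_span_def by (rule span_minimal) (use assms in auto)

lemma nilpotent_ideal_two_step: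
  assumes "subspace I" "\<And>X Y. Y \<in> I \<Longrightarrow> br X Y \<in> I"
    and "subspace S" "\<And>X Y. X \<in> I \<Longrightarrow> Y \<in> I \<Longrightarrow> br X Y \<in> S" "\<And>X Y. Y \<in> S \<Longrightarrow> br X Y = 0"
  shows "nilpotent_ideal br I"
proof -
  have "lower_central br I 1 \<subseteq> S"
    using assms(3,4) by (simp add: bracket_span_subset)
  then have "lower_central br I 2 \<subseteq> {0}"
    using assms(5) by (simp add: numeral_2_eq_2) (rule bracket_span_subset, auto simp: subspace_single_0)
  moreover have "0 \<in> lower_central br I 2"
    by (simp add: numeral_2_eq_2 bracket_span_def span_zero)
  ultimately have "lower_central br I 2 = {0}" by blast
  then show ?thesis unfolding nilpotent_ideal_def using assms(1,2) by blast
qed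

text \<open>With zero diagonal the lower central series of the whole algebra falls into
  \<open>\<alpha>3 = 0\<close>, then into the real line where \<alpha>2 vanishes too, then to 0.
  Being a nilpotent ideal, the whole algebra would lie in \<open>N\<close>, which is a
  hyperplane.\<close>

lemma frame_not_nilpotent:
  assumes N: "is_nilradical br N" and F: "frame br J N 0 b 0 0 h k g"
  shows False
proof -
  from F obtain \<alpha>1 \<alpha>2 \<alpha>3 where A: "adapted br J N \<alpha>1 \<alpha>2 \<alpha>3 0 b 0 0 h k g"
    unfolding frame_def by blast
  have zero: "\<alpha>1 0 = 0" "\<alpha>2 0 = 0" "\<alpha>3 0 = 0"
    using adapted_linear(4-)[OF A, of 0 0] by simp_all
  let ?S1 = "{X. Im (\<alpha>1 X) = 0 \<and> \<alpha>3 X = 0}" and ?S2 = "{X. Im (\<alpha>1 X) = 0 \<and> \<alpha>2 X = 0 \<and> \<alpha>3 X = 0}"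
  have S: "subspace ?S1" "subspace ?S2"
    by (auto intro!: subspaceI simp: zero adapted_linear[OF A])
  have Im: "Im (\<alpha>1 (br X Y)) = 0" for X Y
    by (simp add: adapted_br[OF A] hform_def algebra_simps)
  have 1: "lower_central br UNIV 1 \<subseteq> ?S1"
    using S(1) by (simp, intro bracket_span_subset) (auto simp: Im, simp add: adapted_br[OF A])
  have 2: "lower_central br UNIV (Suc 1) \<subseteq> ?S2"
    unfolding lower_central.simps(2)[of _ _ 1]
    using S(2) 1 by (intro bracket_span_subset) (auto simp: Im, auto simp add: adapted_br[OF A])
  have 3: "lower_central br UNIV (Suc (Suc 1)) \<subseteq> {0}"
    unfolding lower_central.simps(2)[of _ _ "Suc 1"]
  proof (rule bracket_span_subset)
    fix X Y assume "Y \<in> lower_central br UNIV (Suc 1)"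
    then have "Im (\<alpha>1 Y) = 0" "\<alpha>2 Y = 0" "\<alpha>3 Y = 0" using 2 by auto
    then have "br X Y = 0"
      by (intro adapted_inj[OF A]) (simp_all add: adapted_br[OF A] hform_def)
    then show "br X Y \<in> {0}" by simp
  qed (simp add: subspace_single_0)
  moreover have "0 \<in> lower_central br UNIV (Suc (Suc 1))"
    by (simp add: bracket_span_def span_zero)
  ultimately have "lower_central br UNIV (Suc (Suc 1)) = {0}" by blast
  then have "nilpotent_ideal br UNIV" unfolding nilpotent_ideal_def by (metis UNIV_I subspace_UNIV)
  then have "UNIV \<subseteq> N" using N unfolding is_nilradical_def by blast
  moreover obtain W where "\<alpha>1 W = \<i>" using adapted_surj[OF A] by metis
  ultimately show False using adapted_N[OF A, of W] by auto
qed

lemma frame_not_abelian: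
  assumes N: "lower_central br N 1 \<noteq> {0}" and F: "frame br J N a b c d 0 0 0"
  shows False
proof -
  from F obtain \<alpha>1 \<alpha>2 \<alpha>3 where A: "adapted br J N \<alpha>1 \<alpha>2 \<alpha>3 a b c d 0 0 0"
    unfolding frame_def by blast
  have "br X Y = 0" if "X \<in> N" "Y \<in> N" for X Y
    using that by (intro adapted_inj[OF A]) (simp_all add: adapted_br[OF A] adapted_N[OF A] hform_def)
  then have "lower_central br N 1 \<subseteq> {0}"
    by (simp, intro bracket_span_subset) (auto simp: subspace_single_0)
  moreover have "0 \<in> lower_central br N 1" by (simp add: bracket_span_def span_zero)
  ultimately show False using N by blast
qed

lemma frame_triangularise:
  assumes F: "frame br J N a b c d h k g"
  obtains a' b' d' h' k' g' where "frame br J N a' b' 0 d' h' k' g'"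
proof (cases "b = 0")
  case True
  then show ?thesis using that frame_swap[OF F] by simp
next
  case False
  \<comment> \<open>\<open>\<alpha>3 + t \<alpha>2\<close> is to become an eigenform.\<close>
  define t where "t = ((a - d) + csqrt ((a - d)\<^sup>2 + 4 * b * c)) / (2 * b)"
  have "(2 * b * t - (a - d))\<^sup>2 = (a - d)\<^sup>2 + 4 * b * c"
    using False by (simp add: t_def)
  then have "4 * b * (b * t\<^sup>2 - (a - d) * t - c) = 0"
    by (simp add: power2_eq_square algebra_simps)
  then have "b * t\<^sup>2 - (a - d) * t - c = 0" using False by simp
  then have t: "c + t * a - t * (d + t * b) = 0" by (simp add: power2_eq_square algebra_simps)
  \<comment> \<open>\<open>frame_shear\<close> alters \<alpha>2 only, so the shear of \<alpha>3 is
    conjugated by two swaps.\<close>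
  from frame_swap[OF frame_shear[OF frame_swap[OF F], of t]] t
  have "frame br J N (a - t * b) b 0 (d + t * b) (h - 2 * Re (cnj g * t) + k * (cmod t)\<^sup>2) k (cnj (cnj g - k * cnj t))"
    by (simp add: algebra_simps)
  then show ?thesis using that by blast
qed

text \<open>A scalar coefficient matrix is fixed by shears and swaps, so the Hermitian form can be
  treated alone, by completing the square.\<close>

lemma frame_hermitian_diagonalise:
  assumes F: "frame br J N a 0 0 a h k g"
  obtains h' k' where "frame br J N a 0 0 a h' k' 0"
proof -
  have case1: thesis if "frame br J N a 0 0 a h k g" "h \<noteq> 0" for h k g
  proof -
    have "frame br J N a 0 0 a h (k - 2 * Re (g * (cnj g / h)) + h * (cmod (cnj g / h))\<^sup>2) 0"
      using frame_shear[OF that(1), of "cnj g / h"] that(2) by simp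
    then show ?thesis using \<open>\<And>h' k'. frame br J N a 0 0 a h' k' 0 \<Longrightarrow> thesis\<close> by blast
  qed
  have case2: thesis if "frame br J N a 0 0 a h k g" "k \<noteq> 0" for h k g
    using case1[OF frame_swap[OF that(1)] that(2)] .
  show ?thesis
  proof (cases "h \<noteq> 0 \<or> k \<noteq> 0")
    case True
    then show ?thesis using case1[OF F] case2[OF F] by blast
  next
    case False
    show ?thesis
    proof (cases "g = 0")
      case True
      then show ?thesis using that F by blast
    next
      case g: False
      \<comment> \<open>A purely off-diagonal form first acquires a nonzero diagonal entry by the
        shear with \<open>cnj g\<close>.\<close>
      have "frame br J N a 0 0 a 0 (- 2 * Re (g * cnj g)) g"
        using frame_shear[OF F, of "cnj g"] False by simp
      moreover have "Re (g * cnj g) \<noteq> 0" using g unfolding complex_mult_cnj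
        by (auto simp: complex_eq_iff sum_power2_eq_zero_iff)
      ultimately show ?thesis using case2[of 0 "- 2 * Re (g * cnj g)" g] by linarith
    qed
  qed
qed

text \<open>The skewness equations tie the form to the spectrum. Distinct real entries force
  orthogonal eigenlines; nonreal distinct entries force isotropic eigenlines and then conjugacy; a
  Jordan block forces its eigenline to be isotropic. In the diagonal family
  \<open>\<bar>d\<bar> \<le> \<bar>a\<bar>\<close> is a choice of order, made by
  \<open>frame_swap\<close>.\<close>

lemma frame_classification:
  assumes lie: "lie_algebra br" and N: "is_nilradical br N" "lower_central br N 1 \<noteq> {0}"
    and trace: "\<And>a b c d h k g. frame br J N a b c d h k g \<Longrightarrow> Im (a + d) = 0"
    and F: "frame br J N a b c d h k g"
  obtains (diagonal) a d h k where "frame br J N (of_real a) 0 0 (of_real d) h k 0" "a \<noteq> 0" "\<bar>d\<bar> \<le> \<bar>a\<bar>" "h \<noteq> 0 \<or> k \<noteq> 0"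
  | (conjugate) a g where "frame br J N a 0 0 (cnj a) 0 0 g" "Im a \<noteq> 0" "g \<noteq> 0"
  | (jordan) a b k g where "frame br J N (of_real a) b 0 (of_real a) 0 k g" "a \<noteq> 0" "b \<noteq> 0" "Im (b * g) = 0" "g \<noteq> 0 \<or> k \<noteq> 0"
proof -
  have diag: thesis if F: "frame br J N (of_real a) 0 0 (of_real d) h k 0" for a d h k
  proof -
    have hk: "h \<noteq> 0 \<or> k \<noteq> 0" using F frame_not_abelian[OF N(2)] by blast
    have ad: "a \<noteq> 0 \<or> d \<noteq> 0" using F frame_not_nilpotent[OF N(1)] by fastforce
    show thesis
    proof (cases "\<bar>d\<bar> \<le> \<bar>a\<bar>")
      case True
      then show thesis using diagonal[OF F] hk ad by auto
    next
      case False
      then show thesis using diagonal[of d a k h] frame_swap[OF F] hk ad by auto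
    qed
  qed
  obtain a b d h k g where F: "frame br J N a b 0 d h k g"
    using frame_triangularise[OF F] .
  have Imd: "Im d = - Im a" using trace[OF F] by simp
  note skew = frame_skew[OF lie F]
  show thesis
  proof (cases "a = d")
    case False
    \<comment> \<open>The shear to eigenforms, available because the diagonal entries
      differ.\<close>
    define t where "t = b / (a - d)"
    have t: "b + t * d - t * a = 0" using False by (simp add: t_def field_simps)
    define h' k' g' where "h' = h" and "k' = k - 2 * Re (g * t) + h * (cmod t)\<^sup>2" and "g' = g - h * cnj t"
    have F': "frame br J N a 0 0 d h' k' g'"
      using frame_shear[OF F, of t] t by (simp add: h'_def k'_def g'_def)
    note skew = frame_skew[OF lie F']
    show thesis
    proof (cases "Im a = 0")
      case True
      then have r: "a = of_real (Re a)" "d = of_real (Re d)" using Imd by (auto simp: complex_eq_iff)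
      have "a - cnj d \<noteq> 0" using False True Imd by (auto simp: complex_eq_iff)
      then have "g' = 0" using skew(2) by simp
      then show thesis using diag[of "Re a" "Re d" h' k'] F' r by simp
    next
      case Ima: False
      then have "h' = 0" "k' = 0" using skew Imd by auto
      moreover from this have "g' \<noteq> 0" using F' frame_not_abelian[OF N(2)] by blast
      ultimately have "a - cnj d = 0" using skew(2) by simp
      then have "d = cnj a" by (simp add: complex_eq_iff)
      then show thesis using conjugate[of a g'] F' Ima \<open>h' = 0\<close> \<open>k' = 0\<close> \<open>g' \<noteq> 0\<close> by simp
    qed
  next
    case True
    then have r: "Im a = 0" "a = of_real (Re a)" using Imd by (auto simp: complex_eq_iff)
    show thesis
    proof (cases "b = 0")
      case b: True
      then have "frame br J N a 0 0 a h k g" using F True by simp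
      then obtain h' k' where "frame br J N a 0 0 a h' k' 0" using frame_hermitian_diagonalise by blast
      then show thesis using diag[of "Re a" "Re a" h' k'] r by simp
    next
      case b: False
      \<comment> \<open>The second skewness equation now reads \<open>0 = h * cnj b\<close>.\<close>
      have "a - cnj d = 0" using True r by (simp add: complex_eq_iff)
      then have h: "h = 0" using skew(2) b by simp
      have F': "frame br J N (of_real (Re a)) b 0 (of_real (Re a)) 0 k g"
        using F True h r(2) by simp
      have "Re a \<noteq> 0" using F' frame_not_nilpotent[OF N(1)] by force
      moreover have "Im (b * g) = 0" using skew(3) r(1) True by simp
      moreover have "g \<noteq> 0 \<or> k \<noteq> 0" using F h frame_not_abelian[OF N(2)] by blast
      ultimately show thesis using jordan[OF F'] b by blast
    qed
  qed
qed

section \<open>Comparison with a given isomorphism class\<close>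

text \<open>The radical of the real form is the kernel of the Hermitian one: pairing with
  \<open>\<i>\<close> times a component of the Hermitian image gives twice the squared modulus of
  that component.\<close>

lemma hform_eq_zero:
  assumes "\<And>y z. hform h k g u v y z = 0"
  shows "h * u + cnj g * v = 0" and "g * u + k * v = 0"
proof -
  define P Q where "P = h * u + cnj g * v" and "Q = g * u + k * v"
  have eq: "hform h k g u v y z = \<i> * (P * cnj y - y * cnj P + (Q * cnj z - z * cnj Q))" for y z
    by (simp add: hform_def P_def Q_def algebra_simps)
  have *: "\<i> * (p * cnj (\<i> * p) - \<i> * p * cnj p) = 2 * (p * cnj p)" for p
    by (simp add: complex_eq_iff)
  have "2 * (P * cnj P) = 0"
    using assms[of "\<i> * P" 0] unfolding eq *[symmetric]
    by (simp only: complex_cnj_zero mult_zero_left mult_zero_right diff_self add_0_right)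
  then show "h * u + cnj g * v = 0" by (simp add: P_def[symmetric])
  have "2 * (Q * cnj Q) = 0"
    using assms[of 0 "\<i> * Q"] unfolding eq *[symmetric]
    by (simp only: complex_cnj_zero mult_zero_left mult_zero_right diff_self add_0_left)
  then show "g * u + k * v = 0" by (simp add: Q_def[symmetric])
qed

type_synonym quad = "complex \<times> complex \<times> complex \<times> complex"

text \<open>\<open>R\<close> is the transpose of \<open>ad e\<^sub>6\<close> on \<open>N/[N,N]\<close> in the basis \<open>e\<^sub>2, \<dots>, e\<^sub>5\<close> of a listed Lie algebra, and \<open>\<omega>\<close> is
  its form \<open>df\<^sup>1\<close>; \<open>u\<^sub>i\<close> and \<open>v\<^sub>i\<close> are the values on \<open>e\<^sub>i\<close> of the forms \<open>\<alpha>2\<close> and \<open>\<alpha>3\<close> of an adapted coframe with \<open>c = 0\<close>,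
  and \<open>\<tau> = Im (\<alpha>1 e\<^sub>6)\<close>, \<open>\<rho> = \<alpha>1 e\<^sub>1\<close>.\<close>

locale realisation =
  fixes R :: "complex \<Rightarrow> complex \<Rightarrow> complex \<Rightarrow> complex \<Rightarrow> quad"
    and \<omega> :: "real \<Rightarrow> real \<Rightarrow> real \<Rightarrow> real \<Rightarrow> real \<Rightarrow> real \<Rightarrow> real \<Rightarrow> real \<Rightarrow> real"
    and a b d :: complex and h k :: real and g u2 u3 u4 u5 v2 v3 v4 v5 :: complex and \<tau> \<rho> :: real
  assumes tau: "\<tau> \<noteq> 0" and rho: "\<rho> \<noteq> 0"
    and inj: "\<And>x2 x3 x4 x5. of_real x2 * u2 + of_real x3 * u3 + of_real x4 * u4 + of_real x5 * u5 = 0 \<Longrightarrow>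
        of_real x2 * v2 + of_real x3 * v3 + of_real x4 * v4 + of_real x5 * v5 = 0
          \<Longrightarrow> x2 = 0 \<and> x3 = 0 \<and> x4 = 0 \<and> x5 = 0"
    and surj: "\<And>y z. \<exists>x2 x3 x4 x5. y = of_real x2 * u2 + of_real x3 * u3 + of_real x4 * u4 + of_real x5 * u5 \<and>
        z = of_real x2 * v2 + of_real x3 * v3 + of_real x4 * v4 + of_real x5 * v5"
    and R_u: "R u2 u3 u4 u5 = (- 2 * \<i> * of_real \<tau> * (a * u2 + b * v2), - 2 * \<i> * of_real \<tau> * (a * u3 + b * v3),
         - 2 * \<i> * of_real \<tau> * (a * u4 + b * v4), - 2 * \<i> * of_real \<tau> * (a * u5 + b * v5))"
    and R_v: "R v2 v3 v4 v5 = (- 2 * \<i> * of_real \<tau> * (d * v2), - 2 * \<i> * of_real \<tau> * (d * v3),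
         - 2 * \<i> * of_real \<tau> * (d * v4), - 2 * \<i> * of_real \<tau> * (d * v5))"
    and form: "\<And>x2 x3 x4 x5 y2 y3 y4 y5. hform h k g
        (of_real x2 * u2 + of_real x3 * u3 + of_real x4 * u4 + of_real x5 * u5) (of_real x2 * v2 + of_real x3 * v3 + of_real x4 * v4 + of_real x5 * v5)
        (of_real y2 * u2 + of_real y3 * u3 + of_real y4 * u4 + of_real y5 * u5) (of_real y2 * v2 + of_real y3 * v3 + of_real y4 * v4 + of_real y5 * v5)
        = of_real (\<rho> * \<omega> x2 x3 x4 x5 y2 y3 y4 y5)"

definition realises ::
  "(complex \<Rightarrow> complex \<Rightarrow> complex \<Rightarrow> complex \<Rightarrow> quad)
   \<Rightarrow> (real \<Rightarrow> real \<Rightarrow> real \<Rightarrow> real \<Rightarrow> real \<Rightarrow> real \<Rightarrow> real \<Rightarrow> real \<Rightarrow> real)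
   \<Rightarrow> complex \<Rightarrow> complex \<Rightarrow> complex \<Rightarrow> real \<Rightarrow> real \<Rightarrow> complex \<Rightarrow> bool" where
  "realises R \<omega> a b d h k g \<longleftrightarrow>
    (\<exists>u2 u3 u4 u5 v2 v3 v4 v5 \<tau> \<rho>. realisation R \<omega> a b d h k g u2 u3 u4 u5 v2 v3 v4 v5 \<tau> \<rho>)"

lemma dual_bases_expand:
  assumes "dual_bases e f"
  shows "X = f 1 X *\<^sub>R e 1 + f 2 X *\<^sub>R e 2 + f 3 X *\<^sub>R e 3 + f 4 X *\<^sub>R e 4 + f 5 X *\<^sub>R e 5 + f 6 X *\<^sub>R e 6"
proof -
  have inj: "inj_on e {1..6}" and span: "span (e ` {1..6}) = UNIV"
    and f: "\<And>i. i \<in> {1..6} \<Longrightarrow> linear (f i)"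
    and fe: "\<And>i j. i \<in> {1..6} \<Longrightarrow> j \<in> {1..6} \<Longrightarrow> f i (e j) = (if i = j then 1 else 0)"
    using assms unfolding dual_bases_def by blast+
  have "X \<in> span (e ` {1..6})" using span by simp
  then obtain u where u: "X = (\<Sum>x\<in>e ` {1..6}. u x *\<^sub>R x)"
    by (auto simp: span_finite)
  then have X: "X = (\<Sum>j\<in>{1..6}. u (e j) *\<^sub>R e j)" using inj by (simp add: sum.reindex)
  have "f i X = u (e i)" if i: "i \<in> {1..6}" for i
  proof -
    have "f i X = (\<Sum>j\<in>{1..6}. u (e j) * f i (e j))"
      unfolding X using f[OF i] by (simp add: linear_sum linear_scale)
    also have "\<dots> = (\<Sum>j\<in>{1..6}. if i = j then u (e j) else 0)"
      using fe[OF i] by (intro sum.cong) auto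
    finally show ?thesis using i by simp
  qed
  then have "(\<Sum>j\<in>{1..6}. u (e j) *\<^sub>R e j) = (\<Sum>j\<in>{1..6}. f j X *\<^sub>R e j)" by simp
  then have "X = (\<Sum>j\<in>{1..6}. f j X *\<^sub>R e j)" using X by simp
  then show ?thesis unfolding atLeastAtMost_1_6 by (simp add: add.assoc)
qed

text \<open>The bridge from a real basis to the coframe. The hyperplane \<open>f 6 = 0\<close> is a
  two-step nilpotent ideal, hence equal to \<open>N\<close>, and \<open>e 1\<close> spans its
  brackets. So \<alpha>2 and \<alpha>3 vanish on \<open>e 1\<close>, and on \<open>N\<close> they
  are given by their values on \<open>e 2\<close> to \<open>e 5\<close>.\<close>

lemma realisesI:
  fixes br :: "'a::real_vector \<Rightarrow> 'a \<Rightarrow> 'a"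
  assumes N: "is_nilradical br N" and F: "frame br J N a b 0 d h k g"
    and ef: "dual_bases e f"
    and f1: "\<And>X Y. f 1 (br X Y) = - \<omega> (f 2 X) (f 3 X) (f 4 X) (f 5 X) (f 2 Y) (f 3 Y) (f 4 Y) (f 5 Y)"
    and f6: "\<And>X Y. f 6 (br X Y) = 0"
    and two_step: "\<And>X Y i. f 6 X = 0 \<Longrightarrow> f 6 Y = 0 \<Longrightarrow> i \<in> {2..5} \<Longrightarrow> f i (br X Y) = 0"
    and central: "\<And>X Y i. f 2 Y = 0 \<Longrightarrow> f 3 Y = 0 \<Longrightarrow> f 4 Y = 0 \<Longrightarrow> f 5 Y = 0 \<Longrightarrow> f 6 Y = 0 \<Longrightarrow> i \<in> {1..5} \<Longrightarrow> f i (br X Y) = 0"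
    and \<omega>: "\<omega> x2 x3 x4 x5 y2 y3 y4 y5 \<noteq> 0"
    and R: "\<And>x2 x3 x4 x5. R x2 x3 x4 x5 =
        (f 2 (br (e 6) (e 2)) * x2 + f 3 (br (e 6) (e 2)) * x3 + f 4 (br (e 6) (e 2)) * x4 + f 5 (br (e 6) (e 2)) * x5,
         f 2 (br (e 6) (e 3)) * x2 + f 3 (br (e 6) (e 3)) * x3 + f 4 (br (e 6) (e 3)) * x4 + f 5 (br (e 6) (e 3)) * x5,
         f 2 (br (e 6) (e 4)) * x2 + f 3 (br (e 6) (e 4)) * x3 + f 4 (br (e 6) (e 4)) * x4 + f 5 (br (e 6) (e 4)) * x5,
         f 2 (br (e 6) (e 5)) * x2 + f 3 (br (e 6) (e 5)) * x3 + f 4 (br (e 6) (e 5)) * x4 + f 5 (br (e 6) (e 5)) * x5)"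
  shows "realises R \<omega> a b d h k g"
proof -
  from F obtain \<alpha>1 \<alpha>2 \<alpha>3 where A: "adapted br J N \<alpha>1 \<alpha>2 \<alpha>3 a b 0 d h k g"
    unfolding frame_def by blast
  have lin: "linear (f i)" if "i \<in> {1..6}" for i using ef that unfolding dual_bases_def by blast
  have fe: "f i (e j) = (if i = j then 1 else 0)" if "i \<in> {1..6}" "j \<in> {1..6}" for i j
    using ef that unfolding dual_bases_def by blast
  have fadd: "f i (X + Y) = f i X + f i Y" and fscale: "f i (r *\<^sub>R X) = r * f i X" if "i \<in> {1..6}" for i X Y r
    using lin[OF that] by (simp_all add: linear_add linear_scale)
  have f0: "f i 0 = 0" if "i \<in> {1..6}" for i using fscale[OF that, of 0 0] by simp
  note ex = dual_bases_expand[OF ef]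
  have zeroI: "X = 0" if "\<And>i. i \<in> {1..6} \<Longrightarrow> f i X = 0" for X
    by (rule trans[OF ex]) (simp add: that del: One_nat_def)
  let ?K = "{X. f 6 X = 0}" and ?S = "{X. f 2 X = 0 \<and> f 3 X = 0 \<and> f 4 X = 0 \<and> f 5 X = 0 \<and> f 6 X = 0}"
  have "nilpotent_ideal br ?K"
  proof (rule nilpotent_ideal_two_step)
    show "subspace ?K" "subspace ?S" by (auto intro!: subspaceI simp: fadd fscale f0)
    show "br X Y \<in> ?K" for X Y using f6 by simp
    show "br X Y \<in> ?S" if "X \<in> ?K" "Y \<in> ?K" for X Y using that f6 two_step by auto
    show "br X Y = 0" if "Y \<in> ?S" for X Y
    proof (rule zeroI)
      fix i :: nat assume "i \<in> {1..6}"
      then have "i \<in> {1..5} \<or> i = 6" by auto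
      then show "f i (br X Y) = 0" using that central[of Y i X] f6 by auto
    qed
  qed
  then have KN: "?K \<subseteq> N" using N unfolding is_nilradical_def by blast
  have im0: "Im (\<alpha>1 X) = 0" if "f 6 X = 0" for X
    using KN adapted_N[OF A] that by blast
  define \<tau> where "\<tau> = Im (\<alpha>1 (e 6))"
  \<comment> \<open>\<open>Im \<alpha>1\<close> vanishes on the kernel of \<open>f 6\<close>, so the
    two functionals are proportional.\<close>
  have im: "Im (\<alpha>1 X) = f 6 X * \<tau>" for X
  proof -
    have "X = f 6 X *\<^sub>R e 6 + (X + (- f 6 X) *\<^sub>R e 6)" by (simp add: algebra_simps)
    then have "Im (\<alpha>1 X) = Im (\<alpha>1 (f 6 X *\<^sub>R e 6)) + Im (\<alpha>1 (X + (- f 6 X) *\<^sub>R e 6))"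
      by (metis adapted_linear(1)[OF A] plus_complex.simps(2))
    also have "Im (\<alpha>1 (X + (- f 6 X) *\<^sub>R e 6)) = 0"
      by (rule im0) (simp add: fadd fscale fe del: add_uminus_conv_diff scaleR_minus_left)
    finally show ?thesis by (simp add: adapted_linear[OF A] \<tau>_def)
  qed
  obtain W where "\<alpha>1 W = \<i>" using adapted_surj[OF A] by metis
  then have \<tau>: "\<tau> \<noteq> 0" using im[of W] by auto
  have f6_iff: "f 6 X = 0 \<longleftrightarrow> Im (\<alpha>1 X) = 0" for X using im[of X] \<tau> by simp
  define V where "V y2 y3 y4 y5 = y2 *\<^sub>R e 2 + y3 *\<^sub>R e 3 + y4 *\<^sub>R e 4 + y5 *\<^sub>R e 5" for y2 y3 y4 y5
  have fV: "f 1 (V y2 y3 y4 y5) = 0" "f 2 (V y2 y3 y4 y5) = y2" "f 3 (V y2 y3 y4 y5) = y3" "f 4 (V y2 y3 y4 y5) = y4"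
      "f 5 (V y2 y3 y4 y5) = y5" "f 6 (V y2 y3 y4 y5) = 0" for y2 y3 y4 y5
    by (simp_all add: V_def fadd fscale fe del: One_nat_def)
  have brV: "br (V y2 y3 y4 y5) (V z2 z3 z4 z5) = (- \<omega> y2 y3 y4 y5 z2 z3 z4 z5) *\<^sub>R e 1" for y2 y3 y4 y5 z2 z3 z4 z5
  proof -
    have 0: "f i (br (V y2 y3 y4 y5) (V z2 z3 z4 z5)) = 0" if "i \<in> {2..5}" for i
      by (rule two_step) (use that fV in auto)
    show ?thesis
      by (rule trans[OF ex]) (simp add: 0 f1 f6 fV del: One_nat_def)
  qed
  have brV0: "\<alpha>2 (br (V y2 y3 y4 y5) (V z2 z3 z4 z5)) = 0" "\<alpha>3 (br (V y2 y3 y4 y5) (V z2 z3 z4 z5)) = 0"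
     for y2 y3 y4 y5 z2 z3 z4 z5
    by (simp_all add: adapted_br[OF A] im fV)
  \<comment> \<open>A nonzero value of \<omega> exhibits a multiple of \<open>e 1\<close> as a
    bracket of elements of \<open>N\<close>, and both forms vanish on such brackets.\<close>
  have e1: "\<alpha>2 (e 1) = 0" "\<alpha>3 (e 1) = 0"
    using brV0[of x2 x3 x4 x5 y2 y3 y4 y5] \<omega> unfolding brV adapted_linear[OF A] by auto
  define \<rho> where "\<rho> = Re (\<alpha>1 (e 1))"
  have Im1: "Im (\<alpha>1 (e 1)) = 0" by (simp add: im fe)
  then have \<rho>1: "\<alpha>1 (e 1) = of_real \<rho>" by (simp add: \<rho>_def complex_eq_iff)
  have "e 1 \<noteq> 0" using fe[of 1 1] f0[of 1] by auto
  then have \<rho>: "\<rho> \<noteq> 0" using adapted_inj[OF A, of "e 1"] e1 \<rho>1 by auto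
  define u v where "u i = \<alpha>2 (e i)" and "v i = \<alpha>3 (e i)" for i
  have \<alpha>V: "\<alpha>2 (V y2 y3 y4 y5) = y2 * u 2 + y3 * u 3 + y4 * u 4 + y5 * u 5"
      "\<alpha>3 (V y2 y3 y4 y5) = y2 * v 2 + y3 * v 3 + y4 * v 4 + y5 * v 5" for y2 y3 y4 y5
    by (simp_all add: V_def adapted_linear[OF A] u_def v_def)
  have exV: "X = f 1 X *\<^sub>R e 1 + V (f 2 X) (f 3 X) (f 4 X) (f 5 X)" if "f 6 X = 0" for X
    by (rule trans[OF ex]) (simp add: V_def add.assoc that)
  have \<alpha>K: "\<alpha>2 X = f 2 X * u 2 + f 3 X * u 3 + f 4 X * u 4 + f 5 X * u 5"
      "\<alpha>3 X = f 2 X * v 2 + f 3 X * v 3 + f 4 X * v 4 + f 5 X * v 5" if "f 6 X = 0" for X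
    using arg_cong[OF exV[OF that], of \<alpha>2] arg_cong[OF exV[OF that], of \<alpha>3]
    unfolding adapted_linear[OF A] e1 \<alpha>V by simp_all
  have T: "\<alpha>2 (br (e 6) (e i)) = - 2 * \<i> * of_real \<tau> * (a * u i + b * v i)"
     "\<alpha>3 (br (e 6) (e i)) = - 2 * \<i> * of_real \<tau> * (d * v i)" if "i \<in> {2..5}" for i
    using that fe[of 6 i] im[of "e i"] im[of "e 6"] fe[of 6 6]
    by (simp_all add: adapted_br[OF A] u_def v_def)
  show ?thesis
    unfolding realises_def
  proof (rule exI[of _ "u 2"], rule exI[of _ "u 3"], rule exI[of _ "u 4"], rule exI[of _ "u 5"], rule exI[of _ "v 2"], rule exI[of _ "v 3"], rule exI[of _ "v 4"], rule exI[of _ "v 5"], rule exI[of _ "\<tau>"], rule exI[of _ "\<rho>"],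
      rule realisation.intro)
    fix x2 x3 x4 x5 :: real
    assume 0: "x2 * u 2 + x3 * u 3 + x4 * u 4 + x5 * u 5 = 0" "x2 * v 2 + x3 * v 3 + x4 * v 4 + x5 * v 5 = 0"
    define x where "x = Re (\<alpha>1 (V x2 x3 x4 x5))"
    have "Im (\<alpha>1 (V x2 x3 x4 x5)) = 0" by (simp add: im fV)
    then have x: "\<alpha>1 (V x2 x3 x4 x5) = of_real x" by (simp add: x_def complex_eq_iff)
    \<comment> \<open>The multiple of \<open>e 1\<close> that cancels the \<alpha>1-component, so
      that injectivity of the whole coframe applies.\<close>
    define r where "r = - x / \<rho>"
    have r: "of_real x + of_real r * complex_of_real \<rho> = 0" using \<rho> by (simp add: r_def)
    have "V x2 x3 x4 x5 + r *\<^sub>R e 1 = 0"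
      by (rule adapted_inj[OF A]) (use 0 \<rho> in \<open>simp_all add: adapted_linear[OF A] \<alpha>V e1 \<rho>1 x r del: One_nat_def\<close>)
    then have *: "f i (V x2 x3 x4 x5 + r *\<^sub>R e 1) = 0" if "i \<in> {1..6}" for i
      using f0[OF that] by simp
    show "x2 = 0 \<and> x3 = 0 \<and> x4 = 0 \<and> x5 = 0"
      using *[of 2] *[of 3] *[of 4] *[of 5] by (simp add: fadd fscale fe fV del: One_nat_def)
  next
    fix y z
    obtain X where X: "\<alpha>1 X = 0" "\<alpha>2 X = y" "\<alpha>3 X = z" using adapted_surj[OF A] by metis
    then have "f 6 X = 0" by (simp add: f6_iff)
    then show "\<exists>(x2::real) (x3::real) (x4::real) (x5::real). y = x2 * u 2 + x3 * u 3 + x4 * u 4 + x5 * u 5 \<and>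
        z = x2 * v 2 + x3 * v 3 + x4 * v 4 + x5 * v 5"
      using \<alpha>K[of X] X by blast
  next
    fix x2 x3 x4 x5 y2 y3 y4 y5
    have "\<alpha>1 (br (V x2 x3 x4 x5) (V y2 y3 y4 y5)) = - of_real (\<rho> * \<omega> x2 x3 x4 x5 y2 y3 y4 y5)"
      unfolding brV adapted_linear[OF A] \<rho>1 by simp
    then show "hform h k g (x2 * u 2 + x3 * u 3 + x4 * u 4 + x5 * u 5) (x2 * v 2 + x3 * v 3 + x4 * v 4 + x5 * v 5)
          (y2 * u 2 + y3 * u 3 + y4 * u 4 + y5 * u 5) (y2 * v 2 + y3 * v 3 + y4 * v 4 + y5 * v 5)
        = of_real (\<rho> * \<omega> x2 x3 x4 x5 y2 y3 y4 y5)"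
      by (simp add: adapted_br[OF A] \<alpha>V)
  next
    show "R (u 2) (u 3) (u 4) (u 5) =
      (- 2 * \<i> * of_real \<tau> * (a * u 2 + b * v 2), - 2 * \<i> * of_real \<tau> * (a * u 3 + b * v 3),
       - 2 * \<i> * of_real \<tau> * (a * u 4 + b * v 4), - 2 * \<i> * of_real \<tau> * (a * u 5 + b * v 5))"
      unfolding R \<alpha>K(1)[OF f6, symmetric] by (simp add: T)
    show "R (v 2) (v 3) (v 4) (v 5) =
      (- 2 * \<i> * of_real \<tau> * (d * v 2), - 2 * \<i> * of_real \<tau> * (d * v 3),
       - 2 * \<i> * of_real \<tau> * (d * v 4), - 2 * \<i> * of_real \<tau> * (d * v 5))"
      unfolding R \<alpha>K(2)[OF f6, symmetric] by (simp add: T)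
  qed (use \<tau> \<rho> in auto)
qed

text \<open>The 2-form \<open>f^23\<close> in the coordinates along \<open>e 2\<close> to
  \<open>e 5\<close>; its radical is spanned by \<open>e 4\<close> and \<open>e 5\<close>.\<close>

definition symplectic2 :: "real \<Rightarrow> real \<Rightarrow> real \<Rightarrow> real \<Rightarrow> real \<Rightarrow> real \<Rightarrow> real \<Rightarrow> real \<Rightarrow> real" where
  "symplectic2 x2 x3 x4 x5 y2 y3 y4 y5 = x2 * y3 - x3 * y2"

text \<open>The 2-form \<open>f^24 + f^35\<close>, which is nondegenerate on these
  coordinates.\<close>

definition symplectic4 :: "real \<Rightarrow> real \<Rightarrow> real \<Rightarrow> real \<Rightarrow> real \<Rightarrow> real \<Rightarrow> real \<Rightarrow> real \<Rightarrow> real" where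
  "symplectic4 x2 x3 x4 x5 y2 y3 y4 y5 = x2 * y4 - x4 * y2 + (x3 * y5 - x5 * y3)"

lemma atLeastAtMost_explicit: "{2..5::nat} = {2, 3, 4, 5}" "{1..5::nat} = {1, 2, 3, 4, 5}"
  by auto

section \<open>Operator and form of each listed algebra\<close>

lemma realises_h3_s33:
  assumes N: "is_nilradical br N" and F: "frame br J N a b 0 d h k g" and iso: "isomorphic_to br h3_s33"
  shows "realises (\<lambda>x2 x3 x4 x5. (0, 0, - x5, x4)) symplectic2 a b d h k g"
proof -
  from iso obtain e f where ef: "dual_bases e f"
    and eq: "[ce_d br (f 1), ce_d br (f 2), ce_d br (f 3), ce_d br (f 4), ce_d br (f 5), ce_d br (f 6)] = h3_s33 f"
    unfolding isomorphic_to_def by blast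
  have fe: "f i (e j) = (if i = j then 1 else 0)" if "i \<in> {1..6}" "j \<in> {1..6}" for i j
    using ef that unfolding dual_bases_def by blast
  have f: "f i (br X Y) = - ce_d br (f i) X Y" for i X Y by (simp add: ce_d_def)
  note E = eq[unfolded h3_s33_def list.inject]
  show ?thesis
    \<comment> \<open>The instantiation stands for \<open>e 2\<close> and \<open>e 3\<close>, on
      which the form is 1.\<close>
    by (rule realisesI[OF N F ef, where ?x2.0 = 1 and ?x3.0 = 0 and ?x4.0 = 0 and ?x5.0 = 0 and ?y2.0 = 0 and ?y3.0 = 1 and ?y4.0 = 0 and ?y5.0 = 0])
      (auto simp: f E form_simps fe symplectic2_def symplectic4_def atLeastAtMost_explicit simp del: One_nat_def)
qed

lemma realises_s47_R2:
  assumes N: "is_nilradical br N" and F: "frame br J N a b 0 d h k g" and iso: "isomorphic_to br s47_R2"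
  shows "realises (\<lambda>x2 x3 x4 x5. (- x3, x2, 0, 0)) symplectic2 a b d h k g"
proof -
  from iso obtain e f where ef: "dual_bases e f"
    and eq: "[ce_d br (f 1), ce_d br (f 2), ce_d br (f 3), ce_d br (f 4), ce_d br (f 5), ce_d br (f 6)] = s47_R2 f"
    unfolding isomorphic_to_def by blast
  have fe: "f i (e j) = (if i = j then 1 else 0)" if "i \<in> {1..6}" "j \<in> {1..6}" for i j
    using ef that unfolding dual_bases_def by blast
  have f: "f i (br X Y) = - ce_d br (f i) X Y" for i X Y by (simp add: ce_d_def)
  note E = eq[unfolded s47_R2_def list.inject]
  show ?thesis
    by (rule realisesI[OF N F ef, where ?x2.0 = 1 and ?x3.0 = 0 and ?x4.0 = 0 and ?x5.0 = 0 and ?y2.0 = 0 and ?y3.0 = 1 and ?y4.0 = 0 and ?y5.0 = 0])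
      (auto simp: f E form_simps fe symplectic2_def symplectic4_def atLeastAtMost_explicit simp del: One_nat_def)
qed

lemma realises_s6_44:
  assumes N: "is_nilradical br N" and F: "frame br J N a b 0 d h k g" and iso: "isomorphic_to br s6_44"
  shows "realises (\<lambda>x2 x3 x4 x5. (- x3 + x4, x2 + x5, - x5, x4)) symplectic2 a b d h k g"
proof -
  from iso obtain e f where ef: "dual_bases e f"
    and eq: "[ce_d br (f 1), ce_d br (f 2), ce_d br (f 3), ce_d br (f 4), ce_d br (f 5), ce_d br (f 6)] = s6_44 f"
    unfolding isomorphic_to_def by blast
  have fe: "f i (e j) = (if i = j then 1 else 0)" if "i \<in> {1..6}" "j \<in> {1..6}" for i j
    using ef that unfolding dual_bases_def by blast
  have f: "f i (br X Y) = - ce_d br (f i) X Y" for i X Y by (simp add: ce_d_def)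
  note E = eq[unfolded s6_44_def list.inject]
  show ?thesis
    by (rule realisesI[OF N F ef, where ?x2.0 = 1 and ?x3.0 = 0 and ?x4.0 = 0 and ?x5.0 = 0 and ?y2.0 = 0 and ?y3.0 = 1 and ?y4.0 = 0 and ?y5.0 = 0])
      (auto simp: f E form_simps fe symplectic2_def symplectic4_def atLeastAtMost_explicit simp del: One_nat_def)
qed

lemma realises_s6_52:
  assumes N: "is_nilradical br N" and F: "frame br J N a b 0 d h k g" and iso: "isomorphic_to br (s6_52 q)"
  shows "realises (\<lambda>x2 x3 x4 x5. (- x3, x2, - (q * x5), q * x4)) symplectic2 a b d h k g"
proof -
  from iso obtain e f where ef: "dual_bases e f"
    and eq: "[ce_d br (f 1), ce_d br (f 2), ce_d br (f 3), ce_d br (f 4), ce_d br (f 5), ce_d br (f 6)] = s6_52 q f"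
    unfolding isomorphic_to_def by blast
  have fe: "f i (e j) = (if i = j then 1 else 0)" if "i \<in> {1..6}" "j \<in> {1..6}" for i j
    using ef that unfolding dual_bases_def by blast
  have f: "f i (br X Y) = - ce_d br (f i) X Y" for i X Y by (simp add: ce_d_def)
  note E = eq[unfolded s6_52_def list.inject]
  show ?thesis
    by (rule realisesI[OF N F ef, where ?x2.0 = 1 and ?x3.0 = 0 and ?x4.0 = 0 and ?x5.0 = 0 and ?y2.0 = 0 and ?y3.0 = 1 and ?y4.0 = 0 and ?y5.0 = 0])
      (auto simp: f E form_simps fe symplectic2_def symplectic4_def atLeastAtMost_explicit simp del: One_nat_def)
qed

lemma realises_s6_159:
  assumes N: "is_nilradical br N" and F: "frame br J N a b 0 d h k g" and iso: "isomorphic_to br s6_159"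
  shows "realises (\<lambda>x2 x3 x4 x5. (0, x5, 0, - x3)) symplectic4 a b d h k g"
proof -
  from iso obtain e f where ef: "dual_bases e f"
    and eq: "[ce_d br (f 1), ce_d br (f 2), ce_d br (f 3), ce_d br (f 4), ce_d br (f 5), ce_d br (f 6)] = s6_159 f"
    unfolding isomorphic_to_def by blast
  have fe: "f i (e j) = (if i = j then 1 else 0)" if "i \<in> {1..6}" "j \<in> {1..6}" for i j
    using ef that unfolding dual_bases_def by blast
  have f: "f i (br X Y) = - ce_d br (f i) X Y" for i X Y by (simp add: ce_d_def)
  note E = eq[unfolded s6_159_def list.inject]
  show ?thesis
    \<comment> \<open>For the nondegenerate form the pair \<open>e 2\<close>, \<open>e 4\<close>
      serves instead.\<close>
    by (rule realisesI[OF N F ef, where ?x2.0 = 1 and ?x3.0 = 0 and ?x4.0 = 0 and ?x5.0 = 0 and ?y2.0 = 0 and ?y3.0 = 0 and ?y4.0 = 1 and ?y5.0 = 0])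
      (auto simp: f E form_simps fe symplectic2_def symplectic4_def atLeastAtMost_explicit simp del: One_nat_def)
qed

lemma realises_s6_162_1:
  assumes N: "is_nilradical br N" and F: "frame br J N a b 0 d h k g" and iso: "isomorphic_to br s6_162_1"
  shows "realises (\<lambda>x2 x3 x4 x5. (x2, x3, - x4, - x5)) symplectic4 a b d h k g"
proof -
  from iso obtain e f where ef: "dual_bases e f"
    and eq: "[ce_d br (f 1), ce_d br (f 2), ce_d br (f 3), ce_d br (f 4), ce_d br (f 5), ce_d br (f 6)] = s6_162_1 f"
    unfolding isomorphic_to_def by blast
  have fe: "f i (e j) = (if i = j then 1 else 0)" if "i \<in> {1..6}" "j \<in> {1..6}" for i j
    using ef that unfolding dual_bases_def by blast
  have f: "f i (br X Y) = - ce_d br (f i) X Y" for i X Y by (simp add: ce_d_def)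
  note E = eq[unfolded s6_162_1_def list.inject]
  show ?thesis
    by (rule realisesI[OF N F ef, where ?x2.0 = 1 and ?x3.0 = 0 and ?x4.0 = 0 and ?x5.0 = 0 and ?y2.0 = 0 and ?y3.0 = 0 and ?y4.0 = 1 and ?y5.0 = 0])
      (auto simp: f E form_simps fe symplectic2_def symplectic4_def atLeastAtMost_explicit simp del: One_nat_def)
qed

lemma realises_s6_165:
  assumes N: "is_nilradical br N" and F: "frame br J N a b 0 d h k g" and iso: "isomorphic_to br (s6_165 p)"
  shows "realises (\<lambda>x2 x3 x4 x5. (p * x2 - x3, x2 + p * x3, - (p * x4) - x5, x4 - p * x5)) symplectic4 a b d h k g"
proof -
  from iso obtain e f where ef: "dual_bases e f"
    and eq: "[ce_d br (f 1), ce_d br (f 2), ce_d br (f 3), ce_d br (f 4), ce_d br (f 5), ce_d br (f 6)] = s6_165 p f"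
    unfolding isomorphic_to_def by blast
  have fe: "f i (e j) = (if i = j then 1 else 0)" if "i \<in> {1..6}" "j \<in> {1..6}" for i j
    using ef that unfolding dual_bases_def by blast
  have f: "f i (br X Y) = - ce_d br (f i) X Y" for i X Y by (simp add: ce_d_def)
  note E = eq[unfolded s6_165_def list.inject]
  show ?thesis
    by (rule realisesI[OF N F ef, where ?x2.0 = 1 and ?x3.0 = 0 and ?x4.0 = 0 and ?x5.0 = 0 and ?y2.0 = 0 and ?y3.0 = 0 and ?y4.0 = 1 and ?y5.0 = 0])
      (auto simp: f E form_simps fe symplectic2_def symplectic4_def atLeastAtMost_explicit simp del: One_nat_def)
qed

lemma realises_s6_166:
  assumes N: "is_nilradical br N" and F: "frame br J N a b 0 d h k g" and iso: "isomorphic_to br (s6_166 p)"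
  shows "realises (\<lambda>x2 x3 x4 x5. (x4, p * x5, - x2, - (p * x3))) symplectic4 a b d h k g"
proof -
  from iso obtain e f where ef: "dual_bases e f"
    and eq: "[ce_d br (f 1), ce_d br (f 2), ce_d br (f 3), ce_d br (f 4), ce_d br (f 5), ce_d br (f 6)] = s6_166 p f"
    unfolding isomorphic_to_def by blast
  have fe: "f i (e j) = (if i = j then 1 else 0)" if "i \<in> {1..6}" "j \<in> {1..6}" for i j
    using ef that unfolding dual_bases_def by blast
  have f: "f i (br X Y) = - ce_d br (f i) X Y" for i X Y by (simp add: ce_d_def)
  note E = eq[unfolded s6_166_def list.inject]
  show ?thesis
    by (rule realisesI[OF N F ef, where ?x2.0 = 1 and ?x3.0 = 0 and ?x4.0 = 0 and ?x5.0 = 0 and ?y2.0 = 0 and ?y3.0 = 0 and ?y4.0 = 1 and ?y5.0 = 0])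
      (auto simp: f E form_simps fe symplectic2_def symplectic4_def atLeastAtMost_explicit simp del: One_nat_def)
qed

lemma realises_s6_167:
  assumes N: "is_nilradical br N" and F: "frame br J N a b 0 d h k g" and iso: "isomorphic_to br s6_167"
  shows "realises (\<lambda>x2 x3 x4 x5. (- x3 + x4, x2 + x5, - x5, x4)) symplectic4 a b d h k g"
proof -
  from iso obtain e f where ef: "dual_bases e f"
    and eq: "[ce_d br (f 1), ce_d br (f 2), ce_d br (f 3), ce_d br (f 4), ce_d br (f 5), ce_d br (f 6)] = s6_167 f"
    unfolding isomorphic_to_def by blast
  have fe: "f i (e j) = (if i = j then 1 else 0)" if "i \<in> {1..6}" "j \<in> {1..6}" for i j
    using ef that unfolding dual_bases_def by blast
  have f: "f i (br X Y) = - ce_d br (f i) X Y" for i X Y by (simp add: ce_d_def)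
  note E = eq[unfolded s6_167_def list.inject]
  show ?thesis
    by (rule realisesI[OF N F ef, where ?x2.0 = 1 and ?x3.0 = 0 and ?x4.0 = 0 and ?x5.0 = 0 and ?y2.0 = 0 and ?y3.0 = 0 and ?y4.0 = 1 and ?y5.0 = 0])
      (auto simp: f E form_simps fe symplectic2_def symplectic4_def atLeastAtMost_explicit simp del: One_nat_def)
qed

section \<open>Radical and rank of the Hermitian form\<close>

context realisation
begin

lemma nonzero: "u2 \<noteq> 0 \<or> v2 \<noteq> 0" "u3 \<noteq> 0 \<or> v3 \<noteq> 0" "u4 \<noteq> 0 \<or> v4 \<noteq> 0" "u5 \<noteq> 0 \<or> v5 \<noteq> 0"
    "u2 \<noteq> 0 \<or> u3 \<noteq> 0 \<or> u4 \<noteq> 0 \<or> u5 \<noteq> 0" "v2 \<noteq> 0 \<or> v3 \<noteq> 0 \<or> v4 \<noteq> 0 \<or> v5 \<noteq> 0"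
  using inj[of 1 0 0 0] inj[of 0 1 0 0] inj[of 0 0 1 0] inj[of 0 0 0 1] surj[of 1 1] by auto

lemma radical:
  assumes "\<omega> = symplectic2"
  shows "h * u4 + cnj g * v4 = 0" "g * u4 + k * v4 = 0" "h * u5 + cnj g * v5 = 0" "g * u5 + k * v5 = 0"
proof -
  have 4: "hform h k g u4 v4 y z = 0" and 5: "hform h k g u5 v5 y z = 0" for y z
  proof -
    obtain y2 y3 y4 y5 :: real where
      "y = y2 * u2 + y3 * u3 + y4 * u4 + y5 * u5" "z = y2 * v2 + y3 * v3 + y4 * v4 + y5 * v5"
      using surj by blast
    then show "hform h k g u4 v4 y z = 0" "hform h k g u5 v5 y z = 0"
      using form[of 0 0 1 0 y2 y3 y4 y5] form[of 0 0 0 1 y2 y3 y4 y5] by (simp_all add: assms symplectic2_def)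
  qed
  show "h * u4 + cnj g * v4 = 0" "g * u4 + k * v4 = 0" "h * u5 + cnj g * v5 = 0" "g * u5 + k * v5 = 0"
    using hform_eq_zero[OF 4] hform_eq_zero[OF 5] by simp_all
qed

text \<open>\<open>(u4, v4)\<close> is a nonzero kernel vector of the Hermitian matrix. Multiplying
  by the adjugate shows that the determinant annihilates it.\<close>

lemma degenerate:
  assumes "\<omega> = symplectic2"
  shows "h * k = (cmod g)\<^sup>2"
proof -
  note r = radical[OF assms]
  have "(of_real (h * k) - g * cnj g) * u4 = of_real k * (h * u4 + cnj g * v4) - cnj g * (g * u4 + k * v4)"
    "(of_real (h * k) - g * cnj g) * v4 = of_real h * (g * u4 + k * v4) - g * (h * u4 + cnj g * v4)"
    by (simp_all add: algebra_simps)
  then have "(of_real (h * k) - g * cnj g) * u4 = 0" "(of_real (h * k) - g * cnj g) * v4 = 0"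
    unfolding r by simp_all
  then have "of_real (h * k) - g * cnj g = 0" using nonzero(3) by auto
  then have "complex_of_real (h * k) = of_real ((cmod g)\<^sup>2)"
    by (simp only: complex_norm_square right_minus_eq)
  then show ?thesis unfolding of_real_eq_iff .
qed

text \<open>A kernel vector of a singular Hermitian matrix would come from a real vector in the
  radical of \<open>symplectic4\<close>, which is zero.\<close>

lemma nondegenerate:
  assumes "\<omega> = symplectic4"
  shows "h * k \<noteq> (cmod g)\<^sup>2"
proof
  assume eq: "h * k = (cmod g)\<^sup>2"
  have hk: "of_real h * of_real k = g * cnj g"
    using eq complex_norm_square[of g] by (metis of_real_mult)
  obtain p q :: complex where pq: "p \<noteq> 0 \<or> q \<noteq> 0" "h * p + cnj g * q = 0" "g * p + k * q = 0"
  proof (cases "g = 0 \<and> h = 0")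
    case True
    then show thesis using that[of 1 0] by simp
  next
    case False
    \<comment> \<open>Up to sign a column of the adjugate; it lies in the kernel because the
      determinant is 0.\<close>
    then show thesis using that[of "cnj g" "- of_real h"] hk by (auto simp: mult.commute)
  qed
  have zero: "hform h k g p q y z = 0" for y z
  proof -
    have "hform h k g p q y z = \<i> * ((h * p + cnj g * q) * cnj y - y * cnj (h * p + cnj g * q)
      + ((g * p + k * q) * cnj z - z * cnj (g * p + k * q)))"
      by (simp add: hform_def algebra_simps)
    then show ?thesis unfolding pq by simp
  qed
  obtain x2 x3 x4 x5 :: real where
    x: "p = x2 * u2 + x3 * u3 + x4 * u4 + x5 * u5" "q = x2 * v2 + x3 * v3 + x4 * v4 + x5 * v5"
    using surj by blast
  have *: "of_real (\<rho> * symplectic4 x2 x3 x4 x5 y2 y3 y4 y5) = (0::complex)" for y2 y3 y4 y5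
    using form[of x2 x3 x4 x5 y2 y3 y4 y5] unfolding x[symmetric] zero assms by simp
  have "symplectic4 x2 x3 x4 x5 y2 y3 y4 y5 = 0" for y2 y3 y4 y5
    using *[of y2 y3 y4 y5] rho unfolding of_real_eq_0_iff mult_eq_0_iff by blast
  from this[of 1 0 0 0] this[of 0 1 0 0] this[of 0 0 1 0] this[of 0 0 0 1]
  have "x2 = 0" "x3 = 0" "x4 = 0" "x5 = 0" by (simp_all add: symplectic4_def)
  then show False using pq x by simp
qed

end

lemma realises_symplectic2_degenerate:
  assumes "realises R symplectic2 a b d h k g" shows "h * k = (cmod g)\<^sup>2"
  using assms realisation.degenerate[OF _ refl] unfolding realises_def by blast

lemma realises_symplectic4_nondegenerate:
  assumes "realises R symplectic4 a b d h k g" shows "h * k \<noteq> (cmod g)\<^sup>2"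
  using assms realisation.nondegenerate[OF _ refl] unfolding realises_def by blast

section \<open>Spectral constraints imposed by each listed algebra\<close>

text \<open>\<open>e 4\<close> and \<open>e 5\<close> span the radical, while \<open>ad e6\<close>
  kills \<open>e 2\<close> and \<open>e 3\<close> modulo \<open>[N,N]\<close>. A form whose own
  Hermitian coefficient is nonzero vanishes on the radical, hence not on both \<open>e 2\<close> and
  \<open>e 3\<close>; if it is an eigenform, its eigenvalue is 0.\<close>

lemma constraint_h3_s33:
  assumes r: "realises (\<lambda>x2 x3 x4 x5. (0, 0, - x5, x4)) symplectic2 a b d h k 0"
  shows "b = 0 \<Longrightarrow> h \<noteq> 0 \<Longrightarrow> a = 0" and "k \<noteq> 0 \<Longrightarrow> d = 0"
proof -
  let ?R = "\<lambda>x2 x3 x4 x5. (0, 0, - x5, x4)"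
  obtain u2 u3 u4 u5 v2 v3 v4 v5 \<tau> \<rho> where
    "realisation ?R symplectic2 a b d h k 0 u2 u3 u4 u5 v2 v3 v4 v5 \<tau> \<rho>"
    using r unfolding realises_def by blast
  then interpret realisation ?R symplectic2 a b d h k 0 u2 u3 u4 u5 v2 v3 v4 v5 \<tau> \<rho> .
  have "0 = - 2 * \<i> * of_real \<tau> * (a * u2 + b * v2)" "0 = - 2 * \<i> * of_real \<tau> * (a * u3 + b * v3)"
    "0 = - 2 * \<i> * of_real \<tau> * (d * v2)" "0 = - 2 * \<i> * of_real \<tau> * (d * v3)"
    using R_u R_v unfolding prod.inject by blast+
  then have e: "a * u2 + b * v2 = 0" "a * u3 + b * v3 = 0" "d * v2 = 0" "d * v3 = 0" using tau by simp_all
  show "a = 0" if "b = 0" "h \<noteq> 0"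
    using that e(1,2) radical(1,3)[OF refl] nonzero(5) by auto
  show "d = 0" if "k \<noteq> 0"
    using that e(3,4) radical(2,4)[OF refl] nonzero(6) by auto
qed

text \<open>Here \<open>e 4\<close> lies both in the radical and in the kernel of
  \<open>ad e6\<close>. The form with nonzero Hermitian coefficient vanishes on \<open>e 4\<close>,
  so the other one does not and has eigenvalue 0.\<close>

lemma constraint_s47_R2:
  assumes r: "realises (\<lambda>x2 x3 x4 x5. (- x3, x2, 0, 0)) symplectic2 a b d h k 0"
  shows "h \<noteq> 0 \<Longrightarrow> d = 0" and "k \<noteq> 0 \<Longrightarrow> a = 0"
proof -
  let ?R = "\<lambda>x2 x3 x4 x5. (- x3, x2, 0, 0)"
  obtain u2 u3 u4 u5 v2 v3 v4 v5 \<tau> \<rho> where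
    "realisation ?R symplectic2 a b d h k 0 u2 u3 u4 u5 v2 v3 v4 v5 \<tau> \<rho>"
    using r unfolding realises_def by blast
  then interpret realisation ?R symplectic2 a b d h k 0 u2 u3 u4 u5 v2 v3 v4 v5 \<tau> \<rho> .
  have "0 = - 2 * \<i> * of_real \<tau> * (a * u4 + b * v4)" "0 = - 2 * \<i> * of_real \<tau> * (d * v4)"
    using R_u R_v unfolding prod.inject by blast+
  then have e: "a * u4 + b * v4 = 0" "d * v4 = 0" using tau by simp_all
  show "d = 0" if "h \<noteq> 0"
    using that e radical(1)[OF refl] nonzero(3) by auto
  show "a = 0" if "k \<noteq> 0"
    using that e radical(2)[OF refl] nonzero(3) by auto
qed

text \<open>The operator has eigenvalues \<open>\<i>\<close> and \<open>- \<i>\<close>, each with a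
  Jordan block of size two. A nonzero \<open>x4\<close> would give \<open>m * m = - 1\<close> and,
  on the other plane, \<open>(1 + m * m) * x2 = 2 * m * x4\<close>, hence
  \<open>m = 0\<close>.\<close>

lemma eigenvector_s6_44:
  fixes m :: complex
  assumes "- x3 + x4 = m * x2" "x2 + x5 = m * x3" "- x5 = m * x4" "x4 = m * x5"
  shows "x4 = 0"
proof (rule ccontr)
  assume x4: "x4 \<noteq> 0"
  have "m * x4 = - x5" using assms(3) by simp
  then have "m * (m * x4) = - x4" using assms(4) by simp
  then have "(1 + m * m) * x4 = 0" by (simp add: distrib_right mult.assoc)
  then have m: "1 + m * m = 0" using x4 by simp
  have "(1 + m * m) * x2 = 2 * m * x4"
  proof -
    have x3: "x3 = x4 - m * x2" using assms(1) by (simp add: algebra_simps)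
    have x5: "x5 = - (m * x4)" using assms(3) by (metis minus_minus)
    show ?thesis using assms(2) unfolding x3 x5 by (simp add: algebra_simps)
  qed
  then have "m = 0" using m x4 by simp
  then show False using m by simp
qed

text \<open>For \<open>b = 0\<close> both rows \<open>u\<close> and \<open>v\<close> are
  eigenvectors, so both vanish at \<open>e 4\<close>, against injectivity. The form \<omega> is left
  arbitrary so that \<open>s6_167\<close>, which has the same operator, is covered.\<close>

lemma constraint_s6_44:
  assumes r: "realises (\<lambda>x2 x3 x4 x5. (- x3 + x4, x2 + x5, - x5, x4)) \<omega> a 0 d h k g"
  shows False
proof -
  obtain u2 u3 u4 u5 v2 v3 v4 v5 \<tau> \<rho> where
    "realisation (\<lambda>x2 x3 x4 x5. (- x3 + x4, x2 + x5, - x5, x4)) \<omega> a 0 d h k g u2 u3 u4 u5 v2 v3 v4 v5 \<tau> \<rho>"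
    using r unfolding realises_def by blast
  then interpret realisation "\<lambda>x2 x3 x4 x5. (- x3 + x4, x2 + x5, - x5, x4)" \<omega> a 0 d h k g u2 u3 u4 u5 v2 v3 v4 v5 \<tau> \<rho> .
  have "- u3 + u4 = - 2 * \<i> * of_real \<tau> * a * u2" "u2 + u5 = - 2 * \<i> * of_real \<tau> * a * u3"
    "- u5 = - 2 * \<i> * of_real \<tau> * a * u4" "u4 = - 2 * \<i> * of_real \<tau> * a * u5"
    using R_u unfolding prod.inject mult.assoc mult_zero_left add_0_right by blast+
  then have "u4 = 0" by (rule eigenvector_s6_44)
  have "- v3 + v4 = - 2 * \<i> * of_real \<tau> * d * v2" "v2 + v5 = - 2 * \<i> * of_real \<tau> * d * v3"
    "- v5 = - 2 * \<i> * of_real \<tau> * d * v4" "v4 = - 2 * \<i> * of_real \<tau> * d * v5"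
    using R_v unfolding prod.inject mult.assoc by blast+
  then have "v4 = 0" by (rule eigenvector_s6_44)
  with \<open>u4 = 0\<close> show False using nonzero(3) by simp
qed

text \<open>A plane rotation of speed \<open>q\<close> has eigenvalues \<open>\<i> * q\<close> and
  \<open>- \<i> * q\<close>; squaring avoids choosing between them.\<close>

lemma eigenvector_rotation:
  fixes m q :: complex
  assumes "- (q * y) = m * x" "q * x = m * y" "x \<noteq> 0 \<or> y \<noteq> 0"
  shows "m * m = - (q * q)"
proof -
  have "m * m * x = - (q * q) * x" "m * m * y = - (q * q) * y"
    using assms(1,2) by (metis minus_mult_left minus_mult_right mult.assoc mult.left_commute)+
  then show ?thesis using assms(3) by (metis mult_right_cancel)
qed

text \<open>In the first case \<open>u\<close> lives on the plane rotated with speed 1 and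
  \<open>v\<close> is nonzero on the plane of speed \<open>q\<close>; comparing squared eigenvalues
  eliminates \<tau>. In the second case \<open>u\<close> would be a generalised eigenvector over
  \<open>v\<close> on the first plane, where the rotation is semisimple.\<close>

lemma constraint_s6_52:
  fixes q :: real
  assumes r: "realises (\<lambda>x2 x3 x4 x5. (- x3, x2, - (of_real q * x5), of_real q * x4)) symplectic2 a b d h k 0"
  shows "b = 0 \<Longrightarrow> h \<noteq> 0 \<Longrightarrow> a \<noteq> 0 \<and> d * d = of_real (q * q) * (a * a)"
    and "k \<noteq> 0 \<Longrightarrow> h = 0 \<Longrightarrow> a = d \<Longrightarrow> b = 0"
proof -
  let ?R = "\<lambda>x2 x3 x4 x5. (- x3, x2, - (of_real q * x5), of_real q * x4)"
  obtain u2 u3 u4 u5 v2 v3 v4 v5 \<tau> \<rho> where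
    "realisation ?R symplectic2 a b d h k 0 u2 u3 u4 u5 v2 v3 v4 v5 \<tau> \<rho>"
    using r unfolding realises_def by blast
  then interpret realisation ?R symplectic2 a b d h k 0 u2 u3 u4 u5 v2 v3 v4 v5 \<tau> \<rho> .
  define \<mu> where "\<mu> = - 2 * \<i> * complex_of_real \<tau>"
  have \<mu>: "\<mu> \<noteq> 0" using tau by (simp add: \<mu>_def)
  have Ru: "- u3 = \<mu> * (a * u2 + b * v2)" "u2 = \<mu> * (a * u3 + b * v3)"
    using R_u[folded \<mu>_def] unfolding prod.inject by blast+
  have Rv: "- v3 = \<mu> * (d * v2)" "v2 = \<mu> * (d * v3)" "- (of_real q * v5) = \<mu> * (d * v4)" "of_real q * v4 = \<mu> * (d * v5)"
    using R_v[folded \<mu>_def] unfolding prod.inject by blast+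
  {
    assume b: "b = 0" and h: "h \<noteq> 0"
    have u: "u4 = 0" "u5 = 0" using radical[OF refl] h by auto
    have 1: "(\<mu> * a) * (\<mu> * a) = - (1 * 1)"
      by (rule eigenvector_rotation[of 1 u3 _ u2])
        (use Ru b in \<open>simp_all only: mult.assoc mult_1_left mult_zero_left add_0_right\<close>, use u nonzero(5) in blast)
    have 2: "(\<mu> * d) * (\<mu> * d) = - (of_real q * of_real q)"
      by (rule eigenvector_rotation[of "of_real q" v5 _ v4])
        (use Rv in \<open>simp_all only: mult.assoc\<close>, use u nonzero(3) in blast)
    have "(\<mu> * \<mu>) * (d * d) = (\<mu> * \<mu>) * (of_real (q * q) * (a * a))"
    proof -
      have "(\<mu> * \<mu>) * (d * d) = - (of_real q * of_real q)" "(\<mu> * \<mu>) * (a * a) = - 1"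
        using 1 2 by (simp_all add: mult_ac)
      moreover have "(\<mu> * \<mu>) * (of_real (q * q) * (a * a)) = of_real (q * q) * ((\<mu> * \<mu>) * (a * a))" by (simp only: mult_ac)
      ultimately show ?thesis by simp
    qed
    then have "d * d = of_real (q * q) * (a * a)" using \<mu> by simp
    moreover have "a \<noteq> 0" using 1 by auto
    ultimately show "a \<noteq> 0 \<and> d * d = of_real (q * q) * (a * a)" by blast
  next
    assume k: "k \<noteq> 0" and h: "h = 0" and ad: "a = d"
    show "b = 0"
    proof (rule ccontr)
      assume b: "b \<noteq> 0"
      have v: "v4 = 0" "v5 = 0" using radical[OF refl] k by auto
      define m n where "m = \<mu> * a" and "n = \<mu> * b"
      have e: "- v3 = m * v2" "v2 = m * v3" "- u3 = m * u2 + n * v2" "u2 = m * u3 + n * v3"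
        unfolding m_def n_def using Ru Rv(1,2) unfolding ad by (simp_all only: mult.assoc distrib_left)
      have m: "m * m = - (1 * 1)"
        by (rule eigenvector_rotation[of 1 v3 _ v2]) (use e(1,2) in \<open>simp_all only: mult_1_left\<close>, use v nonzero(6) in blast)
      have "u2 = - (m * m) * u2 - m * n * v2 + n * v3"
      proof -
        have u3: "u3 = - (m * u2 + n * v2)" using e(3) by (metis minus_minus)
        show ?thesis using e(4) unfolding u3 by (simp add: algebra_simps)
      qed
      then have "n * (v3 - m * v2) = 0" using m by (simp add: algebra_simps) metis
      then have "v3 = m * v2" using b \<mu> by (simp add: n_def)
      then have "v3 = 0" using e(1) by (metis add.inverse_neutral neg_eq_iff_add_eq_0 mult_2 mult_eq_0_iff zero_neq_numeral)
      then have "v2 = 0" using e(2) by simp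
      then show False using \<open>v3 = 0\<close> v nonzero by blast
    qed
  }
qed


text \<open>Modulo \<open>[N,N]\<close>, \<open>e 2\<close> is in the kernel of
  \<open>ad e6\<close>. So \<open>(u2, v2)\<close> is a nonzero kernel vector of a triangular
  matrix, which must have a zero on its diagonal.\<close>

lemma constraint_s6_159:
  assumes r: "realises (\<lambda>x2 x3 x4 x5. (0, x5, 0, - x3)) \<omega> a b d h k g"
  shows "a = 0 \<or> d = 0"
proof -
  let ?R = "\<lambda>x2 x3 x4 x5. (0, x5, 0, - x3)"
  obtain u2 u3 u4 u5 v2 v3 v4 v5 \<tau> \<rho> where
    "realisation ?R \<omega> a b d h k g u2 u3 u4 u5 v2 v3 v4 v5 \<tau> \<rho>"
    using r unfolding realises_def by blast
  then interpret realisation ?R \<omega> a b d h k g u2 u3 u4 u5 v2 v3 v4 v5 \<tau> \<rho> .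
  have "0 = - 2 * \<i> * of_real \<tau> * (a * u2 + b * v2)" "0 = - 2 * \<i> * of_real \<tau> * (d * v2)"
    using R_u R_v unfolding prod.inject by blast+
  then have "a * u2 + b * v2 = 0" "d * v2 = 0" using tau by simp_all
  then show ?thesis using nonzero(1) by auto
qed

text \<open>On \<open>e 2\<close> the eigenvalue is 1. An entry \<open>c\<close> with
  \<open>- 2 * \<i> * \<tau> * c = 1\<close> is purely imaginary and nonzero, and at least one of
  \<open>a\<close>, \<open>d\<close> is such an entry.\<close>

lemma constraint_s6_162_1:
  assumes r: "realises (\<lambda>x2 x3 x4 x5. (x2, x3, - x4, - x5)) \<omega> a b d h k g"
  shows "\<not> (Im a = 0 \<and> Im d = 0)" and "b = 0 \<Longrightarrow> d = cnj a \<Longrightarrow> Re a = 0"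
proof -
  let ?R = "\<lambda>x2 x3 x4 x5. (x2, x3, - x4, - x5)"
  obtain u2 u3 u4 u5 v2 v3 v4 v5 \<tau> \<rho> where
    "realisation ?R \<omega> a b d h k g u2 u3 u4 u5 v2 v3 v4 v5 \<tau> \<rho>"
    using r unfolding realises_def by blast
  then interpret realisation ?R \<omega> a b d h k g u2 u3 u4 u5 v2 v3 v4 v5 \<tau> \<rho> .
  have e: "u2 = - 2 * \<i> * of_real \<tau> * (a * u2 + b * v2)" "v2 = - 2 * \<i> * of_real \<tau> * (d * v2)"
    using R_u R_v unfolding prod.inject by blast+
  have one: "- 2 * \<i> * of_real \<tau> * c = 1" if "x = - 2 * \<i> * of_real \<tau> * (c * x)" "x \<noteq> 0" for c x
  proof -
    have "(- 2 * \<i> * of_real \<tau> * c) * x = 1 * x" using that(1) by (simp only: mult.assoc mult_1_left)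
    then show ?thesis using that(2) mult_right_cancel by blast
  qed
  have *: "Im c \<noteq> 0 \<and> Re c = 0" if "- 2 * \<i> * of_real \<tau> * c = 1" for c
    using that tau by (auto simp: complex_eq_iff)
  have u: "Im a \<noteq> 0 \<and> Re a = 0" if "b * v2 = 0" "u2 \<noteq> 0"
    using *[OF one[of u2 a]] e(1) that by simp
  have v: "Im d \<noteq> 0 \<and> Re d = 0" if "v2 \<noteq> 0"
    using *[OF one[of v2 d]] e(2) that by blast
  show "\<not> (Im a = 0 \<and> Im d = 0)" using u v nonzero(1) by auto
  show "Re a = 0" if "b = 0" "d = cnj a" using u v nonzero(1) that by auto
qed

lemma constraint_s6_165:
  fixes p :: real
  assumes r: "realises (\<lambda>x2 x3 x4 x5. (of_real p * x2 - x3, x2 + of_real p * x3, - (of_real p * x4) - x5, x4 - of_real p * x5)) \<omega> a b d h k g"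
    and p: "p > 0"
  shows "\<not> (Im a = 0 \<and> Im d = 0)"
    and "b = 0 \<Longrightarrow> d = cnj a \<Longrightarrow> Re a \<noteq> 0 \<and> \<bar>Im a\<bar> = p * \<bar>Re a\<bar>"
proof -
  let ?R = "\<lambda>x2 x3 x4 x5. (of_real p * x2 - x3, x2 + of_real p * x3, - (of_real p * x4) - x5, x4 - of_real p * x5)"
  obtain u2 u3 u4 u5 v2 v3 v4 v5 \<tau> \<rho> where
    "realisation ?R \<omega> a b d h k g u2 u3 u4 u5 v2 v3 v4 v5 \<tau> \<rho>"
    using r unfolding realises_def by blast
  then interpret realisation ?R \<omega> a b d h k g u2 u3 u4 u5 v2 v3 v4 v5 \<tau> \<rho> .
  have e: "of_real p * u2 - u3 = - 2 * \<i> * of_real \<tau> * (a * u2 + b * v2)" "u2 + of_real p * u3 = - 2 * \<i> * of_real \<tau> * (a * u3 + b * v3)"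
    "of_real p * v2 - v3 = - 2 * \<i> * of_real \<tau> * (d * v2)" "v2 + of_real p * v3 = - 2 * \<i> * of_real \<tau> * (d * v3)"
    using R_u R_v unfolding prod.inject by blast+
  have *: "Re c \<noteq> 0 \<and> 2 * \<tau> * Im c = p \<and> \<bar>2 * \<tau> * Re c\<bar> = 1"
    if "of_real p * x - y = - 2 * \<i> * of_real \<tau> * (c * x)" "x + of_real p * y = - 2 * \<i> * of_real \<tau> * (c * y)" "x \<noteq> 0 \<or> y \<noteq> 0"
    for x y c
  proof -
    \<comment> \<open>On \<open>e 2\<close>, \<open>e 3\<close> the operator is \<open>p\<close>
      plus a rotation of speed 1; subtracting \<open>p\<close> leaves the rotation.\<close>
    define m where "m = - 2 * \<i> * of_real \<tau> * c - of_real p"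
    have "- (1 * y) = m * x" "1 * x = m * y"
      using that(1,2) by (simp_all add: m_def algebra_simps)
    then have m: "m * m = - (1 * 1)" using that(3) by (rule eigenvector_rotation)
    have "Re m = 0 \<and> \<bar>Im m\<bar> = 1"
    proof -
      have 1: "Re m * Re m - Im m * Im m = - 1" and 2: "Re m * Im m = 0"
        using m by (auto simp: complex_eq_iff)
      have "Im m \<noteq> 0" using 1 by (auto simp: zero_le_square) (metis not_one_le_zero neg_0_le_iff_le zero_le_square)
      then have "Re m = 0" using 2 by simp
      then have "(Im m)\<^sup>2 = 1" using 1 by (simp add: power2_eq_square)
      then show ?thesis using \<open>Re m = 0\<close> by (simp add: power2_eq_1_iff) linarith
    qed
    then have "2 * \<tau> * Im c = p" "\<bar>2 * \<tau> * Re c\<bar> = 1" by (simp_all add: m_def)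
    then show ?thesis by auto
  qed
  have u: "Re a \<noteq> 0 \<and> 2 * \<tau> * Im a = p \<and> \<bar>2 * \<tau> * Re a\<bar> = 1" if "b * v2 = 0" "b * v3 = 0" "u2 \<noteq> 0"
    using *[of u2 u3 a] e(1,2) that by simp
  have v: "Re d \<noteq> 0 \<and> 2 * \<tau> * Im d = p \<and> \<bar>2 * \<tau> * Re d\<bar> = 1" if "v2 \<noteq> 0 \<or> v3 \<noteq> 0"
    using *[of v2 v3 d] e(3,4) that by blast
  show "\<not> (Im a = 0 \<and> Im d = 0)" using u v nonzero(1) p by (metis mult_eq_0_iff less_irrefl)
  show "Re a \<noteq> 0 \<and> \<bar>Im a\<bar> = p * \<bar>Re a\<bar>" if "b = 0" "d = cnj a"
  proof -
    have "\<bar>2 * \<tau> * Im a\<bar> = p * \<bar>2 * \<tau> * Re a\<bar> \<and> Re a \<noteq> 0"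
      using u v nonzero(1) that p by auto
    then show ?thesis using tau by (auto simp: abs_mult)
  qed
qed

text \<open>The plane of \<open>e 2\<close> and \<open>e 4\<close> is rotated with speed 1, so the
  eigenvalue of whichever of \<open>u\<close>, \<open>v\<close> is nonzero at \<open>e 2\<close> is
  imaginary, and the corresponding entry is real.\<close>

lemma constraint_s6_166_not_conjugate:
  fixes p :: real
  assumes r: "realises (\<lambda>x2 x3 x4 x5. (x4, of_real p * x5, - x2, - (of_real p * x3))) \<omega> a 0 (cnj a) h k g"
  shows "Im a = 0"
proof -
  let ?R = "\<lambda>x2 x3 x4 x5. (x4, of_real p * x5, - x2, - (of_real p * x3))"
  obtain u2 u3 u4 u5 v2 v3 v4 v5 \<tau> \<rho> where
    "realisation ?R \<omega> a 0 (cnj a) h k g u2 u3 u4 u5 v2 v3 v4 v5 \<tau> \<rho>"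
    using r unfolding realises_def by blast
  then interpret realisation ?R \<omega> a 0 "cnj a" h k g u2 u3 u4 u5 v2 v3 v4 v5 \<tau> \<rho> .
  have e: "u4 = - 2 * \<i> * of_real \<tau> * (a * u2)" "- u2 = - 2 * \<i> * of_real \<tau> * (a * u4)"
    "v4 = - 2 * \<i> * of_real \<tau> * (cnj a * v2)" "- v2 = - 2 * \<i> * of_real \<tau> * (cnj a * v4)"
    using R_u R_v unfolding prod.inject mult_zero_left add_0_right by blast+
  have *: "Im c = 0" if "y = - 2 * \<i> * of_real \<tau> * (c * x)" "- x = - 2 * \<i> * of_real \<tau> * (c * y)" "x \<noteq> 0" for c x y
  proof -
    define m where "m = - 2 * \<i> * of_real \<tau> * c"
    have "- (1 * x) = m * y" "1 * y = m * x"
      using that(1,2) by (simp_all only: m_def mult.assoc mult_1_left)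
    then have m: "m * m = - (1 * 1)" using that(3) by (intro eigenvector_rotation[of 1 x m y]) auto
    have 1: "Re m * Re m - Im m * Im m = - 1" and 2: "Re m * Im m = 0"
      using m by (auto simp: complex_eq_iff)
    have "Im m \<noteq> 0" using 1 by (auto simp: zero_le_square) (metis not_one_le_zero neg_0_le_iff_le zero_le_square)
    then have "Re m = 0" using 2 by simp
    then show ?thesis using tau by (simp add: m_def)
  qed
  show ?thesis using *[OF e(1,2)] *[OF e(3,4)] nonzero(1) by auto
qed

text \<open>Semisimplicity of a rotation: applying it twice to the generalised eigenvector gives
  \<open>- p * p * u = m * m * u + 2 * m * n * v\<close>, and \<open>m * m = - p * p\<close> leaves
  only the last term.\<close>

lemma eigenform_rotation_jordan:
  fixes m n p :: complex
  assumes "p * u' = m * u + n * v" "- (p * u) = m * u' + n * v'" "p * v' = m * v" "- (p * v) = m * v'"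
    and "p \<noteq> 0" "n \<noteq> 0" "m \<noteq> 0"
  shows "v = 0"
proof (rule ccontr)
  assume v: "v \<noteq> 0"
  have "- (p * v) = m * v'" "p * v' = m * v" by fact+
  then have m: "m * m = - (p * p)" using v by (intro eigenvector_rotation[of p v m v']) auto
  have "- (p * p * u) = m * (p * u') + n * (p * v')"
    using arg_cong[OF assms(2), of "\<lambda>x. p * x"] by (simp add: algebra_simps)
  also have "\<dots> = m * m * u + 2 * (m * n * v)"
    unfolding assms(1,3) by (simp add: algebra_simps)
  finally have "2 * (m * n * v) = 0" using m by simp
  then show False using v assms by simp
qed

lemma constraint_s6_166_not_jordan:
  fixes p :: real
  assumes r: "realises (\<lambda>x2 x3 x4 x5. (x4, of_real p * x5, - x2, - (of_real p * x3))) \<omega> a b a h k g"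
    and p: "p \<noteq> 0" and a: "a \<noteq> 0"
  shows "b = 0"
proof (rule ccontr)
  assume b: "b \<noteq> 0"
  let ?R = "\<lambda>x2 x3 x4 x5. (x4, of_real p * x5, - x2, - (of_real p * x3))"
  obtain u2 u3 u4 u5 v2 v3 v4 v5 \<tau> \<rho> where
    "realisation ?R \<omega> a b a h k g u2 u3 u4 u5 v2 v3 v4 v5 \<tau> \<rho>"
    using r unfolding realises_def by blast
  then interpret realisation ?R \<omega> a b a h k g u2 u3 u4 u5 v2 v3 v4 v5 \<tau> \<rho> .
  define m n where "m = - 2 * \<i> * of_real \<tau> * a" and "n = - 2 * \<i> * of_real \<tau> * b"
  have mn: "m \<noteq> 0" "n \<noteq> 0" using a b tau by (simp_all add: m_def n_def)
  have e: "u4 = m * u2 + n * v2" "of_real p * u5 = m * u3 + n * v3" "- u2 = m * u4 + n * v4" "- (of_real p * u3) = m * u5 + n * v5"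
    "v4 = m * v2" "of_real p * v5 = m * v3" "- v2 = m * v4" "- (of_real p * v3) = m * v5"
    using R_u R_v unfolding prod.inject m_def n_def distrib_left mult.assoc by blast+
  have "v2 = 0"
    by (rule eigenform_rotation_jordan[of 1 u4 m u2 n v2 v4]) (unfold mult_1_left, (rule e mn one_neq_zero)+)
  moreover have "v3 = 0"
    by (rule eigenform_rotation_jordan[of "of_real p" u5 m u3 n v3 v5]) ((rule e mn)+, use p mn in auto)
  ultimately have "v2 = 0" "v3 = 0" "v4 = 0" "v5 = 0" using e(5,6) p by auto
  then show False using nonzero(6) by blast
qed

lemma constraint_s6_166_diagonal:
  fixes p a d :: real
  assumes r: "realises (\<lambda>x2 x3 x4 x5. (x4, of_real p * x5, - x2, - (of_real p * x3))) symplectic4 (of_real a) 0 (of_real d) h k 0"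
    and p: "p \<noteq> 0" "\<bar>p\<bar> \<le> 1" and ad: "\<bar>d\<bar> \<le> \<bar>a\<bar>"
  shows "\<bar>d\<bar> = \<bar>p\<bar> * \<bar>a\<bar>" and "p * (a * h) * (d * k) > 0"
proof -
  let ?R = "\<lambda>x2 x3 x4 x5. (x4, of_real p * x5, - x2, - (of_real p * x3))"
  obtain u2 u3 u4 u5 v2 v3 v4 v5 \<tau> \<rho> where
    "realisation ?R symplectic4 (of_real a) 0 (of_real d) h k 0 u2 u3 u4 u5 v2 v3 v4 v5 \<tau> \<rho>"
    using r unfolding realises_def by blast
  then interpret realisation ?R symplectic4 "of_real a" 0 "of_real d" h k 0 u2 u3 u4 u5 v2 v3 v4 v5 \<tau> \<rho> .
  define m n where "m = - 2 * \<i> * of_real \<tau> * complex_of_real a" and "n = - 2 * \<i> * of_real \<tau> * complex_of_real d"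
  have e: "u4 = m * u2" "of_real p * u5 = m * u3" "- u2 = m * u4" "- (of_real p * u3) = m * u5"
    "v4 = n * v2" "of_real p * v5 = n * v3" "- v2 = n * v4" "- (of_real p * v3) = n * v5"
    using R_u R_v unfolding prod.inject m_def n_def mult.assoc mult_zero_left add_0_right by blast+
  \<comment> \<open>Squared frequencies of the two eigenforms. Each plane and each eigenform has to
    be matched, so they are 1 and \<open>p^2\<close>; the orders \<open>D \<le> A\<close> and
    \<open>p^2 \<le> 1\<close> decide which is which.\<close>
  define A D where "A = (2 * \<tau> * a)\<^sup>2" and "D = (2 * \<tau> * d)\<^sup>2"
  have mA: "m * m = - of_real A" and nD: "n * n = - of_real D"
    by (simp_all add: m_def n_def A_def D_def power2_eq_square algebra_simps)
  have rot1: "c * c = - 1" if "y = c * x" "- x = c * y" "x \<noteq> 0 \<or> y \<noteq> 0" for c x y :: complex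
    using eigenvector_rotation[of 1 x c y] that by auto
  have rotp: "c * c = - of_real (p\<^sup>2)" if "of_real p * y = c * x" "- (of_real p * x) = c * y" "x \<noteq> 0 \<or> y \<noteq> 0" for c x y :: complex
    using eigenvector_rotation[of "of_real p" x c y] that by (auto simp: power2_eq_square)
  have u: "A = 1" if "u2 \<noteq> 0 \<or> u4 \<noteq> 0"
    using rot1[OF e(1,3)] that mA by (metis neg_equal_iff_equal of_real_eq_1_iff)
  have u': "A = p\<^sup>2" if "u3 \<noteq> 0 \<or> u5 \<noteq> 0"
    using rotp[OF e(2,4)] that mA by (metis neg_equal_iff_equal of_real_eq_iff)
  have v: "D = 1" if "v2 \<noteq> 0 \<or> v4 \<noteq> 0"
    using rot1[OF e(5,7)] that nD by (metis neg_equal_iff_equal of_real_eq_1_iff)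
  have v': "D = p\<^sup>2" if "v3 \<noteq> 0 \<or> v5 \<noteq> 0"
    using rotp[OF e(6,8)] that nD by (metis neg_equal_iff_equal of_real_eq_iff)
  have DA: "D \<le> A"
    using ad by (simp add: A_def D_def power_mult_distrib abs_le_square_iff mult_left_mono)
  have p1: "p\<^sup>2 \<le> 1" using p(2) by (simp add: abs_square_le_1)
  have "A = 1 \<or> A = p\<^sup>2" "D = 1 \<or> D = p\<^sup>2" using u u' v v' nonzero(5,6) by blast+
  moreover have "A = 1 \<or> D = 1" "A = p\<^sup>2 \<or> D = p\<^sup>2" using u u' v v' nonzero(1,2) by blast+
  ultimately have AD: "A = 1" "D = p\<^sup>2" using DA p1 by auto
  have "(2 * \<tau>)\<^sup>2 * d\<^sup>2 = (2 * \<tau>)\<^sup>2 * (p * a)\<^sup>2"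
    using AD by (simp add: A_def D_def power_mult_distrib)
  then have "d\<^sup>2 = (p * a)\<^sup>2" using tau by simp
  then show "\<bar>d\<bar> = \<bar>p\<bar> * \<bar>a\<bar>" by (metis abs_mult power2_eq_iff abs_minus_cancel)
  have ad0: "a \<noteq> 0" "d \<noteq> 0" using AD p by (auto simp: A_def D_def)
  have hk0: "h \<noteq> 0" "k \<noteq> 0" using nondegenerate[OF refl] by auto
  \<comment> \<open>The quadratic form \<open>X \<mapsto> \<omega>(X, ad W X)\<close> is definite iff \<open>p > 0\<close>; this recovers the sign of \<open>p\<close>.\<close>
  define c where "c = - 4 * \<tau> / \<rho>"
  have Q: "c * (a * h * (cmod U)\<^sup>2 + d * k * (cmod V)\<^sup>2) = x2 * x2 + x4 * x4 + p * (x3 * x3 + x5 * x5)"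
    if U: "U = x2 * u2 + x3 * u3 + x4 * u4 + x5 * u5" and V: "V = x2 * v2 + x3 * v3 + x4 * v4 + x5 * v5"
    for U V and x2 x3 x4 x5 :: real
  proof -
    \<comment> \<open>The coordinates on the right are those of \<open>ad e6\<close> applied to the
      vector with coordinates \<open>x2\<close> to \<open>x5\<close>.\<close>
    have mU: "m * U = of_real (- x4) * u2 + of_real (- p * x5) * u3 + of_real x2 * u4 + of_real (p * x3) * u5"
    proof -
      have "m * U = x2 * (m * u2) + x3 * (m * u3) + x4 * (m * u4) + x5 * (m * u5)"
        unfolding U by (simp add: algebra_simps)
      then show ?thesis unfolding e(1-4)[symmetric] by (simp add: algebra_simps)
    qed
    have nV: "n * V = of_real (- x4) * v2 + of_real (- p * x5) * v3 + of_real x2 * v4 + of_real (p * x3) * v5"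
    proof -
      have "n * V = x2 * (n * v2) + x3 * (n * v3) + x4 * (n * v4) + x5 * (n * v5)"
        unfolding V by (simp add: algebra_simps)
      then show ?thesis unfolding e(5-8)[symmetric] by (simp add: algebra_simps)
    qed
    have "hform h k 0 U V (m * U) (n * V) = of_real (\<rho> * symplectic4 x2 x3 x4 x5 (- x4) (- p * x5) x2 (p * x3))"
      unfolding mU nV unfolding U V by (rule form)
    \<comment> \<open>The factor comes from \<open>cnj m - m = 4 * \<i> * \<tau> * a\<close> and its
      analogue for \<open>n\<close>.\<close>
    moreover have "hform h k 0 U V (m * U) (n * V) = of_real (- 4 * \<tau> * (a * h * (cmod U)\<^sup>2 + d * k * (cmod V)\<^sup>2))"
      unfolding of_real_add of_real_mult complex_norm_square
      by (simp add: hform_def m_def n_def algebra_simps)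
    ultimately have "- 4 * \<tau> * (a * h * (cmod U)\<^sup>2 + d * k * (cmod V)\<^sup>2) = \<rho> * symplectic4 x2 x3 x4 x5 (- x4) (- p * x5) x2 (p * x3)"
      by (metis of_real_eq_iff)
    then show ?thesis using rho by (simp add: c_def field_simps symplectic4_def)
  qed
  show "p * (a * h) * (d * k) > 0"
  proof (cases "p > 0")
    case True
    have pos: "c * (a * h * (cmod U)\<^sup>2 + d * k * (cmod V)\<^sup>2) > 0" if "U \<noteq> 0 \<or> V \<noteq> 0" for U V
    proof -
      obtain x2 x3 x4 x5 :: real where
        x: "U = x2 * u2 + x3 * u3 + x4 * u4 + x5 * u5" "V = x2 * v2 + x3 * v3 + x4 * v4 + x5 * v5"
        using surj by blast
      have "x2 \<noteq> 0 \<or> x3 \<noteq> 0 \<or> x4 \<noteq> 0 \<or> x5 \<noteq> 0" using that x by auto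
      then have "0 < x2 * x2 + x4 * x4 + p * (x3 * x3 + x5 * x5)"
        using True by (metis add_nonneg_pos add_pos_nonneg mult_pos_pos not_sum_squares_lt_zero
            sum_squares_gt_zero_iff zero_le_mult_iff less_eq_real_def linorder_not_less)
      then show ?thesis using Q[OF x] by simp
    qed
    have "c * (a * h) > 0" "c * (d * k) > 0" using pos[of 1 0] pos[of 0 1] by simp_all
    then have "(a * h) * (d * k) > 0" by (auto simp: zero_less_mult_iff)
    then show ?thesis using True by (simp add: mult.assoc)
  next
    case False
    then have pn: "p < 0" using p by simp
    have 2: "c * (a * h * (cmod u2)\<^sup>2 + d * k * (cmod v2)\<^sup>2) = 1"
      using Q[of u2 1 0 0 0 v2] by simp
    have 3: "c * (a * h * (cmod u3)\<^sup>2 + d * k * (cmod v3)\<^sup>2) = p"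
      using Q[of u3 0 1 0 0 v3] by simp
    \<comment> \<open>For negative \<open>p\<close> the quadratic form is 1 at \<open>e 2\<close>
      and \<open>p\<close> at \<open>e 3\<close>, hence indefinite, whereas equal signs would make
      it semidefinite.\<close>
    have "\<not> (a * h) * (d * k) > 0"
    proof
      assume "(a * h) * (d * k) > 0"
      then consider (pos) "a * h > 0" "d * k > 0" | (neg) "a * h < 0" "d * k < 0" by (auto simp: zero_less_mult_iff)
      then show False
      proof cases
        case pos
        then have "a * h * (cmod u2)\<^sup>2 + d * k * (cmod v2)\<^sup>2 \<ge> 0" "a * h * (cmod u3)\<^sup>2 + d * k * (cmod v3)\<^sup>2 \<ge> 0"
          by simp_all
        then show False using 2 3 pn by (smt (verit) mult_less_0_iff zero_less_mult_iff)
      next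
        case neg
        then have "a * h * (cmod u2)\<^sup>2 + d * k * (cmod v2)\<^sup>2 \<le> 0" "a * h * (cmod u3)\<^sup>2 + d * k * (cmod v3)\<^sup>2 \<le> 0"
          by (simp_all add: mult_nonpos_nonneg add_nonpos_nonpos)
        then show False using 2 3 pn by (smt (verit) mult_less_0_iff zero_less_mult_iff)
      qed
    qed
    moreover have "(a * h) * (d * k) \<noteq> 0" using ad0 hk0 by simp
    ultimately have "(a * h) * (d * k) < 0" by linarith
    then show ?thesis using pn by (simp add: mult.assoc mult_neg_neg)
  qed
qed

section \<open>Structure equations for each isomorphism class\<close>

lemma sgn_cases: "(x::real) \<noteq> 0 \<Longrightarrow> sgn x = - 1 \<or> sgn x = 1"
  by (simp add: sgn_if)

text \<open>The outcome of the hypotheses in terms of coframes. The trace condition is demanded of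
  all coframes because it is applied after triangularisation.\<close>

locale setting =
  fixes br :: "'a::real_vector \<Rightarrow> 'a \<Rightarrow> 'a" and J :: "'a \<Rightarrow> 'a" and N :: "'a set"
  assumes lie: "lie_algebra br" and nilradical: "is_nilradical br N" and nonabelian: "lower_central br N 1 \<noteq> {0}"
    and trace: "\<And>a b c d h k g. frame br J N a b c d h k g \<Longrightarrow> Im (a + d) = 0"
    and frame_exists: "\<exists>a b c d h k g. frame br J N a b c d h k g"
begin

lemma frame_cases:
  obtains (diagonal) a d h k where "frame br J N (of_real a) 0 0 (of_real d) h k 0" "a \<noteq> 0" "\<bar>d\<bar> \<le> \<bar>a\<bar>" "h \<noteq> 0 \<or> k \<noteq> 0"
  | (conjugate) a g where "frame br J N a 0 0 (cnj a) 0 0 g" "Im a \<noteq> 0" "g \<noteq> 0"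
  | (jordan) a b k g where "frame br J N (of_real a) b 0 (of_real a) 0 k g" "a \<noteq> 0" "b \<noteq> 0" "Im (b * g) = 0" "g \<noteq> 0 \<or> k \<noteq> 0"
proof -
  from frame_exists obtain a b c d h k g where F: "frame br J N a b c d h k g" by blast
  show thesis
  proof (rule frame_classification[OF lie nilradical nonabelian _ F])
    show "Im (a + d) = 0" if "frame br J N a b c d h k g" for a b c d h k g
      using that by (rule trace)
  qed (rule diagonal conjugate jordan; assumption)+
qed

lemma diagonal_rank1_normal:
  assumes F: "frame br J N (of_real a) 0 0 (of_real d) h 0 0" and a: "a \<noteq> 0" and h: "h \<noteq> 0"
    and q: "\<bar>d\<bar> = q * \<bar>a\<bar>" "q > 0"
  obtains \<epsilon> \<delta> where "frame br J N 1 0 0 (complex_of_real (\<epsilon> * q)) \<delta> 0 0" "\<epsilon> = -1 \<or> \<epsilon> = 1" "\<delta> = -1 \<or> \<delta> = 1"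
proof -
  have "frame br J N 1 0 0 (of_real (d / a)) (sgn (a * h)) 0 0"
    using frame_diagonal_normalise[OF F a] by simp
  moreover have "d / a = (d / a / q) * q" using q by simp
  moreover have "\<bar>d / a / q\<bar> = 1" using q a by (simp add: abs_mult)
  then have "d / a / q = -1 \<or> d / a / q = 1" by linarith
  moreover have "sgn (a * h) = -1 \<or> sgn (a * h) = 1" using a h by (intro sgn_cases) simp
  ultimately show thesis using that[of "d / a / q" "sgn (a * h)"] by simp
qed

text \<open>\<epsilon> and \<delta> are the signs of \<open>d / a / p\<close> and
  \<open>a * h\<close>. Positivity of \<open>p * (a * h) * (d * k)\<close> forces the sign of
  \<open>a * k\<close> to be their product.\<close>

lemma diagonal_rank2_normal:
  assumes F: "frame br J N (of_real a) 0 0 (of_real d) h k 0" and a: "a \<noteq> 0" and hk: "h \<noteq> 0" "k \<noteq> 0"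
    and p: "p \<noteq> 0" "\<bar>d\<bar> = \<bar>p\<bar> * \<bar>a\<bar>" "p * (a * h) * (d * k) > 0"
  obtains \<epsilon> \<delta> where "frame br J N 1 0 0 (complex_of_real (\<epsilon> * p)) \<delta> (\<epsilon> * \<delta>) 0" "\<epsilon> = -1 \<or> \<epsilon> = 1" "\<delta> = -1 \<or> \<delta> = 1"
proof -
  have "\<bar>d / a / p\<bar> = 1" using p a by (simp add: abs_mult)
  then have e: "d / a / p = -1 \<or> d / a / p = 1" by linarith
  have s: "sgn (a * h) = -1 \<or> sgn (a * h) = 1" using a hk by (intro sgn_cases) simp
  have "p * (a * h) * (d * k) = (p * p) * ((d / a / p) * ((a * h) * (a * k)))"
    using a p by (simp add: field_simps)
  then have "(d / a / p) * ((a * h) * (a * k)) > 0"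
    using p by (metis zero_less_mult_pos mult_pos_pos not_square_less_zero zero_less_mult_iff)
  then have "sgn ((d / a / p) * ((a * h) * (a * k))) = 1" by simp
  then have 1: "sgn (d / a / p) * (sgn (a * h) * sgn (a * k)) = 1" by (simp only: sgn_mult)
  have "sgn x = x" if "x = -1 \<or> x = 1" for x :: real using that by auto
  from this[OF e] have 2: "sgn (d / a / p) = d / a / p" .
  have "z = x * y" if "x * (y * z) = 1" "x = -1 \<or> x = 1" "y = -1 \<or> y = 1" for x y z :: real
    using that by auto
  from this[OF 1[unfolded 2] e s] have "sgn (a * k) = (d / a / p) * sgn (a * h)" .
  moreover have "d / a = (d / a / p) * p" using p by simp
  ultimately show thesis
    using that[of "d / a / p" "sgn (a * h)"] e s frame_diagonal_normalise[OF F a] by simp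
qed

text \<open>Only the absolute value of \<open>Im a / Re a\<close> is known to be \<open>p\<close>.
  If the sign is wrong, exchanging \<alpha>2 and \<alpha>3 replaces \<open>a\<close> by
  \<open>cnj a\<close>.\<close>

lemma conjugate_normal:
  assumes F: "frame br J N a 0 0 (cnj a) 0 0 g" and g: "g \<noteq> 0" and a: "Re a \<noteq> 0" "\<bar>Im a\<bar> = p * \<bar>Re a\<bar>"
  shows "frame br J N (1 + \<i> * complex_of_real p) 0 0 (1 - \<i> * complex_of_real p) 0 0 (- \<i>)"
proof (cases "Im a / Re a = p")
  case True
  then show ?thesis using frame_conjugate_normalise[OF F a(1)] g by blast
next
  case False
  have "\<bar>Im a / Re a\<bar> = p" using a by simp
  then have "Im (cnj a) / Re (cnj a) = p" using False by (simp add: abs_if split: if_splits)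
  then show ?thesis
    using frame_conjugate_normalise[of br J N "cnj a" "cnj g" p] frame_swap[OF F] g a(1) by simp
qed

section \<open>Selection of the normal form for each listed algebra\<close>

lemma admits_h3_s33:
  assumes iso: "isomorphic_to br h3_s33"
  shows "\<exists>\<epsilon>\<in>{-1, 1}. admits_basis br J (\<lambda>\<alpha>1 \<alpha>2 \<alpha>3 \<sigma>.
        [(\<i> * \<epsilon>) \<odot> \<alpha>3 \<^bold>\<and> conj_form \<alpha>3, - (\<alpha>2 \<^bold>\<and> \<sigma>), 0])"
  using frame_cases
proof cases
  case (diagonal a d h k)
  note r = realises_h3_s33[OF nilradical diagonal(1) iso]
  have "h * k = 0" using realises_symplectic2_degenerate[OF r] by simp
  moreover have "h = 0" using constraint_h3_s33(1)[OF r] diagonal(2) by auto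
  moreover from this have "k \<noteq> 0" using diagonal by simp
  moreover from this have "d = 0" using constraint_h3_s33(2)[OF r] by simp
  ultimately have "frame br J N 1 0 0 0 0 (sgn (a * k)) 0"
    using frame_diagonal_normalise[OF diagonal(1,2)] by simp
  then show ?thesis using normal_h3_s33(2) sgn_cases[of "a * k"] diagonal(2) \<open>k \<noteq> 0\<close> by simp
next
  case (conjugate a g)
  then show ?thesis
    using realises_symplectic2_degenerate[OF realises_h3_s33[OF nilradical conjugate(1) iso]] by simp
next
  case (jordan a b k g)
  note r = realises_h3_s33[OF nilradical jordan(1) iso]
  have "g = 0" using realises_symplectic2_degenerate[OF r] by simp
  then have "a = 0" using constraint_h3_s33(2)[of "of_real a" b "of_real a" 0 k] r jordan(5) by simp
  then show ?thesis using jordan(2) by simp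
qed

lemma admits_s47_R2:
  assumes iso: "isomorphic_to br s47_R2"
  shows "\<exists>\<epsilon>\<in>{-1, 1}. admits_basis br J (\<lambda>\<alpha>1 \<alpha>2 \<alpha>3 \<sigma>.
        [(\<i> * \<epsilon>) \<odot> \<alpha>2 \<^bold>\<and> conj_form \<alpha>2, - (\<alpha>2 \<^bold>\<and> \<sigma>), 0])"
  using frame_cases
proof cases
  case (diagonal a d h k)
  note r = realises_s47_R2[OF nilradical diagonal(1) iso]
  have "k = 0" using constraint_s47_R2(2)[OF r] diagonal(2) by auto
  moreover from this have "h \<noteq> 0" using diagonal by simp
  moreover from this have "d = 0" using constraint_s47_R2(1)[OF r] by simp
  ultimately have "frame br J N 1 0 0 0 (sgn (a * h)) 0 0"
    using frame_diagonal_normalise[OF diagonal(1,2)] by simp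
  then show ?thesis using normal_s47_R2(2) sgn_cases[of "a * h"] diagonal(2) \<open>h \<noteq> 0\<close> by simp
next
  case (conjugate a g)
  then show ?thesis
    using realises_symplectic2_degenerate[OF realises_s47_R2[OF nilradical conjugate(1) iso]] by simp
next
  case (jordan a b k g)
  note r = realises_s47_R2[OF nilradical jordan(1) iso]
  have "g = 0" using realises_symplectic2_degenerate[OF r] by simp
  then have "a = 0" using constraint_s47_R2(2)[of "of_real a" b "of_real a" 0 k] r jordan(5) by simp
  then show ?thesis using jordan(2) by simp
qed

lemma admits_s6_44:
  assumes iso: "isomorphic_to br s6_44"
  shows "\<exists>\<epsilon>\<in>{-1, 1}. admits_basis br J (\<lambda>\<alpha>1 \<alpha>2 \<alpha>3 \<sigma>.
        [(\<i> * \<epsilon>) \<odot> \<alpha>3 \<^bold>\<and> conj_form \<alpha>3, - ((\<lambda>X. \<alpha>2 X + \<i> * \<alpha>3 X) \<^bold>\<and> \<sigma>), - (\<alpha>3 \<^bold>\<and> \<sigma>)])"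
  using frame_cases
proof cases
  case (diagonal a d h k)
  show ?thesis using constraint_s6_44[OF realises_s6_44[OF nilradical diagonal(1) iso]] by blast
next
  case (conjugate a g)
  show ?thesis using constraint_s6_44[OF realises_s6_44[OF nilradical conjugate(1) iso]] by blast
next
  case (jordan a b k g)
  have g: "g = 0" using realises_symplectic2_degenerate[OF realises_s6_44[OF nilradical jordan(1) iso]] by simp
  have "frame br J N 1 \<i> 0 1 0 (sgn (a * k)) 0"
    using frame_jordan_degenerate_normalise[of br J N a b k] jordan g by simp
  then show ?thesis using normal_s6_44(2) sgn_cases[of "a * k"] jordan g by simp
qed

lemma admits_s6_52:
  assumes iso: "isomorphic_to br (s6_52 q)" and q: "q > 0"
  shows "\<exists>\<delta>\<in>{-1, 1}. \<exists>\<epsilon>\<in>{-1, 1}. admits_basis br J (\<lambda>\<alpha>1 \<alpha>2 \<alpha>3 \<sigma>.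
        [(\<i> * \<delta>) \<odot> \<alpha>2 \<^bold>\<and> conj_form \<alpha>2, - (\<alpha>2 \<^bold>\<and> \<sigma>), - ((\<epsilon> * complex_of_real q) \<odot> \<alpha>3 \<^bold>\<and> \<sigma>)])"
  using frame_cases
proof cases
  case (diagonal a d h k)
  \<comment> \<open>No order between \<open>a\<close> and \<open>d\<close> is fixed here, since the
    form may live on either eigenline; a swap brings it to the first one.\<close>
  have *: ?thesis if F: "frame br J N (of_real a) 0 0 (of_real d) h 0 0" and h: "h \<noteq> 0" for a d h
  proof -
    have "complex_of_real a \<noteq> 0 \<and> of_real d * of_real d = of_real (q * q) * (complex_of_real a * of_real a)"
      by (rule constraint_s6_52(1)[OF realises_s6_52[OF nilradical F iso] refl h])
    then have a: "a \<noteq> 0" and "complex_of_real (d * d) = of_real (q * q * (a * a))" by simp_all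
    then have "d\<^sup>2 = (q * a)\<^sup>2" unfolding of_real_eq_iff by (simp add: power2_eq_square)
    then have "\<bar>d\<bar> = \<bar>q * a\<bar>" by (simp only: power2_eq_iff) auto
    then have d: "\<bar>d\<bar> = q * \<bar>a\<bar>" using q by (simp add: abs_mult)
    show ?thesis by (rule diagonal_rank1_normal[OF F a h d q]) (rule normal_s6_52(2); assumption)
  qed
  have "h * k = 0" using realises_symplectic2_degenerate[OF realises_s6_52[OF nilradical diagonal(1) iso]] by simp
  then consider "k = 0" "h \<noteq> 0" | "h = 0" "k \<noteq> 0" using diagonal by auto
  then show ?thesis using *[of a d h] *[of d a k] diagonal(1) frame_swap[OF diagonal(1)] by cases simp_all
next
  case (conjugate a g)
  then show ?thesis
    using realises_symplectic2_degenerate[OF realises_s6_52[OF nilradical conjugate(1) iso]] by simp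
next
  case (jordan a b k g)
  note r = realises_s6_52[OF nilradical jordan(1) iso]
  have "g = 0" using realises_symplectic2_degenerate[OF r] by simp
  then have "b = 0" using constraint_s6_52(2)[of q "of_real a" b "of_real a" 0 k] r jordan(5) by simp
  then show ?thesis using jordan(3) by simp
qed

lemma admits_s6_159:
  assumes iso: "isomorphic_to br s6_159"
  shows "\<exists>\<delta>\<in>{-1, 1}. \<exists>\<epsilon>\<in>{-1, 1}. admits_basis br J (\<lambda>\<alpha>1 \<alpha>2 \<alpha>3 \<sigma>.
        [(\<i> * \<delta>) \<odot> \<alpha>2 \<^bold>\<and> conj_form \<alpha>2 + (\<i> * \<epsilon>) \<odot> \<alpha>3 \<^bold>\<and> conj_form \<alpha>3, - (\<alpha>2 \<^bold>\<and> \<sigma>), 0])"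
  using frame_cases
proof cases
  case (diagonal a d h k)
  note r = realises_s6_159[OF nilradical diagonal(1) iso]
  have "h * k \<noteq> 0" using realises_symplectic4_nondegenerate[OF r] by simp
  then have hk: "sgn (a * h) = -1 \<or> sgn (a * h) = 1" "sgn (a * k) = -1 \<or> sgn (a * k) = 1"
    using diagonal(2) by (auto intro!: sgn_cases)
  have "d = 0" using constraint_s6_159[OF r] diagonal(2) by simp
  then have "frame br J N 1 0 0 0 (sgn (a * h)) (sgn (a * k)) 0"
    using frame_diagonal_normalise[OF diagonal(1,2)] by simp
  then show ?thesis using normal_s6_159(2) hk by blast
next
  case (conjugate a g)
  then show ?thesis using constraint_s6_159[OF realises_s6_159[OF nilradical conjugate(1) iso]] by auto
next
  case (jordan a b k g)
  then show ?thesis using constraint_s6_159[OF realises_s6_159[OF nilradical jordan(1) iso]] by simp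
qed

lemma admits_s6_162_1:
  assumes iso: "isomorphic_to br s6_162_1"
  shows "admits_basis br J (\<lambda>\<alpha>1 \<alpha>2 \<alpha>3 \<sigma>.
        [\<alpha>2 \<^bold>\<and> conj_form \<alpha>3 - \<alpha>3 \<^bold>\<and> conj_form \<alpha>2, - (\<i> \<odot> \<alpha>2 \<^bold>\<and> \<sigma>), \<i> \<odot> \<alpha>3 \<^bold>\<and> \<sigma>])"
  using frame_cases
proof cases
  case (diagonal a d h k)
  then show ?thesis using constraint_s6_162_1(1)[OF realises_s6_162_1[OF nilradical diagonal(1) iso]] by simp
next
  case (conjugate a g)
  have "Re a = 0"
    by (rule constraint_s6_162_1(2)[OF realises_s6_162_1[OF nilradical conjugate(1) iso] refl refl])
  then show ?thesis using normal_s6_162_1(2) frame_imaginary_normalise conjugate by blast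
next
  case (jordan a b k g)
  then show ?thesis using constraint_s6_162_1(1)[OF realises_s6_162_1[OF nilradical jordan(1) iso]] by simp
qed

lemma admits_s6_165:
  assumes iso: "isomorphic_to br (s6_165 p)" and p: "p > 0"
  shows "admits_basis br J (\<lambda>\<alpha>1 \<alpha>2 \<alpha>3 \<sigma>.
        [\<alpha>2 \<^bold>\<and> conj_form \<alpha>3 - \<alpha>3 \<^bold>\<and> conj_form \<alpha>2, - ((1 + \<i> * complex_of_real p) \<odot> \<alpha>2 \<^bold>\<and> \<sigma>), - ((1 - \<i> * complex_of_real p) \<odot> \<alpha>3 \<^bold>\<and> \<sigma>)])"
  using frame_cases
proof cases
  case (diagonal a d h k)
  then show ?thesis using constraint_s6_165(1)[OF realises_s6_165[OF nilradical diagonal(1) iso] p] by simp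
next
  case (conjugate a g)
  have "Re a \<noteq> 0 \<and> \<bar>Im a\<bar> = p * \<bar>Re a\<bar>"
    by (rule constraint_s6_165(2)[OF realises_s6_165[OF nilradical conjugate(1) iso] p refl refl])
  then show ?thesis using normal_s6_165(2) conjugate_normal conjugate by blast
next
  case (jordan a b k g)
  then show ?thesis using constraint_s6_165(1)[OF realises_s6_165[OF nilradical jordan(1) iso] p] by simp
qed

lemma admits_s6_166:
  assumes iso: "isomorphic_to br (s6_166 p)" and p: "0 < \<bar>p\<bar>" "\<bar>p\<bar> \<le> 1"
  shows "\<exists>\<delta>\<in>{-1, 1}. \<exists>\<epsilon>\<in>{-1, 1}. admits_basis br J (\<lambda>\<alpha>1 \<alpha>2 \<alpha>3 \<sigma>.
        [(\<i> * \<delta>) \<odot> \<alpha>2 \<^bold>\<and> conj_form \<alpha>2 + (\<i> * \<epsilon> * \<delta>) \<odot> \<alpha>3 \<^bold>\<and> conj_form \<alpha>3, - (\<alpha>2 \<^bold>\<and> \<sigma>), - ((\<epsilon> * complex_of_real p) \<odot> \<alpha>3 \<^bold>\<and> \<sigma>)])"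
  using frame_cases
proof cases
  case (diagonal a d h k)
  note r = realises_s6_166[OF nilradical diagonal(1) iso]
  have hk: "h \<noteq> 0" "k \<noteq> 0" using realises_symplectic4_nondegenerate[OF r] by auto
  have p0: "p \<noteq> 0" using p by simp
  note c = constraint_s6_166_diagonal[OF r p0 p(2) diagonal(3)]
  show ?thesis
    by (rule diagonal_rank2_normal[OF diagonal(1,2) hk p0 c]) (rule normal_s6_166(2); assumption)
next
  case (conjugate a g)
  then show ?thesis using constraint_s6_166_not_conjugate[OF realises_s6_166[OF nilradical conjugate(1) iso]] by simp
next
  case (jordan a b k g)
  then show ?thesis using constraint_s6_166_not_jordan[OF realises_s6_166[OF nilradical jordan(1) iso]] p by simp
qed

lemma admits_s6_167:
  assumes iso: "isomorphic_to br s6_167"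
  shows "\<exists>\<epsilon>\<in>{-1, 1}. \<exists>x::real. admits_basis br J (\<lambda>\<alpha>1 \<alpha>2 \<alpha>3 \<sigma>.
        [\<epsilon> \<odot> \<alpha>2 \<^bold>\<and> conj_form \<alpha>3 - \<epsilon> \<odot> \<alpha>3 \<^bold>\<and> conj_form \<alpha>2 + (\<i> * complex_of_real x) \<odot> \<alpha>3 \<^bold>\<and> conj_form \<alpha>3, - ((\<lambda>X. \<alpha>2 X + \<i> * \<alpha>3 X) \<^bold>\<and> \<sigma>), - (\<alpha>3 \<^bold>\<and> \<sigma>)])"
  using frame_cases
proof cases
  case (diagonal a d h k)
  show ?thesis using constraint_s6_44[OF realises_s6_167[OF nilradical diagonal(1) iso]] by blast
next
  case (conjugate a g)
  show ?thesis using constraint_s6_44[OF realises_s6_167[OF nilradical conjugate(1) iso]] by blast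
next
  case (jordan a b k g)
  have g: "g \<noteq> 0" using realises_symplectic4_nondegenerate[OF realises_s6_167[OF nilradical jordan(1) iso]] by simp
  have "Re (b * g) \<noteq> 0" using jordan(3,4) g by (metis complex_eq_iff mult_eq_0_iff zero_complex.sel)
  then show ?thesis
    using normal_s6_167(2) frame_jordan_normalise[OF jordan(1-3) g jordan(4)] sgn_cases by blast
qed

text \<open>In the diagonal family the class is read off from the support of the form and from
  \<open>d\<close>: for \<open>d = 0\<close> the form lives on the rotated plane
  (\<open>s47_R2\<close>), on the fixed plane (\<open>h3_s33\<close>) or on both
  (\<open>s6_159\<close>). For nonzero \<open>d\<close>, rank one gives \<open>s6_52\<close> and
  rank two \<open>s6_166\<close>.\<close>

lemma isomorphism_class:
  "isomorphic_to br h3_s33 \<or> isomorphic_to br s47_R2 \<or> isomorphic_to br s6_44 \<or>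
     (\<exists>q>0. isomorphic_to br (s6_52 q)) \<or> isomorphic_to br s6_159 \<or>
     isomorphic_to br s6_162_1 \<or> (\<exists>p>0. isomorphic_to br (s6_165 p)) \<or>
     (\<exists>p. 0 < \<bar>p\<bar> \<and> \<bar>p\<bar> \<le> 1 \<and> isomorphic_to br (s6_166 p)) \<or> isomorphic_to br s6_167"
  using frame_cases
proof cases
  case (diagonal a d h k)
  have rank1: "\<exists>q>0. isomorphic_to br (s6_52 q)"
    if "frame br J N (of_real a) 0 0 (of_real d) h 0 0" "a \<noteq> 0" "h \<noteq> 0" "d \<noteq> 0" for a d h
  proof -
    have q: "\<bar>d\<bar> = \<bar>d / a\<bar> * \<bar>a\<bar>" "\<bar>d / a\<bar> > 0" using that by simp_all
    have "isomorphic_to br (s6_52 \<bar>d / a\<bar>)"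
      by (rule diagonal_rank1_normal[OF that(1-3) q]) (rule normal_s6_52(1); assumption)
    then show ?thesis using q(2) by blast
  qed
  note F = frame_diagonal_normalise[OF diagonal(1,2)]
  consider "k = 0" "h \<noteq> 0" "d = 0" | "k = 0" "h \<noteq> 0" "d \<noteq> 0" | "h = 0" "k \<noteq> 0" "d = 0" | "h = 0" "k \<noteq> 0" "d \<noteq> 0"
    | "h \<noteq> 0" "k \<noteq> 0" "d = 0" | "h \<noteq> 0" "k \<noteq> 0" "d \<noteq> 0"
    using diagonal(4) by blast
  then show ?thesis
  proof cases
    case 1
    then show ?thesis using normal_s47_R2(1)[of br J N "sgn (a * h)"] F sgn_cases[of "a * h"] diagonal(2) by simp
  next
    case 2
    then show ?thesis using rank1[of a d h] diagonal by simp
  next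
    case 3
    then show ?thesis using normal_h3_s33(1)[of br J N "sgn (a * k)"] F sgn_cases[of "a * k"] diagonal(2) by simp
  next
    case 4
    then show ?thesis using rank1[of d a k] diagonal frame_swap[OF diagonal(1)] by simp
  next
    case 5
    then show ?thesis using normal_s6_159(1)[of br J N "sgn (a * h)" "sgn (a * k)"] F sgn_cases[of "a * h"] sgn_cases[of "a * k"] diagonal(2) by simp
  next
    case 6
    \<comment> \<open>The modulus is the ratio of frequencies; the sign is the one that makes
      \<open>p * (a * h) * (d * k)\<close> positive.\<close>
    define p where "p = sgn ((a * h) * (d * k)) * \<bar>d / a\<bar>"
    have s: "\<bar>sgn ((a * h) * (d * k))\<bar> = 1" using 6 diagonal(2) by (simp add: abs_sgn_eq)
    have abs_p: "\<bar>p\<bar> = \<bar>d / a\<bar>" unfolding p_def abs_mult s by simp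
    have p0: "p \<noteq> 0" using abs_p 6 diagonal(2) by auto
    have "p * ((a * h) * (d * k)) = \<bar>(a * h) * (d * k)\<bar> * \<bar>d / a\<bar>"
      unfolding p_def by (simp only: mult.assoc mult.commute[of "\<bar>d / a\<bar>"] abs_sgn mult_ac)
    then have pos: "p * (a * h) * (d * k) > 0" using 6 diagonal(2) by (simp add: mult.assoc)
    have d: "\<bar>d\<bar> = \<bar>p\<bar> * \<bar>a\<bar>" unfolding abs_p using diagonal(2) by simp
    have "isomorphic_to br (s6_166 p)"
      by (rule diagonal_rank2_normal[OF diagonal(1,2) 6(1,2) p0 d pos]) (rule normal_s6_166(1); assumption)
    moreover have "\<bar>p\<bar> \<le> 1" unfolding abs_p using diagonal(2,3) by simp
    ultimately show ?thesis using p0 by auto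
  qed
next
  case (conjugate a g)
  show ?thesis
  proof (cases "Re a = 0")
    case True
    then show ?thesis using normal_s6_162_1(1) frame_imaginary_normalise[OF conjugate(1)] conjugate by blast
  next
    case False
    define p where "p = \<bar>Im a\<bar> / \<bar>Re a\<bar>"
    have "p > 0" "\<bar>Im a\<bar> = p * \<bar>Re a\<bar>" using False conjugate by (simp_all add: p_def)
    then show ?thesis using normal_s6_165(1) conjugate_normal[OF conjugate(1,3) False] by blast
  qed
next
  case (jordan a b k g)
  show ?thesis
  proof (cases "g = 0")
    case True
    then show ?thesis
      using normal_s6_44(1)[of br J N "sgn (a * k)"] frame_jordan_degenerate_normalise[of br J N a b k] jordan sgn_cases[of "a * k"] by simp
  next
    case False
    have "Re (b * g) \<noteq> 0" using jordan(3,4) False by (metis complex_eq_iff mult_eq_0_iff zero_complex.sel)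
    then show ?thesis
      using normal_s6_167(1) frame_jordan_normalise[OF jordan(1-3) False jordan(4)] sgn_cases by blast
  qed
qed

end

section \<open>Existence of an adapted coframe\<close>

text \<open>The dimension is written \<open>Suc n\<close> because a positive cardinality is what
  makes the basis finite.\<close>

lemma finite_basis_exists:
  assumes "dim (UNIV :: 'a::real_vector set) = Suc n"
  obtains B :: "'a::real_vector set" where "finite B" "card B = Suc n" "span B = UNIV"
proof -
  obtain B :: "'a set" where "independent B" "UNIV \<subseteq> span B" "card B = dim (UNIV :: 'a set)"
    using basis_exists[of "UNIV :: 'a set"] by metis
  then show thesis using that[of B] assms card_ge_0_finite[of B] by auto
qed

lemma independent_card_le_dim:
  assumes "dim (UNIV :: 'a::real_vector set) = Suc n" and "independent (S :: 'a::real_vector set)"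
  shows "finite S" "card S \<le> Suc n"
proof -
  obtain B :: "'a set" where "finite B" "card B = Suc n" "span B = UNIV"
    using finite_basis_exists[OF assms(1)] by blast
  then have "finite S \<and> card S \<le> card B"
    using assms(2) by (intro independent_span_bound) auto
  then show "finite S" "card S \<le> Suc n" using \<open>card B = Suc n\<close> by auto
qed

lemma independent_card_eq_dim_spans:
  assumes "dim (UNIV :: 'a::real_vector set) = Suc n" and S: "independent (S :: 'a::real_vector set)" "card S = Suc n"
  shows "span S = UNIV"
proof (rule ccontr)
  assume "span S \<noteq> UNIV"
  then obtain x where x: "x \<notin> span S" by blast
  then have "independent (insert x S)" using S by (simp add: independent_insertI)
  moreover have "card (insert x S) = Suc (Suc n)"
  proof -
    have "x \<notin> S" using x span_base[of x S] by blast
    moreover have "finite S" using S card_ge_0_finite[of S] by simp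
    ultimately show ?thesis using S by simp
  qed
  ultimately show False using independent_card_le_dim(2)[OF assms(1), of "insert x S"] by simp
qed

lemma quot_basis_exists:
  assumes "subspace V" "subspace W" "W \<subseteq> V"
  shows "\<exists>B C. quot_basis V W B C"
proof -
  obtain C where C: "C \<subseteq> W" "independent C" "W \<subseteq> span C" using basis_exists[of W] by metis
  obtain B where B: "C \<subseteq> B" "B \<subseteq> V" "independent B" "V \<subseteq> span B"
    using maximal_independent_subset_extend[OF subset_trans[OF C(1) assms(3)] C(2)] by metis
  have "span C = W" using C assms(2) by (simp add: span_minimal subset_antisym)
  moreover have "span B = V" using B assms(1) by (simp add: span_minimal subset_antisym)
  moreover have "(B - C) \<union> C = B" using B by blast
  ultimately have "quot_basis V W (B - C) C" unfolding quot_basis_def using B by auto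
  then show ?thesis by blast
qed

text \<open>Independence of the trace from the chosen basis: the functionals and vectors indexed by
  \<open>I\<close> resolve the identity of \<open>V/W\<close>, as do the chosen basis and its
  coordinates. Expanding one system in the other and exchanging the sums turns one trace into the
  other.\<close>

lemma quot_trace_eq:
  fixes T :: "'a::real_vector \<Rightarrow> 'a"
  assumes dim: "dim (UNIV :: 'a set) = Suc n"
    and VW: "subspace V" "subspace W" "W \<subseteq> V"
    and T: "linear T" "\<And>x. x \<in> V \<Longrightarrow> T x \<in> V" "\<And>x. x \<in> W \<Longrightarrow> T x \<in> W"
    and I: "finite I"
    and \<phi>: "\<And>i. i \<in> I \<Longrightarrow> linear (\<phi> i)" "\<And>i x. i \<in> I \<Longrightarrow> x \<in> W \<Longrightarrow> \<phi> i x = 0"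
    and e: "\<And>i. i \<in> I \<Longrightarrow> e i \<in> V" "\<And>x. x \<in> V \<Longrightarrow> x - (\<Sum>i\<in>I. \<phi> i x *\<^sub>R e i) \<in> W"
  shows "quot_trace T V W = (\<Sum>i\<in>I. \<phi> i (T (e i)))"
proof -
  obtain B C where SOME: "(SOME (B, C). quot_basis V W B C) = (B, C)" by (metis prod.exhaust)
  have "\<exists>x. case x of (B, C) \<Rightarrow> quot_basis V W B C" using quot_basis_exists[OF VW] by simp
  from someI_ex[OF this] have "quot_basis V W B C" unfolding SOME by simp
  then have BC: "B \<inter> C = {}" "independent (B \<union> C)" "span C = W" "span (B \<union> C) = V"
    unfolding quot_basis_def by auto
  have fin: "finite B" "finite C" using independent_card_le_dim(1)[OF dim BC(2)] by auto
  define \<beta> where "\<beta> b x = representation (B \<union> C) x b" for b x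
  \<comment> \<open>A vector of \<open>W\<close> is represented by \<open>C\<close> alone, so its
    coordinates along \<open>B\<close> vanish.\<close>
  have \<beta>W: "\<beta> b x = 0" if "b \<in> B" "x \<in> W" for b x
  proof -
    have "representation (B \<union> C) x = representation C x"
      using that BC by (intro representation_extend) auto
    moreover have "representation C x b = 0"
      using representation_ne_zero[of C x b] that BC(1) by blast
    ultimately show ?thesis by (simp add: \<beta>_def)
  qed
  have dec: "x - (\<Sum>b\<in>B. \<beta> b x *\<^sub>R b) \<in> W" if "x \<in> V" for x
  proof -
    have "(\<Sum>b\<in>B \<union> C. \<beta> b x *\<^sub>R b) = x"
      unfolding \<beta>_def using BC fin that by (intro sum_representation_eq) auto
    then have "x - (\<Sum>b\<in>B. \<beta> b x *\<^sub>R b) = (\<Sum>b\<in>C. \<beta> b x *\<^sub>R b)"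
      using BC(1) fin by (simp add: sum.union_disjoint algebra_simps)
    also have "\<dots> \<in> span C" by (intro span_sum span_scale span_base)
    finally show ?thesis using BC by simp
  qed
  have BV: "b \<in> V" if "b \<in> B" for b using that BC(4) span_base[of b "B \<union> C"] by auto
  have \<beta>e: "\<beta> b x = (\<Sum>i\<in>I. \<phi> i x * \<beta> b (e i))" if b: "b \<in> B" and x: "x \<in> V" for b x
  proof -
    let ?s = "\<Sum>i\<in>I. \<phi> i x *\<^sub>R e i"
    have s: "?s \<in> V" using VW(1) e(1) by (intro subspace_sum subspace_scale) auto
    have "\<beta> b (x - ?s) = \<beta> b x - \<beta> b ?s"
      unfolding \<beta>_def using BC x s by (subst representation_diff) auto
    moreover have "\<beta> b (x - ?s) = 0" using \<beta>W b e(2)[OF x] by blast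
    moreover have "\<beta> b ?s = (\<Sum>i\<in>I. \<phi> i x * \<beta> b (e i))"
    proof -
      have "representation (B \<union> C) ?s = (\<lambda>b. \<Sum>i\<in>I. representation (B \<union> C) (\<phi> i x *\<^sub>R e i) b)"
        using BC e(1) VW(1) by (intro representation_sum) (auto intro: subspace_scale)
      then have "\<beta> b ?s = (\<Sum>i\<in>I. representation (B \<union> C) (\<phi> i x *\<^sub>R e i) b)" by (simp add: \<beta>_def)
      also have "\<dots> = (\<Sum>i\<in>I. \<phi> i x * \<beta> b (e i))"
        unfolding \<beta>_def using BC e(1) by (intro sum.cong refl) (simp add: representation_scale)
      finally show ?thesis .
    qed
    ultimately show ?thesis by simp
  qed
  have "quot_trace T V W = (\<Sum>b\<in>B. \<beta> b (T b))"
    unfolding quot_trace_def SOME \<beta>_def by simp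
  also have "\<dots> = (\<Sum>b\<in>B. \<Sum>i\<in>I. \<phi> i (T b) * \<beta> b (e i))"
    by (intro sum.cong refl \<beta>e T BV)
  also have "\<dots> = (\<Sum>i\<in>I. \<Sum>b\<in>B. \<phi> i (T b) * \<beta> b (e i))"
    by (rule sum.swap)
  also have "\<dots> = (\<Sum>i\<in>I. \<phi> i (T (e i)))"
  proof (intro sum.cong refl)
    fix i assume i: "i \<in> I"
    let ?s = "\<Sum>b\<in>B. \<beta> b (e i) *\<^sub>R b"
    have "T (e i - ?s) \<in> W" using T(3) dec[OF e(1)[OF i]] .
    then have "\<phi> i (T (e i - ?s)) = 0" using \<phi>(2) i by blast
    then have "\<phi> i (T (e i)) = \<phi> i (T ?s)"
      using T(1) \<phi>(1)[OF i] by (simp add: linear_diff)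
    also have "\<dots> = (\<Sum>b\<in>B. \<phi> i (T b) * \<beta> b (e i))"
      using T(1) \<phi>(1)[OF i] by (simp add: linear_sum linear_scale mult.commute)
    finally show "(\<Sum>b\<in>B. \<phi> i (T b) * \<beta> b (e i)) = \<phi> i (T (e i))" by simp
  qed
  finally show ?thesis .
qed

lemma subspace_lower_central: "subspace N \<Longrightarrow> subspace (lower_central br N k)"
  by (cases k) (simp_all add: bracket_span_def)

text \<open>On \<open>N/[N,N]\<close> the operator \<open>ad W\<close> is \<open>- 2 * \<i>\<close>
  times the coefficient matrix, and its real trace is twice the real part of the complex one, namely
  \<open>4 * Im (a + d)\<close>.\<close>

lemma frame_trace:
  fixes br :: "'a::real_vector \<Rightarrow> 'a \<Rightarrow> 'a"
  assumes dim: "dim (UNIV :: 'a set) = Suc n" and lie: "lie_algebra br"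
    and N: "subspace N" "\<And>X Y. Y \<in> N \<Longrightarrow> br X Y \<in> N" "lower_central br N 1 \<noteq> {0}"
    and N1: "\<And>X Y. Y \<in> lower_central br N 1 \<Longrightarrow> br X Y \<in> lower_central br N 1"
    and tr: "\<And>X. quot_trace (br X) N (lower_central br N 1) = 0"
    and F: "frame br J N a b c d h k g"
  shows "Im (a + d) = 0"
proof -
  from F obtain \<alpha>1 \<alpha>2 \<alpha>3 where A: "adapted br J N \<alpha>1 \<alpha>2 \<alpha>3 a b c d h k g"
    unfolding frame_def by blast
  obtain W where W: "\<alpha>1 W = \<i>" "\<alpha>2 W = 0" "\<alpha>3 W = 0" using adapted_surj[OF A] by metis
  obtain E1 where E1: "\<alpha>1 E1 = 0" "\<alpha>2 E1 = 1" "\<alpha>3 E1 = 0" using adapted_surj[OF A] by metis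
  obtain E2 where E2: "\<alpha>1 E2 = 0" "\<alpha>2 E2 = \<i>" "\<alpha>3 E2 = 0" using adapted_surj[OF A] by metis
  obtain E3 where E3: "\<alpha>1 E3 = 0" "\<alpha>2 E3 = 0" "\<alpha>3 E3 = 1" using adapted_surj[OF A] by metis
  obtain E4 where E4: "\<alpha>1 E4 = 0" "\<alpha>2 E4 = 0" "\<alpha>3 E4 = \<i>" using adapted_surj[OF A] by metis
  define e where "e = tuple6 E1 E2 E3 E4 0 0"
  define \<phi> where "\<phi> = tuple6 (\<lambda>X. Re (\<alpha>2 X)) (\<lambda>X. Im (\<alpha>2 X)) (\<lambda>X. Re (\<alpha>3 X)) (\<lambda>X. Im (\<alpha>3 X)) (\<lambda>X. 0) (\<lambda>X. 0)"
  let ?W = "lower_central br N 1"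
  have zero: "\<alpha>1 0 = 0" "\<alpha>2 0 = 0" "\<alpha>3 0 = 0"
    using adapted_linear(4-)[OF A, of 0 0] by simp_all
  have minus: "\<alpha>1 (X - Y) = \<alpha>1 X - \<alpha>1 Y" "\<alpha>2 (X - Y) = \<alpha>2 X - \<alpha>2 Y" "\<alpha>3 (X - Y) = \<alpha>3 X - \<alpha>3 Y" for X Y
    using adapted_form10[OF A] by (simp_all add: form10_def linear_diff)
  let ?S = "{X. Im (\<alpha>1 X) = 0 \<and> \<alpha>2 X = 0 \<and> \<alpha>3 X = 0}"
  have S: "subspace ?S" by (auto intro!: subspaceI simp: zero adapted_linear[OF A])
  have WS: "?W \<subseteq> ?S"
    unfolding One_nat_def lower_central.simps
    by (rule bracket_span_subset[OF S]) (use N(2) in \<open>auto simp: adapted_N[OF A] adapted_br(2,3)[OF A]\<close>)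
  have subW: "subspace ?W" by (rule subspace_lower_central[OF N(1)])
  have "0 \<in> ?W" using subW by (rule subspace_0)
  then obtain Z where Z: "Z \<in> ?W" "Z \<noteq> 0" using N(3) by auto
  then have Z': "Im (\<alpha>1 Z) = 0" "\<alpha>2 Z = 0" "\<alpha>3 Z = 0" using WS by auto
  then have Z0: "Re (\<alpha>1 Z) \<noteq> 0" using adapted_inj[OF A, of Z] Z(2) by (auto simp: complex_eq_iff)
  \<comment> \<open>\<open>?S\<close> is a real line, with coordinate \<open>Re \<alpha>1\<close>,
    and it contains the nonzero element \<open>Z\<close> of the derived algebra.\<close>
  have SW: "X \<in> ?W" if "X \<in> ?S" for X
  proof -
    let ?Y = "(Re (\<alpha>1 X) / Re (\<alpha>1 Z)) *\<^sub>R Z"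
    have "X - ?Y = 0"
      by (rule adapted_inj[OF A]) (use that Z' Z0 in \<open>auto simp: minus adapted_linear[OF A] complex_eq_iff\<close>)
    moreover have "?Y \<in> ?W" using subW Z(1) by (rule subspace_scale)
    ultimately show ?thesis by simp
  qed
  have "quot_trace (br W) N ?W = (\<Sum>i\<in>{1, 2, 3, 4}. \<phi> i (br W (e i)))"
  proof (rule quot_trace_eq[OF dim N(1) subW])
    show "?W \<subseteq> N" using WS adapted_N[OF A] by blast
    show "linear (br W)" using lie unfolding lie_algebra_def by blast
    show "br W X \<in> N" if "X \<in> N" for X using N(2) that .
    show "br W X \<in> ?W" if "X \<in> ?W" for X using N1 that .
    show "linear (\<phi> i)" if "i \<in> {1, 2, 3, 4}" for i
      using that by (auto simp: \<phi>_def adapted_linear[OF A] intro!: linearI)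
    show "\<phi> i X = 0" if "i \<in> {1, 2, 3, 4}" "X \<in> ?W" for i X
      using that(1) WS that(2) by (auto simp: \<phi>_def)
    show "e i \<in> N" if "i \<in> {1, 2, 3, 4}" for i
      using that by (auto simp: e_def adapted_N[OF A] E1 E2 E3 E4)
    show "X - (\<Sum>i\<in>{1, 2, 3, 4}. \<phi> i X *\<^sub>R e i) \<in> ?W" if "X \<in> N" for X
      using that by (intro SW)
        (auto simp: e_def \<phi>_def minus adapted_linear[OF A] adapted_N[OF A] E1 E2 E3 E4 complex_eq_iff)
  qed simp
  also have "\<dots> = 4 * (Im a + Im d)"
    by (simp add: e_def \<phi>_def adapted_br[OF A] W E1 E2 E3 E4)
  finally show ?thesis using tr[of W] by simp
qed

section \<open>Construction of an adapted coframe\<close>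

text \<open>\<open>J\<close> has no real eigenvalue modulo a \<open>J\<close>-invariant subspace:
  \<open>J v = t v\<close> there would imply that \<open>(1 + t * t) v\<close> vanishes there. So a
  new vector always brings its image under \<open>J\<close> as a second one.\<close>

lemma complex_line_extend:
  fixes J :: "'a::real_vector \<Rightarrow> 'a"
  assumes J: "linear J" "\<And>X. J (J X) = - X"
    and B: "independent B" "finite B" "\<And>X. X \<in> span B \<Longrightarrow> J X \<in> span B" and v: "v \<notin> span B"
  shows "independent (insert (J v) (insert v B))" "finite (insert (J v) (insert v B))"
    "card (insert (J v) (insert v B)) = card B + 2"
    "\<And>X. X \<in> span (insert (J v) (insert v B)) \<Longrightarrow> J X \<in> span (insert (J v) (insert v B))"
proof -
  have Jv: "J v \<notin> span (insert v B)"
  proof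
    assume "J v \<in> span (insert v B)"
    then obtain t where w: "J v - t *\<^sub>R v \<in> span B" by (auto simp: span_breakdown_eq)
    then have "J (J v - t *\<^sub>R v) \<in> span B" by (rule B(3))
    then have "- v - t *\<^sub>R J v \<in> span B" using J by (simp add: linear_diff linear_scale)
    from span_add[OF this span_scale[OF w, of t]]
    have "(- (1 + t * t)) *\<^sub>R v \<in> span B" by (simp add: algebra_simps)
    then have "inverse (- (1 + t * t)) *\<^sub>R ((- (1 + t * t)) *\<^sub>R v) \<in> span B" by (rule span_scale)
    moreover have "- (1 + t * t) \<noteq> 0" using zero_le_square[of t] by linarith
    then have "inverse (- (1 + t * t)) * (- (1 + t * t)) = 1" by (rule left_inverse)
    ultimately have "v \<in> span B" by (simp only: scaleR_scaleR scaleR_one)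
    then show False using v by blast
  qed
  then show "independent (insert (J v) (insert v B))"
    using B(1) v by (intro independent_insertI)
  show "finite (insert (J v) (insert v B))" using B by simp
  have "v \<notin> B" "J v \<notin> insert v B" using v Jv span_base by blast+
  then show "card (insert (J v) (insert v B)) = card B + 2" using B(2) by (simp add: card_insert_disjoint)
  fix X assume "X \<in> span (insert (J v) (insert v B))"
  then obtain s t where w: "X - s *\<^sub>R J v - t *\<^sub>R v \<in> span B" by (auto simp: span_breakdown_eq)
  then have "J (X - s *\<^sub>R J v - t *\<^sub>R v) \<in> span B" by (rule B(3))
  then have "J X - (- s) *\<^sub>R v - t *\<^sub>R J v \<in> span B" using J by (simp add: linear_diff linear_scale)
  then have "J X - t *\<^sub>R J v - (- s) *\<^sub>R v \<in> span B" by (simp add: algebra_simps)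
  then show "J X \<in> span (insert (J v) (insert v B))" unfolding span_breakdown_eq by blast
qed

lemma coframe_exists:
  fixes J :: "'a::real_vector \<Rightarrow> 'a"
  assumes dim: "dim (UNIV :: 'a set) = 6" and J: "linear J" "\<And>X. J (J X) = - X"
    and \<alpha>1: "form10 J \<alpha>1" "\<alpha>1 Z = 1"
  obtains \<alpha>2 \<alpha>3 where "form10 J \<alpha>2" "form10 J \<alpha>3" "\<alpha>2 Z = 0" "\<alpha>3 Z = 0"
    "\<And>X. \<alpha>1 X = 0 \<Longrightarrow> \<alpha>2 X = 0 \<Longrightarrow> \<alpha>3 X = 0 \<Longrightarrow> X = 0"
    "\<And>x y z. \<exists>X. \<alpha>1 X = x \<and> \<alpha>2 X = y \<and> \<alpha>3 X = z"
proof -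
  have dim': "dim (UNIV :: 'a set) = Suc 5" using dim by simp
  have J0: "J 0 = 0" using J(1) by (rule linear_0)
  have Z: "Z \<noteq> 0" using \<alpha>1 linear_0 unfolding form10_def by force
  have small: "\<exists>v. v \<notin> span B" if "finite B" "card B < 6" for B :: "'a set"
  proof (rule ccontr)
    assume "\<nexists>v. v \<notin> span B"
    then have "UNIV \<subseteq> span B" by blast
    moreover obtain S :: "'a set" where "independent S" "card S = dim (UNIV :: 'a set)"
      using basis_exists[of "UNIV :: 'a set"] by metis
    ultimately have "card S \<le> card B" using independent_span_bound[of B S] that by blast
    then show False using \<open>card S = _\<close> dim that by simp
  qed
  define B1 where "B1 = {J Z, Z}"
  have B1: "independent B1" "finite B1" "\<And>X. X \<in> span B1 \<Longrightarrow> J X \<in> span B1" "card B1 = 2"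
    using complex_line_extend[OF J, of "{}" Z] Z J0 unfolding B1_def by (simp_all add: independent_empty)
  obtain v2 where v2: "v2 \<notin> span B1" using small[of B1] B1 by auto
  define B2 where "B2 = insert (J v2) (insert v2 B1)"
  have B2: "independent B2" "finite B2" "\<And>X. X \<in> span B2 \<Longrightarrow> J X \<in> span B2" "card B2 = 4"
    using complex_line_extend[OF J B1(1-3) v2] B1(4) unfolding B2_def by auto
  obtain v3 where v3: "v3 \<notin> span B2" using small[of B2] B2 by auto
  define B3 where "B3 = insert (J v3) (insert v3 B2)"
  have B3: "independent B3" "card B3 = 6"
    using complex_line_extend[OF J B2(1-3) v3] B2(4) unfolding B3_def by auto
  have span3: "span B3 = UNIV" using independent_card_eq_dim_spans[OF dim' B3(1)] B3(2) by simp
  have distinct: "card {J v3, v3, J v2, v2, J Z, Z} = 6"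
    using B3(2) unfolding B3_def B2_def B1_def .
  have ne: "J v3 \<noteq> v3" "J v3 \<noteq> J v2" "J v3 \<noteq> v2" "J v3 \<noteq> J Z" "J v3 \<noteq> Z" "v3 \<noteq> J v2" "v3 \<noteq> v2" "v3 \<noteq> J Z" "v3 \<noteq> Z"
      "J v2 \<noteq> v2" "J v2 \<noteq> J Z" "J v2 \<noteq> Z" "v2 \<noteq> J Z" "v2 \<noteq> Z"
    using distinct by (auto simp: card_insert_if split: if_splits)
  have functional: "\<exists>c::'a \<Rightarrow> real. linear c \<and> (\<forall>x\<in>B3. c x = (if x = v then 1 else 0))" for v
    by (rule linear_independent_extend[OF B3(1)])
  obtain c2 :: "'a \<Rightarrow> real" where c2: "linear c2" "\<And>x. x \<in> B3 \<Longrightarrow> c2 x = (if x = v2 then 1 else 0)"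
    using functional by metis
  obtain c3 :: "'a \<Rightarrow> real" where c3: "linear c3" "\<And>x. x \<in> B3 \<Longrightarrow> c3 x = (if x = v3 then 1 else 0)"
    using functional by metis
  \<comment> \<open>The projection of a real functional to type (1,0) is
    \<open>c - \<i> * (c o J)\<close>.\<close>
  have form: "form10 J (\<lambda>X. Complex (c X) (- c (J X)))" if "linear c" for c :: "'a \<Rightarrow> real"
    unfolding form10_def using that J
    by (auto intro!: linearI simp: linear_add linear_scale linear_neg complex_eq_iff)
  define \<alpha>2 \<alpha>3 where "\<alpha>2 X = Complex (c2 X) (- c2 (J X))" and "\<alpha>3 X = Complex (c3 X) (- c3 (J X))" for X
  have f: "form10 J \<alpha>2" "form10 J \<alpha>3"
    using form[OF c2(1)] form[OF c3(1)] unfolding \<alpha>2_def[abs_def] \<alpha>3_def[abs_def] .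
  have mem: "J v3 \<in> B3" "v3 \<in> B3" "J v2 \<in> B3" "v2 \<in> B3" "J Z \<in> B3" "Z \<in> B3"
    by (simp_all add: B3_def B2_def B1_def)
  have val: "\<alpha>2 Z = 0" "\<alpha>3 Z = 0" "\<alpha>2 v2 = 1" "\<alpha>3 v2 = 0" "\<alpha>2 v3 = 0" "\<alpha>3 v3 = 1"
    using ne by (auto simp: \<alpha>2_def \<alpha>3_def c2(2) c3(2) mem complex_eq_iff)
  define C where "C z X = Re z *\<^sub>R X + Im z *\<^sub>R J X" for z X
  have C: "\<alpha> (C z X) = z * \<alpha> X" if "form10 J \<alpha>" for \<alpha> z X
    unfolding C_def form10_add[OF that] form10_scaleR[OF that] form10_J[OF that]
    by (simp add: complex_eq_iff algebra_simps)
  note add = form10_add[OF \<alpha>1(1)] form10_add[OF f(1)] form10_add[OF f(2)]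
  note Cs = C[OF \<alpha>1(1)] C[OF f(1)] C[OF f(2)]
  have dec: "\<exists>x y z. X = C x Z + C y v2 + C z v3" for X
  proof -
    have "X \<in> span B3" using span3 by simp
    then obtain p q r s t u where
      "X - p *\<^sub>R J v3 - q *\<^sub>R v3 - r *\<^sub>R J v2 - s *\<^sub>R v2 - t *\<^sub>R J Z - u *\<^sub>R Z = 0"
      unfolding B3_def B2_def B1_def span_breakdown_eq span_empty by blast
    then have "X = C (Complex u t) Z + C (Complex s r) v2 + C (Complex q p) v3"
      by (simp add: C_def algebra_simps)
    then show ?thesis by blast
  qed
  show thesis
  proof (rule that[OF f val(1,2)])
    fix X assume 0: "\<alpha>1 X = 0" "\<alpha>2 X = 0" "\<alpha>3 X = 0"
    obtain x y z where X: "X = C x Z + C y v2 + C z v3" using dec by blast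
    have "y = 0" "z = 0" using 0(2,3) unfolding X add Cs val by simp_all
    moreover from this have "x = 0" using 0(1) unfolding X add Cs \<alpha>1(2) by simp
    ultimately show "X = 0" unfolding X by (simp add: C_def)
  next
    fix x y z
    \<comment> \<open>\<alpha>1 is prescribed and may be nonzero on \<open>v2\<close> and
      \<open>v3\<close>, which is corrected along \<open>Z\<close>.\<close>
    define X where "X = C (x - y * \<alpha>1 v2 - z * \<alpha>1 v3) Z + C y v2 + C z v3"
    have "\<alpha>1 X = x \<and> \<alpha>2 X = y \<and> \<alpha>3 X = z" unfolding X_def add Cs \<alpha>1(2) val by simp
    then show "\<exists>X. \<alpha>1 X = x \<and> \<alpha>2 X = y \<and> \<alpha>3 X = z" by blast
  qed
qed


lemma frame_exists_if_central:
  fixes br :: "'a::real_vector \<Rightarrow> 'a \<Rightarrow> 'a" and \<nu> :: "'a \<Rightarrow> real"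
  assumes lie: "lie_algebra br" and dim: "dim (UNIV :: 'a set) = 6" and cs: "complex_structure br J"
    and \<nu>: "linear \<nu>" "\<And>X. X \<in> N \<longleftrightarrow> \<nu> X = 0" "\<nu> (J Z) = 1"
    and N: "\<And>X Y. Y \<in> N \<Longrightarrow> br X Y \<in> N" "\<And>X Y. X \<in> N \<Longrightarrow> Y \<in> N \<Longrightarrow> br X Y \<in> span {Z}"
    and Z: "Z \<in> N" "\<And>X. br X Z = 0"
  shows "\<exists>a b c d h k g. frame br J N a b c d h k g"
proof -
  have J: "linear J" "\<And>X. J (J X) = - X"
    and nij: "\<And>X Y. br X Y + J (br (J X) Y) + J (br X (J Y)) - br (J X) (J Y) = 0"
    using cs unfolding complex_structure_def by blast+
  have linr: "linear (br X)" and linl: "linear (\<lambda>X. br X Y)" and alt: "br X X = 0" for X Y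
    using lie unfolding lie_algebra_def by blast+
  have br_simps: "br X (Y + Y') = br X Y + br X Y'" "br (X + X') Y = br X Y + br X' Y"
    "br X (r *\<^sub>R Y) = r *\<^sub>R br X Y" "br (r *\<^sub>R X) Y = r *\<^sub>R br X Y" for X X' Y Y' r
    using linear_add[OF linr] linear_add[OF linl] linear_scale[OF linr] linear_scale[OF linl] by blast+
  have anti: "br X Y = - br Y X" for X Y
    using alt[of "X + Y"] unfolding br_simps by (simp add: alt eq_neg_iff_add_eq_0 add.commute)
  have J_simps: "J (X + Y) = J X + J Y" "J (r *\<^sub>R X) = r *\<^sub>R J X" "J (- X) = - J X" "J 0 = 0" for X Y r
    using J(1) by (simp_all add: linear_add linear_scale linear_neg linear_0)
  have \<nu>_simps: "\<nu> (X + Y) = \<nu> X + \<nu> Y" "\<nu> (r *\<^sub>R X) = r * \<nu> X" "\<nu> (- X) = - \<nu> X" "\<nu> 0 = 0" for X Y r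
    using \<nu>(1) by (simp_all add: linear_add linear_scale linear_neg linear_0)
  have Z': "br Z X = 0" for X using anti[of Z X] Z(2) by simp
  have \<nu>Z: "\<nu> Z = 0" using Z(1) \<nu>(2) by blast
  define W where "W = J Z"
  \<comment> \<open>The (1,0)-form with imaginary part \<nu>, so that \<open>N\<close> is the kernel
    of \<open>Im \<alpha>1\<close>.\<close>
  define \<alpha>1 where "\<alpha>1 X = Complex (\<nu> (J X)) (\<nu> X)" for X
  have \<alpha>1: "form10 J \<alpha>1"
    unfolding form10_def \<alpha>1_def by (auto intro!: linearI simp: J_simps J(2) \<nu>_simps complex_eq_iff)
  have \<alpha>1Z: "\<alpha>1 Z = 1" by (simp add: \<alpha>1_def \<nu>(3) \<nu>Z complex_eq_iff)
  obtain \<alpha>2 \<alpha>3 where f: "form10 J \<alpha>2" "form10 J \<alpha>3" and fZ: "\<alpha>2 Z = 0" "\<alpha>3 Z = 0"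
    and inj: "\<And>X. \<alpha>1 X = 0 \<Longrightarrow> \<alpha>2 X = 0 \<Longrightarrow> \<alpha>3 X = 0 \<Longrightarrow> X = 0"
    and surj: "\<And>x y z. \<exists>X. \<alpha>1 X = x \<and> \<alpha>2 X = y \<and> \<alpha>3 X = z"
    by (rule coframe_exists[OF dim J \<alpha>1 \<alpha>1Z]) blast
  have basis: "basis10 J \<alpha>1 \<alpha>2 \<alpha>3"
    using \<alpha>1 f inj surj by (rule basis10_if_coordinates)
  have expand: "\<exists>b c. \<forall>X. \<beta> X = b * \<alpha>2 X + c * \<alpha>3 X" if "form10 J \<beta>" "\<beta> Z = 0" for \<beta>
  proof -
    obtain a b c where abc: "\<And>X. \<beta> X = a * \<alpha>1 X + b * \<alpha>2 X + c * \<alpha>3 X"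
      using basis \<open>form10 J \<beta>\<close> unfolding basis10_def by blast
    have "a = 0" using abc[of Z] that(2) \<alpha>1Z fZ by simp
    then show ?thesis using abc by auto
  qed
  have \<nu>W: "\<nu> W = 1" using \<nu>(3) by (simp add: W_def)
  \<comment> \<open>Integrability at the central element \<open>Z\<close>: the two terms containing
    a bracket with \<open>Z\<close> drop out.\<close>
  have JW: "br W (J X) = J (br W X)" for X
    using nij[of Z X] by (simp add: Z' J_simps W_def)
  \<comment> \<open>\<open>N\<close> is an ideal of codimension one, so the quotient is abelian and
    all brackets lie in \<open>N\<close>.\<close>
  have br\<nu>: "\<nu> (br X Y) = 0" for X Y
  proof -
    define Y' where "Y' = Y + (- \<nu> Y) *\<^sub>R W"
    have "\<nu> Y' = 0" unfolding Y'_def \<nu>_simps \<nu>W by simp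
    then have Y': "Y' \<in> N" by (simp only: \<nu>(2))
    define X' where "X' = X + (- \<nu> X) *\<^sub>R W"
    have "\<nu> X' = 0" unfolding X'_def \<nu>_simps \<nu>W by simp
    then have X': "X' \<in> N" by (simp only: \<nu>(2))
    have "\<nu> (br X Y') = 0" "\<nu> (br W X') = 0" using N(1) X' Y' \<nu>(2) by blast+
    moreover have "Y = Y' + \<nu> Y *\<^sub>R W" "X = X' + \<nu> X *\<^sub>R W" by (simp_all add: Y'_def X'_def)
    then have "br X Y = br X Y' + \<nu> Y *\<^sub>R br X W" "br X W = br X' W"
      using br_simps alt by (metis, metis add.right_neutral scaleR_zero_right)
    moreover have "br X' W = - br W X'" by (rule anti)
    ultimately show ?thesis by (simp add: \<nu>_simps linear_diff[OF \<nu>(1)])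
  qed
  have \<alpha>1W: "\<alpha>1 (br W X) = 0" for X
    using br\<nu>[of W X] br\<nu>[of W "J X"] by (simp add: \<alpha>1_def JW complex_eq_iff)
  \<comment> \<open>Projection onto \<open>N\<close> along \<open>W\<close>. Brackets inside
    \<open>N\<close> are multiples of \<open>Z\<close>, invisible to \<alpha>2 and \<alpha>3, so
    only \<open>ad W\<close> matters for them.\<close>
  define \<pi> where "\<pi> X = X + (- \<nu> X) *\<^sub>R W" for X
  have \<pi>N: "\<pi> X \<in> N" for X unfolding \<nu>(2) \<pi>_def \<nu>_simps \<nu>W by simp
  have br_dec: "br X Y = br (\<pi> X) (\<pi> Y) + (\<nu> X *\<^sub>R br W Y + (- \<nu> Y) *\<^sub>R br W X)" for X Y
    unfolding \<pi>_def br_simps alt anti[of X W] by (simp add: algebra_simps)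
  have \<alpha>N1: "\<alpha> X = 0" if "form10 J \<alpha>" "\<alpha> Z = 0" "X \<in> span {Z}" for \<alpha> X
    using that(3) form10_scaleR[OF that(1)] that(2) by (auto simp: span_singleton)
  have br23: "\<alpha> (br X Y) = \<nu> X * \<alpha> (br W Y) - \<nu> Y * \<alpha> (br W X)"
    if "form10 J \<alpha>" "\<alpha> Z = 0" for \<alpha> :: "'a \<Rightarrow> complex" and X Y
    using arg_cong[OF br_dec[of X Y], of \<alpha>] \<alpha>N1[OF that N(2)[OF \<pi>N \<pi>N]]
    unfolding form10_add[OF that(1)] form10_scaleR[OF that(1)] by simp
  have adform: "form10 J (\<lambda>X. \<alpha> (br W X))" if "form10 J \<alpha>" for \<alpha>
    unfolding form10_def using that
    by (auto intro!: linearI simp: br_simps form10_add[OF that] form10_scaleR[OF that] form10_J[OF that] JW scaleR_conv_of_real)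
  obtain q2 r2 where 2: "\<And>X. \<alpha>2 (br W X) = q2 * \<alpha>2 X + r2 * \<alpha>3 X"
    using expand[OF adform[OF f(1)]] f(1) Z(2) by (auto simp: form10_def linear_0)
  obtain q3 r3 where 3: "\<And>X. \<alpha>3 (br W X) = q3 * \<alpha>2 X + r3 * \<alpha>3 X"
    using expand[OF adform[OF f(2)]] f(2) Z(2) by (auto simp: form10_def linear_0)

  define \<omega> where "\<omega> X Y = \<nu> (J (br X Y))" for X Y
  have \<alpha>1br: "\<alpha>1 (br X Y) = of_real (\<omega> X Y)" for X Y
    by (simp add: \<alpha>1_def \<omega>_def br\<nu> complex_eq_iff)
  have \<omega>_simps: "\<omega> (X + X') Y = \<omega> X Y + \<omega> X' Y" "\<omega> X (Y + Y') = \<omega> X Y + \<omega> X Y'"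
    "\<omega> (r *\<^sub>R X) Y = r * \<omega> X Y" "\<omega> X (r *\<^sub>R Y) = r * \<omega> X Y" "\<omega> (- X) Y = - \<omega> X Y" "\<omega> X (- Y) = - \<omega> X Y" for X X' Y Y' r
    by (simp_all add: \<omega>_def br_simps J_simps \<nu>_simps linear_neg[OF linr] linear_neg[OF linl])
  have \<omega>_anti: "\<omega> Y X = - \<omega> X Y" for X Y
    unfolding \<omega>_def by (subst anti) (simp add: J_simps \<nu>_simps)
  \<comment> \<open>The \<alpha>1-component of integrability: its real and imaginary parts say that
    \<omega> is \<open>J\<close>-invariant, that is, of type (1,1).\<close>
  have "\<alpha>1 (br X Y + J (br (J X) Y) + J (br X (J Y)) + (- 1) *\<^sub>R br (J X) (J Y)) = 0" for X Y
    using nij[of X Y] \<alpha>1 by (simp add: form10_def linear_0)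
  then have "of_real (\<omega> X Y) + \<i> * of_real (\<omega> (J X) Y) + \<i> * of_real (\<omega> X (J Y)) - complex_of_real (\<omega> (J X) (J Y)) = 0" for X Y
    unfolding form10_add[OF \<alpha>1] form10_scaleR[OF \<alpha>1] form10_J[OF \<alpha>1] \<alpha>1br by simp
  then have "\<omega> X Y = \<omega> (J X) (J Y) \<and> \<omega> (J X) Y + \<omega> X (J Y) = 0" for X Y
    by (simp add: complex_eq_iff)
  then have \<omega>J: "\<omega> (J X) (J Y) = \<omega> X Y" "\<omega> X (J Y) = - \<omega> (J X) Y" for X Y
    by (metis, metis add.commute eq_neg_iff_add_eq_0)
  \<comment> \<open>\<open>Z\<close> and \<open>J Z\<close> lie in the radical of \<omega>, so the
    Hermitian form can be expressed through \<alpha>2 and \<alpha>3.\<close>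
  have \<omega>Z: "\<omega> Z Y = 0" "\<omega> Y Z = 0" "\<omega> (J Z) Y = 0" "\<omega> Y (J Z) = 0" for Y
    using \<alpha>1br[of Z Y] \<alpha>1br[of Y Z] \<alpha>1W[of Y] \<alpha>1br[of W Y] \<omega>_anti[of W Y] \<alpha>1
    by (auto simp: Z' Z(2) W_def form10_def linear_0)
  \<comment> \<open>The Hermitian form with imaginary part \<open>\<omega>\<close>.\<close>
  define \<theta> where "\<theta> Y X = Complex (\<omega> (J X) Y) (\<omega> X Y)" for X Y
  have \<theta>form: "form10 J (\<theta> Y)" for Y
    unfolding form10_def \<theta>_def[abs_def] by (auto intro!: linearI simp: J_simps J(2) \<omega>_simps complex_eq_iff)
  have \<theta>herm: "\<theta> X Y = cnj (\<theta> Y X)" for X Y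
    using \<omega>J(2)[of X Y] \<omega>_anti[of X Y] \<omega>_anti[of X "J Y"] by (simp add: \<theta>_def complex_eq_iff)
  have \<theta>Z: "\<theta> Y Z = 0" "\<theta> Z Y = 0" for Y by (simp_all add: \<theta>_def \<omega>Z complex_eq_iff)
  obtain X2 where X2: "\<alpha>2 X2 = 1" "\<alpha>3 X2 = 0" using surj by metis
  obtain X3 where X3: "\<alpha>2 X3 = 0" "\<alpha>3 X3 = 1" using surj by metis
  have \<theta>exp: "\<theta> Y X = \<theta> Y X2 * \<alpha>2 X + \<theta> Y X3 * \<alpha>3 X" for X Y
  proof -
    obtain b c where bc: "\<And>X. \<theta> Y X = b * \<alpha>2 X + c * \<alpha>3 X" using expand[OF \<theta>form \<theta>Z(1)] by blast
    then show ?thesis using bc[of X2] bc[of X3] X2 X3 by simp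
  qed
  define h k g where "h = Re (\<theta> X2 X2)" and "k = Re (\<theta> X3 X3)" and "g = \<theta> X3 X2"
  have real: "\<theta> X2 X2 = of_real h" "\<theta> X3 X3 = of_real k"
    using \<theta>herm[of X2 X2] \<theta>herm[of X3 X3] by (simp_all add: h_def k_def complex_eq_iff)
  have g': "\<theta> X2 X3 = cnj g" unfolding g_def by (rule \<theta>herm)
  have \<theta>2: "\<theta> Y X2 = h * cnj (\<alpha>2 Y) + g * cnj (\<alpha>3 Y)" for Y
    unfolding \<theta>herm[of Y X2] \<theta>exp[of X2 Y] real g' by simp
  have \<theta>3: "\<theta> Y X3 = cnj g * cnj (\<alpha>2 Y) + k * cnj (\<alpha>3 Y)" for Y
    unfolding \<theta>herm[of Y X3] \<theta>exp[of X3 Y] real g_def[symmetric] by simp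
  have \<omega>\<theta>: "of_real (\<omega> X Y) = - (\<i> / 2) * (\<theta> Y X - cnj (\<theta> Y X))" for X Y
    by (simp add: \<theta>_def complex_eq_iff)
  have \<alpha>1form: "\<alpha>1 (br X Y) = - hform (h / 2) (k / 2) (g / 2) (\<alpha>2 X) (\<alpha>3 X) (\<alpha>2 Y) (\<alpha>3 Y)" for X Y
    unfolding \<alpha>1br \<omega>\<theta> \<theta>exp[of Y X] \<theta>2 \<theta>3 by (simp add: hform_def algebra_simps add_divide_distrib diff_divide_distrib)
  have Im\<alpha>1: "Im (\<alpha>1 X) = \<nu> X" for X by (simp add: \<alpha>1_def)
  have scale: "2 * \<i> * ((\<i> / 2 * q * u + \<i> / 2 * r * v) * y - (\<i> / 2 * q * u' + \<i> / 2 * r * v') * x)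
      = x * (q * u' + r * v') - y * (q * u + r * v)" for q r u v u' v' x y
  proof -
    have "2 * \<i> * ((\<i> / 2 * q * u + \<i> / 2 * r * v) * y - (\<i> / 2 * q * u' + \<i> / 2 * r * v') * x)
      = (2 * \<i> * (\<i> / 2)) * ((q * u + r * v) * y - (q * u' + r * v') * x)"
      by (simp only: ring_distribs mult.assoc)
    also have "2 * \<i> * (\<i> / 2) = - 1" by simp
    finally show ?thesis by (simp add: mult.commute)
  qed
  \<comment> \<open>The factor \<open>\<i> / 2\<close> inverts the factor \<open>- 2 * \<i>\<close>
    between coefficients and \<open>ad W\<close>. The halves come from writing \<omega> as the
    imaginary part of \<theta>.\<close>
  have "adapted br J N \<alpha>1 \<alpha>2 \<alpha>3 (\<i> / 2 * q2) (\<i> / 2 * r2) (\<i> / 2 * q3) (\<i> / 2 * r3) (h / 2) (k / 2) (g / 2)"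
    unfolding adapted_def
  proof (intro conjI allI impI)
    fix X Y
    show "X \<in> N \<longleftrightarrow> Im (\<alpha>1 X) = 0" unfolding Im\<alpha>1 by (rule \<nu>(2))
    show "\<alpha>2 (br X Y) = 2 * \<i> * ((\<i> / 2 * q2 * \<alpha>2 X + \<i> / 2 * r2 * \<alpha>3 X) * Im (\<alpha>1 Y)
        - (\<i> / 2 * q2 * \<alpha>2 Y + \<i> / 2 * r2 * \<alpha>3 Y) * Im (\<alpha>1 X))"
      using br23[OF f(1) fZ(1), of X Y] unfolding 2 Im\<alpha>1 scale .
    show "\<alpha>3 (br X Y) = 2 * \<i> * ((\<i> / 2 * q3 * \<alpha>2 X + \<i> / 2 * r3 * \<alpha>3 X) * Im (\<alpha>1 Y)
        - (\<i> / 2 * q3 * \<alpha>2 Y + \<i> / 2 * r3 * \<alpha>3 Y) * Im (\<alpha>1 X))"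
      using br23[OF f(2) fZ(2), of X Y] unfolding 3 Im\<alpha>1 scale .
  qed (use inj in \<open>blast intro: \<alpha>1 f surj \<alpha>1form\<close>)+
  then show ?thesis unfolding frame_def by blast
qed

section \<open>From the hypotheses on the nilradical to a coframe\<close>

lemma nilradical_unique: "is_nilradical br N \<Longrightarrow> is_nilradical br N' \<Longrightarrow> N = N'"
  unfolding is_nilradical_def by blast

lemma bracket_ideal:
  assumes lie: "lie_algebra br" and N: "\<And>X Y. Y \<in> N \<Longrightarrow> br X Y \<in> N" and Y: "Y \<in> bracket_span br N N"
  shows "br X Y \<in> bracket_span br N N"
proof -
  have linr: "linear (br X)" and linl: "linear (\<lambda>X. br X Y)" and alt: "br X X = 0"
    and jacobi: "br X (br Y Z) + br Y (br Z X) + br Z (br X Y) = 0" for X Y Z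
    using lie unfolding lie_algebra_def by blast+
  have anti: "br X Y = - br Y X" for X Y
    using alt[of "X + Y"] unfolding linear_add[OF linr] linear_add[OF linl]
    by (simp add: alt eq_neg_iff_add_eq_0 add.commute)
  have base: "br X (br P Q) \<in> bracket_span br N N" if "P \<in> N" "Q \<in> N" for P Q
  proof -
    have "br X (br P Q) = - br P (br Q X) - br Q (br X P)"
      using jacobi[of X P Q] by (simp add: algebra_simps eq_neg_iff_add_eq_0)
    then have "br X (br P Q) = br P (br X Q) - br Q (br X P)"
      using anti[of Q X] linear_neg[OF linr] by simp
    moreover have "br P (br X Q) \<in> bracket_span br N N" "br Q (br X P) \<in> bracket_span br N N"
      unfolding bracket_span_def using that N by (auto intro!: span_base)
    ultimately show ?thesis
      unfolding bracket_span_def by (simp add: span_diff)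
  qed
  have "subspace {Y. br X Y \<in> bracket_span br N N}"
    using linr[of X] unfolding bracket_span_def
    by (auto intro!: subspaceI simp: linear_0 linear_add linear_scale span_add span_scale span_zero)
  then have "bracket_span br N N \<subseteq> {Y. br X Y \<in> bracket_span br N N}"
    by (rule bracket_span_subset) (use base in auto)
  then show ?thesis using Y by blast
qed

lemma subspace_dim_1:
  assumes "subspace S" "dim S = 1"
  obtains Z where "Z \<noteq> 0" "S = span {Z}"
proof -
  obtain B where B: "B \<subseteq> S" "independent B" "S \<subseteq> span B" "card B = dim S"
    using basis_exists by metis
  then obtain Z where "B = {Z}" using assms(2) card_1_singletonE by metis
  moreover have "span B = S" using B assms(1) by (simp add: span_minimal subset_antisym)
  moreover have "Z \<noteq> 0" using B(2) \<open>B = {Z}\<close> by (simp add: dependent_zero) 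
  ultimately show thesis using that by blast
qed

lemma hyperplane_functional:
  fixes N :: "'a::real_vector set"
  assumes "dim (UNIV :: 'a set) = Suc n" and N: "subspace N" "dim N = n" and W: "W \<notin> N"
  obtains \<nu> :: "'a \<Rightarrow> real" where "linear \<nu>" "\<And>X. X \<in> N \<longleftrightarrow> \<nu> X = 0" "\<nu> W = 1"
proof -
  obtain C where C: "C \<subseteq> N" "independent C" "N \<subseteq> span C" "card C = n"
    using basis_exists[of N] N(2) by metis
  have spanC: "span C = N" using C N(1) by (simp add: span_minimal subset_antisym)
  have ind: "independent (insert W C)" using C(2) W spanC by (intro independent_insertI) auto
  have "finite C" using independent_card_le_dim(1)[OF assms(1) C(2)] .
  moreover have WC: "W \<notin> C" using W C(1) by blast
  ultimately have "span (insert W C) = UNIV"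
    using C(4) by (intro independent_card_eq_dim_spans[OF assms(1) ind]) simp
  obtain \<nu> :: "'a \<Rightarrow> real" where \<nu>: "linear \<nu>" "\<forall>x\<in>insert W C. \<nu> x = (if x = W then 1 else 0)"
    using linear_independent_extend[OF ind, of "\<lambda>x. if x = W then 1 else 0"] by blast
  have 0: "\<nu> X = 0" if "X \<in> N" for X
    by (rule linear_eq_0_on_span[OF \<nu>(1), of C]) (use \<nu>(2) WC that spanC in auto)
  have "X \<in> N" if "\<nu> X = 0" for X
  proof -
    have "X \<in> span (insert W C)" using \<open>span (insert W C) = UNIV\<close> by simp
    then obtain t where t: "X - t *\<^sub>R W \<in> N" unfolding span_breakdown_eq spanC by blast
    have "\<nu> (X - t *\<^sub>R W) = - t" using that \<nu> by (simp add: linear_diff linear_scale)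
    then have "t = 0" using 0[OF t] by simp
    then show ?thesis using t by simp
  qed
  then show thesis using that[OF \<nu>(1)] 0 \<nu>(2) by auto
qed

lemma setting_if_hypotheses:
  fixes br :: "'a::real_vector \<Rightarrow> 'a \<Rightarrow> 'a" and N :: "'a set" and J :: "'a \<Rightarrow> 'a"
  assumes lie: "lie_algebra br" and dim: "dim (UNIV :: 'a set) = 6"
    and su: "strongly_unimodular br" and an: "almost_nilpotent br"
    and nr: "is_nilradical br N" and dim1: "dim (lower_central br N 1) = 1"
    and cs: "complex_structure br J" and JN: "\<not> J ` lower_central br N 1 \<subseteq> N"
  shows "setting br J N"
proof -
  have dim': "dim (UNIV :: 'a set) = Suc 5" using dim by simp
  have linr: "linear (br X)" for X using lie unfolding lie_algebra_def by blast
  obtain N' where N': "is_nilradical br N'" "dim N' + 1 = dim (UNIV :: 'a set)"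
    using an unfolding almost_nilpotent_def by blast
  have dimN: "dim N = 5" using nilradical_unique[OF nr N'(1)] N'(2) dim by simp
  obtain N'' where "is_nilradical br N''"
    "\<forall>X k. quot_trace (br X) (lower_central br N'' k) (lower_central br N'' (Suc k)) = 0"
    using su unfolding strongly_unimodular_def by blast
  then have tr: "quot_trace (br X) (lower_central br N k) (lower_central br N (Suc k)) = 0" for X k
    using nilradical_unique[OF nr] by metis
  have N: "subspace N" "\<And>X Y. Y \<in> N \<Longrightarrow> br X Y \<in> N"
    using nr unfolding is_nilradical_def nilpotent_ideal_def by blast+
  obtain m where m: "lower_central br N m = {0}"
    using nr unfolding is_nilradical_def nilpotent_ideal_def by blast
  let ?N1 = "lower_central br N 1"
  have N1_eq: "?N1 = bracket_span br N N" by simp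
  have subN1: "subspace ?N1" by (rule subspace_lower_central[OF N(1)])
  obtain Z where Z: "Z \<noteq> 0" "?N1 = span {Z}" using subspace_dim_1[OF subN1 dim1] by blast
  have ideal: "br X Y \<in> ?N1" if "Y \<in> ?N1" for X Y
    using bracket_ideal[OF lie N(2)] that unfolding N1_eq by blast
  have N1N: "?N1 \<subseteq> N" unfolding N1_eq by (rule bracket_span_subset[OF N(1)]) (rule N(2))
  have ZN1: "Z \<in> ?N1" unfolding Z(2) by (simp add: span_base)
  have ex: "\<exists>t. br X Z = t *\<^sub>R Z" for X
    using ideal[OF ZN1, of X] unfolding Z(2) by (auto simp: span_singleton)
  \<comment> \<open>A nonzero scalar would keep \<open>Z\<close> in every term of the lower central
    series of \<open>N\<close>, against nilpotency.\<close>
  have ZN: "br X Z = 0" if X: "X \<in> N" for X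
  proof (rule ccontr)
    assume "br X Z \<noteq> 0"
    moreover obtain t where t: "br X Z = t *\<^sub>R Z" using ex by blast
    ultimately have "t \<noteq> 0" by auto
    have "Z \<in> lower_central br N k" for k
    proof (induction k)
      case 0
      then show ?case using ZN1 N1N by auto
    next
      case (Suc k)
      then have "t *\<^sub>R Z \<in> lower_central br N (Suc k)"
        using X unfolding t[symmetric] by (auto simp: bracket_span_def intro!: span_base)
      then have "inverse t *\<^sub>R t *\<^sub>R Z \<in> lower_central br N (Suc k)"
        by (rule subspace_scale[OF subspace_lower_central[OF N(1)]])
      then show ?case using \<open>t \<noteq> 0\<close> by simp
    qed
    then show False using m Z(1) by auto
  qed
  have "lower_central br N (Suc 1) \<subseteq> {0}"
    unfolding lower_central.simps(2)[of _ _ 1]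
  proof (rule bracket_span_subset)
    fix X Y assume X: "X \<in> N" and "Y \<in> ?N1"
    then obtain t where "Y = t *\<^sub>R Z" unfolding Z(2) by (auto simp: span_singleton)
    then show "br X Y \<in> {0}" using ZN[OF X] linear_scale[OF linr] by simp
  qed simp
  moreover have "0 \<in> lower_central br N (Suc 1)"
    using subspace_lower_central[OF N(1)] by (rule subspace_0)
  ultimately have N2: "lower_central br N (Suc 1) = {0}" by blast
  have "independent {Z}" using Z(1) by simp
  then obtain \<zeta> :: "'a \<Rightarrow> real" where \<zeta>: "linear \<zeta>" "\<zeta> Z = 1"
    using linear_independent_extend[of "{Z}" "\<lambda>_. 1::real"] by auto
  \<comment> \<open>Strong unimodularity at \<open>k = 1\<close>: the quotient is the line
    \<open>[N,N]\<close> itself, where the trace is the scalar by which \<open>X\<close>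
    acts.\<close>
  have central: "br X Z = 0" for X
  proof -
    obtain t where t: "br X Z = t *\<^sub>R Z" using ex by blast
    have "quot_trace (br X) ?N1 {0} = (\<Sum>i\<in>{()}. \<zeta> (br X Z))"
    proof (rule quot_trace_eq[OF dim' subN1 subspace_single_0])
      show "Y - (\<Sum>i\<in>{()}. \<zeta> Y *\<^sub>R Z) \<in> {0}" if Y: "Y \<in> ?N1" for Y
      proof -
        obtain s where "Y = s *\<^sub>R Z" using Y unfolding Z(2) by (auto simp: span_singleton)
        then show ?thesis using \<zeta> by (simp add: linear_scale)
      qed
    qed (use subN1 ideal linr \<zeta> ZN1 in \<open>auto simp: subspace_0 linear_0\<close>)
    then have "\<zeta> (br X Z) = 0" using tr[of X 1] unfolding N2 by simp
    then show ?thesis using t \<zeta> by (simp add: linear_scale)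
  qed
  have J: "linear J" using cs unfolding complex_structure_def by blast
  have "J Z \<notin> N"
  proof
    assume "J Z \<in> N"
    then have "J ` ?N1 \<subseteq> N"
      unfolding Z(2) using N(1) J by (auto simp: span_singleton linear_scale intro: subspace_scale)
    then show False using JN by blast
  qed
  then obtain \<nu> :: "'a \<Rightarrow> real" where \<nu>: "linear \<nu>" "\<And>X. X \<in> N \<longleftrightarrow> \<nu> X = 0" "\<nu> (J Z) = 1"
    using hyperplane_functional[OF dim' N(1) dimN] by blast
  have brN: "br X Y \<in> span {Z}" if "X \<in> N" "Y \<in> N" for X Y
    unfolding Z(2)[symmetric] N1_eq using that by (auto simp: bracket_span_def intro!: span_base)
  have ZinN: "Z \<in> N" using ZN1 N1N by blast
  have N10: "?N1 \<noteq> {0}" using ZN1 Z(1) by blast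
  show ?thesis
  proof
    show "lie_algebra br" "is_nilradical br N" "?N1 \<noteq> {0}" by fact+
    show "\<exists>a b c d h k g. frame br J N a b c d h k g"
      using frame_exists_if_central[OF lie dim cs \<nu> N(2) brN ZinN central] by blast
    show "Im (a + d) = 0" if "frame br J N a b c d h k g" for a b c d h k g
    proof (rule frame_trace[OF dim' lie N N10 ideal _ that])
      show "quot_trace (br X) N ?N1 = 0" for X using tr[of X 0] by simp
    qed
  qed
qed

theorem proposition3p4:
  fixes br :: "'a::real_vector \<Rightarrow> 'a \<Rightarrow> 'a" and N :: "'a set" and J :: "'a \<Rightarrow> 'a"
  assumes "lie_algebra br" and "dim (UNIV :: 'a set) = 6"
    and "strongly_unimodular br" and "almost_nilpotent br"
    and "is_nilradical br N" and "dim (lower_central br N 1) = 1"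
    and "complex_structure br J" and "\<not> J ` lower_central br N 1 \<subseteq> N"
  shows
   "(isomorphic_to br h3_s33 \<or> isomorphic_to br s47_R2 \<or> isomorphic_to br s6_44 \<or>
     (\<exists>q>0. isomorphic_to br (s6_52 q)) \<or> isomorphic_to br s6_159 \<or>
     isomorphic_to br s6_162_1 \<or> (\<exists>p>0. isomorphic_to br (s6_165 p)) \<or>
     (\<exists>p. 0 < \<bar>p\<bar> \<and> \<bar>p\<bar> \<le> 1 \<and> isomorphic_to br (s6_166 p)) \<or> isomorphic_to br s6_167) \<and>

    (isomorphic_to br h3_s33 \<longrightarrow>
      (\<exists>\<epsilon>\<in>{-1, 1}. admits_basis br J (\<lambda>\<alpha>1 \<alpha>2 \<alpha>3 \<sigma>.
        [(\<i> * \<epsilon>) \<odot> \<alpha>3 \<^bold>\<and> conj_form \<alpha>3,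
         - (\<alpha>2 \<^bold>\<and> \<sigma>),
         0]))) \<and>

    (isomorphic_to br s47_R2 \<longrightarrow>
      (\<exists>\<epsilon>\<in>{-1, 1}. admits_basis br J (\<lambda>\<alpha>1 \<alpha>2 \<alpha>3 \<sigma>.
        [(\<i> * \<epsilon>) \<odot> \<alpha>2 \<^bold>\<and> conj_form \<alpha>2,
         - (\<alpha>2 \<^bold>\<and> \<sigma>),
         0]))) \<and>

    (isomorphic_to br s6_44 \<longrightarrow>
      (\<exists>\<epsilon>\<in>{-1, 1}. admits_basis br J (\<lambda>\<alpha>1 \<alpha>2 \<alpha>3 \<sigma>.
        [(\<i> * \<epsilon>) \<odot> \<alpha>3 \<^bold>\<and> conj_form \<alpha>3,
         - ((\<lambda>X. \<alpha>2 X + \<i> * \<alpha>3 X) \<^bold>\<and> \<sigma>),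
         - (\<alpha>3 \<^bold>\<and> \<sigma>)]))) \<and>

    (\<forall>q>0. isomorphic_to br (s6_52 q) \<longrightarrow>
      (\<exists>\<delta>\<in>{-1, 1}. \<exists>\<epsilon>\<in>{-1, 1}. admits_basis br J (\<lambda>\<alpha>1 \<alpha>2 \<alpha>3 \<sigma>.
        [(\<i> * \<delta>) \<odot> \<alpha>2 \<^bold>\<and> conj_form \<alpha>2,
         - (\<alpha>2 \<^bold>\<and> \<sigma>),
         - ((\<epsilon> * complex_of_real q) \<odot> \<alpha>3 \<^bold>\<and> \<sigma>)]))) \<and>

    (isomorphic_to br s6_159 \<longrightarrow>
      (\<exists>\<delta>\<in>{-1, 1}. \<exists>\<epsilon>\<in>{-1, 1}. admits_basis br J (\<lambda>\<alpha>1 \<alpha>2 \<alpha>3 \<sigma>.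
        [(\<i> * \<delta>) \<odot> \<alpha>2 \<^bold>\<and> conj_form \<alpha>2 + (\<i> * \<epsilon>) \<odot> \<alpha>3 \<^bold>\<and> conj_form \<alpha>3,
         - (\<alpha>2 \<^bold>\<and> \<sigma>),
         0]))) \<and>

    (isomorphic_to br s6_162_1 \<longrightarrow>
      admits_basis br J (\<lambda>\<alpha>1 \<alpha>2 \<alpha>3 \<sigma>.
        [\<alpha>2 \<^bold>\<and> conj_form \<alpha>3 - \<alpha>3 \<^bold>\<and> conj_form \<alpha>2,
         - (\<i> \<odot> \<alpha>2 \<^bold>\<and> \<sigma>),
         \<i> \<odot> \<alpha>3 \<^bold>\<and> \<sigma>])) \<and>

    (\<forall>p>0. isomorphic_to br (s6_165 p) \<longrightarrow>
      admits_basis br J (\<lambda>\<alpha>1 \<alpha>2 \<alpha>3 \<sigma>.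
        [\<alpha>2 \<^bold>\<and> conj_form \<alpha>3 - \<alpha>3 \<^bold>\<and> conj_form \<alpha>2,
         - ((1 + \<i> * complex_of_real p) \<odot> \<alpha>2 \<^bold>\<and> \<sigma>),
         - ((1 - \<i> * complex_of_real p) \<odot> \<alpha>3 \<^bold>\<and> \<sigma>)])) \<and>

    (\<forall>p. 0 < \<bar>p\<bar> \<and> \<bar>p\<bar> \<le> 1 \<and> isomorphic_to br (s6_166 p) \<longrightarrow>
      (\<exists>\<delta>\<in>{-1, 1}. \<exists>\<epsilon>\<in>{-1, 1}. admits_basis br J (\<lambda>\<alpha>1 \<alpha>2 \<alpha>3 \<sigma>.
        [(\<i> * \<delta>) \<odot> \<alpha>2 \<^bold>\<and> conj_form \<alpha>2 + (\<i> * \<epsilon> * \<delta>) \<odot> \<alpha>3 \<^bold>\<and> conj_form \<alpha>3,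
         - (\<alpha>2 \<^bold>\<and> \<sigma>),
         - ((\<epsilon> * complex_of_real p) \<odot> \<alpha>3 \<^bold>\<and> \<sigma>)]))) \<and>

    (isomorphic_to br s6_167 \<longrightarrow>
      (\<exists>\<epsilon>\<in>{-1, 1}. \<exists>x::real. admits_basis br J (\<lambda>\<alpha>1 \<alpha>2 \<alpha>3 \<sigma>.
        [\<epsilon> \<odot> \<alpha>2 \<^bold>\<and> conj_form \<alpha>3 - \<epsilon> \<odot> \<alpha>3 \<^bold>\<and> conj_form \<alpha>2
           + (\<i> * complex_of_real x) \<odot> \<alpha>3 \<^bold>\<and> conj_form \<alpha>3,
         - ((\<lambda>X. \<alpha>2 X + \<i> * \<alpha>3 X) \<^bold>\<and> \<sigma>),
         - (\<alpha>3 \<^bold>\<and> \<sigma>)])))"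
proof -
  interpret setting br J N
    using assms by (rule setting_if_hypotheses)
  show ?thesis
    by (intro conjI isomorphism_class impI allI admits_h3_s33 admits_s47_R2 admits_s6_44 admits_s6_52 admits_s6_159
        admits_s6_162_1 admits_s6_165 admits_s6_166 admits_s6_167; (elim conjE)?; assumption)
qed

end
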